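(* Let $A_o\in\mathbb{R}^{n\times n}$ and $B\in\mathbb{R}^{n\times 1}$, let $\mu\neq0$ and $\sigma>0$ be real numbers, and consider the single-input full state feedback LTI system with input channel uncertainty $$\dot x=A_ox+B\hat u,\qquad \hat u=(\mu+\sigma\xi)v,\qquad v=Kx,$$ where $\xi=\frac{d\Delta}{dt}$ with $\Delta$ a standard scalar Wiener process and $K\in\mathbb{R}^{1\times n}$ is a static state feedback gain to be designed. Assume that all eigenvalues of $A_o$ lie in the open right-half plane (i.e. $-A_o$ is Hurwitz) and that the pair $(A_o,B)$ is stabilizable. Then there exists $K$ such that this system is mean square exponentially stable if and only if $$2\,\frac{\sigma^2}{\mu^2}\sum_i\lambda_i(A_o)<1,$$ where the sum runs over the eigenvalues $\lambda_i(A_o)$ of $A_o$ counted with multiplicity.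
   Context: The closed-loop system is interpreted as the Itô equation $dx=(A_o+\mu BK)x\,dt+\sigma BKx\,d\Delta$. It is mean square exponentially stable if there exist positive constants $\beta_1,\beta_2$ such that $E[x(t)^\top x(t)]\le\beta_1e^{-\beta_2t}E[x(0)^\top x(0)]$ for all $t\ge0$ and all $x(0)\in\mathbb{R}^n$. *)

theory Defs
  imports "HOL-Probability.Probability"
begin

subsection \<open>Eigenvalues, Hurwitz matrices, stabilizability\<close>

definition charpoly :: "real^'n^'n \<Rightarrow> complex poly" where
  "charpoly A = det (mat [:0, 1:] - (\<chi> i j. [:complex_of_real (A $ i $ j):]))"

text \<open>The complex eigenvalues, each repeated according to its algebraic multiplicity.
  Non-real ones occur in conjugate pairs, so their sum is real.\<close>

definition eigvals :: "real^'n^'n \<Rightarrow> complex multiset" where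
  "eigvals A = proots (charpoly A)"

definition hurwitz :: "real^'n^'n \<Rightarrow> bool" where
  "hurwitz A \<longleftrightarrow> (\<forall>z \<in># eigvals A. Re z < 0)"

definition stabilizable :: "real^'n^'n \<Rightarrow> real^'m^'n \<Rightarrow> bool" where
  "stabilizable A B \<longleftrightarrow> (\<exists>K :: real^'n^'m. hurwitz (A + B ** K))"


subsection \<open>Wiener process\<close>

text \<open>
  A standard scalar Wiener process on the time axis \<open>t \<ge> 0\<close>, relative to a filtration \<open>F\<close>
  (for instance the one it generates). The index type of \<open>F\<close> is \<open>real\<close>, but the values
  of \<open>F\<close> and \<open>W\<close> at negative times play no role.
\<close>

locale wiener_process = prob_space M + filtration "space M" F
  for M :: "'a measure" and F :: "real \<Rightarrow> 'a measure" +
  fixes W :: "real \<Rightarrow> 'a \<Rightarrow> real"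
  assumes F_subset: "\<And>t. sets (F t) \<subseteq> sets M"
    and adapted: "\<And>t. 0 \<le> t \<Longrightarrow> W t \<in> borel_measurable (F t)"
    and start: "AE \<omega> in M. W 0 \<omega> = 0"
    and paths: "AE \<omega> in M. continuous_on {0..} (\<lambda>t. W t \<omega>)"
    and increments_normal: "\<And>s t. 0 \<le> s \<Longrightarrow> s < t \<Longrightarrow>
      distributed M lborel (\<lambda>\<omega>. W t \<omega> - W s \<omega>) (normal_density 0 (sqrt (t - s)))"
    and increments_indep: "\<And>s t. 0 \<le> s \<Longrightarrow> s < t \<Longrightarrow>
      indep_set (sets (F s)) {(\<lambda>\<omega>. W t \<omega> - W s \<omega>) -` S \<inter> space M | S. S \<in> sets borel}"


subsection \<open>Ito integral\<close>

definition progressive ::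
    "(real \<Rightarrow> 'a measure) \<Rightarrow> (real \<Rightarrow> 'a \<Rightarrow> 'b::euclidean_space) \<Rightarrow> bool" where
  "progressive F H \<longleftrightarrow>
    (\<forall>t\<ge>0. (\<lambda>(s, \<omega>). H s \<omega>) \<in> borel_measurable (restrict_space borel {0..t} \<Otimes>\<^sub>M F t))"

text \<open>The quantity \<open>E \<integral>\<^sub>0\<^sup>t |H\<^sub>s|\<^sup>2 ds\<close>, possibly infinite.\<close>

definition energy :: "'a measure \<Rightarrow> real \<Rightarrow> (real \<Rightarrow> 'a \<Rightarrow> 'b::euclidean_space) \<Rightarrow> ennreal" where
  "energy M t H = (\<integral>\<^sup>+\<omega>. (\<integral>\<^sup>+s\<in>{0..t}. ennreal ((norm (H s \<omega>))\<^sup>2) \<partial>lborel) \<partial>M)"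

text \<open>
  Elementary integrands on \<open>[0,t]\<close>: the triple \<open>n, \<tau>, h\<close> encodes the process that takes the
  value \<open>h i\<close> on the interval \<open>(\<tau> i, \<tau> (i+1)]\<close>, \<open>i < n\<close>.
\<close>

definition elementary :: "'a measure \<Rightarrow> (real \<Rightarrow> 'a measure) \<Rightarrow> real \<Rightarrow>
    nat \<Rightarrow> (nat \<Rightarrow> real) \<Rightarrow> (nat \<Rightarrow> 'a \<Rightarrow> 'b::euclidean_space) \<Rightarrow> bool" where
  "elementary M F t n \<tau> h \<longleftrightarrow>
    \<tau> 0 = 0 \<and> \<tau> n = t \<and> (\<forall>i<n. \<tau> i \<le> \<tau> (Suc i)) \<and>
    (\<forall>i<n. h i \<in> borel_measurable (F (\<tau> i)) \<and> integrable M (\<lambda>\<omega>. (norm (h i \<omega>))\<^sup>2))"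

definition step_process ::
    "nat \<Rightarrow> (nat \<Rightarrow> real) \<Rightarrow> (nat \<Rightarrow> 'a \<Rightarrow> 'b::euclidean_space) \<Rightarrow> real \<Rightarrow> 'a \<Rightarrow> 'b" where
  "step_process n \<tau> h s \<omega> = (\<Sum>i<n. indicator {\<tau> i<..\<tau> (Suc i)} s *\<^sub>R h i \<omega>)"

definition step_integral :: "(real \<Rightarrow> 'a \<Rightarrow> real) \<Rightarrow>
    nat \<Rightarrow> (nat \<Rightarrow> real) \<Rightarrow> (nat \<Rightarrow> 'a \<Rightarrow> 'b::euclidean_space) \<Rightarrow> 'a \<Rightarrow> 'b" where
  "step_integral W n \<tau> h \<omega> = (\<Sum>i<n. (W (\<tau> (Suc i)) \<omega> - W (\<tau> i) \<omega>) *\<^sub>R h i \<omega>)"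

text \<open>
  \<open>Y\<close> is (a version of) \<open>\<integral>\<^sub>0\<^sup>t H\<^sub>s dW\<^sub>s\<close>: the mean square limit of the integrals of elementary
  processes approximating \<open>H\<close> in mean square.
\<close>

definition has_ito_integral :: "'a measure \<Rightarrow> (real \<Rightarrow> 'a measure) \<Rightarrow> (real \<Rightarrow> 'a \<Rightarrow> real) \<Rightarrow>
    (real \<Rightarrow> 'a \<Rightarrow> 'b::euclidean_space) \<Rightarrow> real \<Rightarrow> ('a \<Rightarrow> 'b) \<Rightarrow> bool" where
  "has_ito_integral M F W H t Y \<longleftrightarrow>
    progressive F H \<and> Y \<in> borel_measurable M \<and>
    (\<exists>n \<tau> h.
      (\<forall>k. elementary M F t (n k) (\<tau> k) (h k)) \<and>
      (\<lambda>k. energy M t (\<lambda>s \<omega>. H s \<omega> - step_process (n k) (\<tau> k) (h k) s \<omega>)) \<longlonglongrightarrow> 0 \<and>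
      (\<lambda>k. \<integral>\<^sup>+\<omega>. ennreal ((norm (Y \<omega> - step_integral W (n k) (\<tau> k) (h k) \<omega>))\<^sup>2) \<partial>M) \<longlonglongrightarrow> 0)"


subsection \<open>Linear Ito equations and mean square stability\<close>

text \<open>
  \<open>X\<close> solves \<open>dx = A x dt + C x dW\<close>, \<open>x(0) = x0\<close>, in integrated form. At \<open>t = 0\<close> both
  integrals vanish, so the equation contains the initial condition. Path continuity is not
  required: every solution has a continuous modification, with the same second moments.
\<close>

definition ito_solution :: "'a measure \<Rightarrow> (real \<Rightarrow> 'a measure) \<Rightarrow> (real \<Rightarrow> 'a \<Rightarrow> real) \<Rightarrow>
    real^'n^'n \<Rightarrow> real^'n^'n \<Rightarrow> real^'n \<Rightarrow> (real \<Rightarrow> 'a \<Rightarrow> real^'n) \<Rightarrow> bool" where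
  "ito_solution M F W A C x0 X \<longleftrightarrow>
    progressive F X \<and> (\<forall>t\<ge>0. energy M t X < \<infinity>) \<and>
    (\<forall>t\<ge>0. \<exists>Y. has_ito_integral M F W (\<lambda>s \<omega>. C *v X s \<omega>) t Y \<and>
      (AE \<omega> in M. X t \<omega> = x0 + (LBINT s:{0..t}. A *v X s \<omega>) + Y \<omega>))"

text \<open>
  The expectations are nonnegative integrals, so the bound includes their finiteness.
\<close>

definition ms_exp_stable :: "'a measure \<Rightarrow> (real \<Rightarrow> 'a measure) \<Rightarrow> (real \<Rightarrow> 'a \<Rightarrow> real) \<Rightarrow>
    real^'n^'n \<Rightarrow> real^'n^'n \<Rightarrow> bool" where
  "ms_exp_stable M F W A C \<longleftrightarrow>
    (\<exists>\<beta>1>0. \<exists>\<beta>2>0. \<forall>x0 X. ito_solution M F W A C x0 X \<longrightarrow>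
      (\<forall>t\<ge>0. (\<integral>\<^sup>+\<omega>. ennreal (X t \<omega> \<bullet> X t \<omega>) \<partial>M)
        \<le> ennreal (\<beta>1 * exp (- \<beta>2 * t)) * (\<integral>\<^sup>+\<omega>. ennreal (X 0 \<omega> \<bullet> X 0 \<omega>) \<partial>M)))"

end

theory Submission
  imports Defs "HOL-Computational_Algebra.Fundamental_Theorem_Algebra"
begin

text \<open>
  By Ito's formula in expectation, \<open>d/dt E[x \<bullet> Q x] = E[2 x \<bullet> Q A\<^sub>c x + C x \<bullet> Q C x]\<close> along
  \<open>dx = A\<^sub>c x dt + C x d\<Delta>\<close> with \<open>A\<^sub>c = A + \<mu>BK\<close> and \<open>C = \<sigma>BK\<close>.

  Necessity: integrating the second moments of the solutions that start in the basis vectors gives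
  a positive definite \<open>S\<close> such that, with \<open>Q = S\<^sup>-\<^sup>1\<close>,
  \<open>2 tr A\<^sub>c + \<sigma>\<^sup>2 (K S K\<^sup>T) (B\<^sup>T Q B) < 0\<close>. By Cauchy-Schwarz the second term is at least \<open>\<sigma>\<^sup>2 (KB)\<^sup>2\<close>,
  and minimising \<open>2 tr A + 2\<mu>y + \<sigma>\<^sup>2y\<^sup>2\<close> over \<open>y = KB\<close> yields \<open>2 tr A < \<mu>\<^sup>2/\<sigma>\<^sup>2\<close>. This direction needs the
  existence of solutions, obtained as the limit of Euler schemes on dyadic grids.

  Sufficiency: equality in these estimates dictates the gain. Let \<open>S\<close> solve the Lyapunov equation
  \<open>(A + \<epsilon>I) S + S (A + \<epsilon>I)\<^sup>T = B B\<^sup>T\<close>; it is positive definite by stabilizability, and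
  \<open>K = - B\<^sup>T Q / \<mu>\<close> makes \<open>E[x \<bullet> Q x]\<close> decay at rate \<open>2\<epsilon>\<close> for small \<open>\<epsilon>\<close>.
\<close>

section \<open>Eigenvalues\<close>

text \<open>Stability is quantified over all solutions: the sufficient half estimates an arbitrary
  one, while in the necessary half the hypothesis would be vacuous without a solution from each
  basis vector. Solutions enter only through second moments, so Ito's formula is used in expectation
  and for quadratic functions, where it follows from the Ito isometry and the martingale property;
  both pass from elementary integrands to mean square limits. The origin of the gain: equality in
  Cauchy-Schwarz makes \<open>S K\<^sup>T\<close> a multiple of \<open>B\<close>, hence
  \<open>K\<close> a multiple of \<open>B\<^sup>T Q\<close>; the factor \<open>-1/\<mu>\<close> puts
  \<open>K B\<close> at the minimiser \<open>-\<mu>/\<sigma>\<^sup>2\<close> when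
  \<open>B\<^sup>T Q B\<close> reaches the threshold \<open>\<mu>\<^sup>2/\<sigma>\<^sup>2\<close>.
  The strict trace condition leaves a gap, half of which is spent on the shift \<epsilon>. Lyapunov
  equations are handled by finite-dimensional linear algebra: one strict Lyapunov inequality for
  \<open>A\<close> is built eigenvalue by eigenvalue, and it makes the Lyapunov operator
  injective.\<close>

lemma prod_linear_factors:
  fixes X :: "'a::idom multiset"
  defines "p \<equiv> (\<Prod>x\<in>#X. [:-x, 1:])"
  shows "degree p = size X" "coeff p (size X) = 1" "coeff (pCons 0 p) (size X) = - \<Sum>\<^sub># X"
proof -
  \<comment> \<open>Multiplication by the indeterminate shifts the subleading coefficient to index
    \<open>size X\<close>, so that no truncated \<open>size X - 1\<close> arises for the empty
    multiset. The leading coefficient is carried along because it shows the product to be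
    nonzero.\<close>
  have "degree (\<Prod>x\<in>#X. [:-x, 1:]) = size X \<and> coeff (\<Prod>x\<in>#X. [:-x, 1:]) (size X) = 1 \<and>
      coeff (pCons 0 (\<Prod>x\<in>#X. [:-x, 1:])) (size X) = - \<Sum>\<^sub># X"
  proof (induction X)
    case (add x X)
    let ?p = "\<Prod>x\<in>#X. [:-x, 1:]"
    have nz: "?p \<noteq> 0" using add by auto
    have "degree ([:-x, 1:] * ?p) = Suc (size X)"
      using add nz by (subst degree_mult_eq) auto
    moreover have "coeff ?p (Suc (size X)) = 0" using add by (intro coeff_eq_0) auto
    ultimately show ?case using add by (auto simp: coeff_pCons split: nat.splits)
  qed auto
  then show "degree p = size X" "coeff p (size X) = 1" "coeff (pCons 0 p) (size X) = - \<Sum>\<^sub># X"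
    by (auto simp: p_def)
qed

lemma poly_charpoly:
  "poly (charpoly A) z = det (mat z - (\<chi> i j. complex_of_real (A $ i $ j)))"
  unfolding charpoly_def det_def
  by (simp add: poly_sum poly_prod mat_def if_distrib [where f = "\<lambda>p. poly p z"] of_int_poly cong: if_cong)

text \<open>In the Leibniz expansion a permutation other than the identity moves at least two
  indices, so its product has at most \<open>CARD('n) - 2\<close> factors that contain the
  indeterminate. The two highest coefficients therefore come from the diagonal product, whose roots
  are the diagonal entries.\<close>

lemma charpoly_coeffs:
  fixes A :: "real^'n^'n"
  shows "degree (charpoly A) = CARD('n)" (is ?A)
    and "coeff (charpoly A) CARD('n) = 1" (is ?B)
    and "coeff (pCons 0 (charpoly A)) CARD('n) = - complex_of_real (trace A)" (is ?C)
proof -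
  define M where "M = mat [:0, 1:] - (\<chi> i j. [:complex_of_real (A $ i $ j):])"
  define t where "t = (\<lambda>p. of_int (sign p) * (\<Prod>i\<in>UNIV. M $ i $ p i))"
  define P where "P = {p. p permutes (UNIV :: 'n set)} - {id}"
  have M: "M $ i $ j = (if i = j then [:- complex_of_real (A $ i $ i), 1:] else [:- complex_of_real (A $ i $ j):])"
    for i j by (simp add: M_def mat_def)
  have "charpoly A = (\<Sum>p | p permutes UNIV. t p)"
    by (simp add: charpoly_def det_def t_def M_def)
  also have "\<dots> = t id + sum t P"
    unfolding P_def by (intro sum.remove) (auto simp: permutes_id finite_permutations)
  also have "t id = (\<Prod>x\<in>#image_mset (\<lambda>i. complex_of_real (A $ i $ i)) (mset_set UNIV). [:-x, 1:])"
    by (simp add: t_def M sign_id prod_unfold_prod_mset image_mset.compositionality comp_def)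
  finally have eq: "charpoly A = \<dots> + sum t P" .
  have small: "degree (t p) + 2 \<le> CARD('n)" if "p \<in> P" for p
  proof -
    from that have p: "p permutes UNIV" "p \<noteq> id" by (auto simp: P_def)
    then obtain i where i: "p i \<noteq> i" by fastforce
    then have pi: "p (p i) \<noteq> p i" using p(1) by (metis permutes_inj injD)
    have "degree (t p) \<le> degree (\<Prod>j\<in>UNIV. M $ j $ p j)"
      unfolding t_def by (metis degree_mult_le add_0 degree_of_int)
    also have "\<dots> \<le> (\<Sum>j\<in>UNIV. degree (M $ j $ p j))"
      using degree_prod_sum_le[of UNIV "\<lambda>j. M $ j $ p j"] by (simp add: comp_def)
    also have "\<dots> \<le> (\<Sum>j\<in>UNIV. if j \<in> {i, p i} then 0 else 1)"
      by (intro sum_mono) (use i pi in \<open>auto simp: M\<close>)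
    also have "\<dots> = card (UNIV - {i, p i})"
      by (subst sum.If_cases) (auto intro!: arg_cong[where f = card])
    also have "\<dots> = CARD('n) - 2" using i by (subst card_Diff_subset) auto
    finally have 1: "degree (t p) \<le> CARD('n) - 2" .
    have "card {i, p i} \<le> CARD('n)" by (intro card_mono) auto
    then have "2 \<le> CARD('n)" using i by simp
    with 1 show ?thesis by simp
  qed
  have rest: "coeff (sum t P) k = 0" if "CARD('n) \<le> Suc k" for k
    unfolding coeff_sum
  proof (intro sum.neutral ballI coeff_eq_0)
    fix p assume "p \<in> P" from small[OF this] that show "degree (t p) < k" by simp
  qed
  note pl = prod_linear_factors[of "image_mset (\<lambda>i. complex_of_real (A $ i $ i)) (mset_set UNIV)"]
  show B: ?B unfolding eq using pl(2) rest[of "CARD('n)"] by simp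
  have "degree (charpoly A) \<le> CARD('n)"
    by (rule degree_le) (use eq pl(1) rest in \<open>auto simp: coeff_eq_0\<close>)
  with B show ?A by (metis le_antisym le_degree one_neq_zero)
  obtain m where m: "CARD('n) = Suc m" by (metis Suc_pred' zero_less_card_finite)
  show ?C unfolding eq using pl(3) rest[of m]
    by (simp add: m trace_def flip: sum_unfold_sum_mset)
qed

lemma mem_eigvals: "z \<in># eigvals A \<longleftrightarrow> det (mat z - (\<chi> i j. complex_of_real (A $ i $ j))) = 0"
proof -
  have "charpoly A \<noteq> 0" using charpoly_coeffs(2)[of A] by auto
  then show ?thesis by (simp add: eigvals_def poly_charpoly)
qed

text \<open>The characteristic polynomial is monic and splits over the complex numbers; its
  subleading coefficient is computed once from the roots and once from the matrix. This turns the
  eigenvalue sum of the theorem into a trace.\<close>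

lemma sum_eigvals: "\<Sum>\<^sub># (eigvals A) = complex_of_real (trace A)"
proof -
  have 1: "(\<Prod>x\<in>#eigvals A. [:-x, 1:]) = charpoly A"
    using complex_poly_decompose_multiset[of "charpoly A"] charpoly_coeffs(1,2)[of A] by (simp add: eigvals_def)
  show ?thesis using prod_linear_factors(1,3)[of "eigvals A"] charpoly_coeffs(1,3)[of A] unfolding 1 by simp
qed

section \<open>Polynomials of a matrix applied to a vector\<close>

lemma matrix_vector_mult_scalar: "A *v (c *s x) = c *s (A *v x)" for A :: "'a::comm_semiring_1^'n^'m"
  by (simp add: vector_scalar_mult_def matrix_vector_mult_def vec_eq_iff sum_distrib_left mult_ac)

lemma matrix_vector_mult_sum: "A *v sum f S = (\<Sum>i\<in>S. A *v f i)" for A :: "'a::comm_semiring_1^'n^'m"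
  by (induction S rule: infinite_finite_induct) (auto simp: matrix_vector_right_distrib)

text \<open>This is the vector \<open>p(A) w\<close>, written with iterates of the linear map so
  that no powers or polynomials of matrices have to be introduced.\<close>

definition poly_mv :: "complex^'n^'n \<Rightarrow> complex poly \<Rightarrow> complex^'n \<Rightarrow> complex^'n" where
  "poly_mv A p w = (\<Sum>i\<le>degree p. coeff p i *s ((*v) A ^^ i) w)"

lemma poly_mv_altdef:
  assumes "degree p \<le> N"
  shows "poly_mv A p w = (\<Sum>i\<le>N. coeff p i *s ((*v) A ^^ i) w)"
  unfolding poly_mv_def using assms by (intro sum.mono_neutral_left) (auto simp: coeff_eq_0)

lemma poly_mv_pCons_0: "poly_mv A (pCons 0 p) w = poly_mv A p (A *v w)"
  unfolding poly_mv_altdef[OF degree_pCons_le, of A 0 p] poly_mv_def[of A p]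
  by (subst sum.atMost_Suc_shift) (simp add: funpow_swap1)

lemma poly_mv_mult_A: "poly_mv A p (A *v w) = A *v poly_mv A p w"
  by (simp add: poly_mv_def matrix_vector_mult_sum matrix_vector_mult_scalar funpow_swap1)

lemma poly_mv_linear_right:
  "poly_mv A p (v - c *s w) = poly_mv A p v - c *s poly_mv A p w"
proof -
  have "((*v) A ^^ i) (v - c *s w) = ((*v) A ^^ i) v - c *s ((*v) A ^^ i) w" for i
    by (induction i) (simp_all add: matrix_vector_mult_diff_distrib matrix_vector_mult_scalar)
  then show ?thesis
    by (simp add: poly_mv_def vec_eq_iff sum_subtractf sum_distrib_left right_diff_distrib mult.left_commute)
qed

lemma poly_mv_linear_factor:
  "poly_mv A ([:-c, 1:] * p) w = poly_mv A p (A *v w - c *s w)"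
proof -
  define N where "N = Suc (degree p)"
  have "degree ([:-c, 1:] * p) \<le> N" unfolding N_def
    using degree_mult_le[of "[:-c, 1:]" p] by simp
  moreover have "degree (pCons 0 p) \<le> N" by (simp add: N_def degree_pCons_le)
  moreover have "degree p \<le> N" by (simp add: N_def)
  ultimately have "poly_mv A ([:-c, 1:] * p) w = poly_mv A (pCons 0 p) w - c *s poly_mv A p w"
    by (simp add: poly_mv_altdef vec_eq_iff sum_subtractf sum_distrib_left algebra_simps sum.distrib)
  then show ?thesis by (simp add: poly_mv_pCons_0 poly_mv_linear_right)
qed

text \<open>A family may repeat a value, while \<open>dependent\<close> speaks of sets; a repetition
  yields the relation directly, with coefficients 1 and -1.\<close>

lemma linear_relation_exists:
  fixes f :: "nat \<Rightarrow> 'a::euclidean_space"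
  obtains c where "\<exists>i\<le>DIM('a). c i \<noteq> 0" "(\<Sum>i\<le>DIM('a). c i *\<^sub>R f i) = 0"
proof (cases "inj_on f {..DIM('a)}")
  case True
  have "dependent (f ` {..DIM('a)})"
    by (intro dependent_biggerset) (simp add: card_image[OF True])
  then obtain u where u: "\<exists>v\<in>f ` {..DIM('a)}. u v \<noteq> 0" "(\<Sum>v\<in>f ` {..DIM('a)}. u v *\<^sub>R v) = 0"
    by (subst (asm) dependent_finite) auto
  from u(2) have "(\<Sum>i\<le>DIM('a). u (f i) *\<^sub>R f i) = 0"
    by (simp add: sum.reindex[OF True])
  with u(1) show ?thesis by (intro that[of "u \<circ> f"]) auto
next
  case False
  then obtain i j where ij: "i \<le> DIM('a)" "j \<le> DIM('a)" "i \<noteq> j" "f i = f j"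
    by (auto simp: inj_on_def)
  define c :: "nat \<Rightarrow> real" where "c = (\<lambda>k. if k = i then 1 else if k = j then -1 else 0)"
  have "(\<Sum>k\<le>DIM('a). c k *\<^sub>R f k) = (\<Sum>k\<in>{i, j}. c k *\<^sub>R f k)"
    using ij by (intro sum.mono_neutral_right) (auto simp: c_def)
  also have "\<dots> = 0" using ij by (simp add: c_def)
  finally show ?thesis using ij by (intro that[of c]) (auto simp: c_def intro!: exI[of _ i])
qed

text \<open>The iterates of \<open>w\<close> under \<open>A\<close> are compared over the reals, so
  the polynomial has real coefficients and its degree is bounded by the real dimension of the space,
  twice the size of \<open>A\<close>. What counts is that it is nonzero.\<close>

lemma annihilating_poly_exists:
  fixes A :: "complex^'n^'n"
  shows "\<exists>p. p \<noteq> 0 \<and> poly_mv A p w = 0"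
proof -
  let ?N = "DIM(complex^'n)"
  obtain c where c: "\<exists>i\<le>?N. c i \<noteq> 0" "(\<Sum>i\<le>?N. c i *\<^sub>R ((*v) A ^^ i) w) = 0"
    by (rule linear_relation_exists[of "\<lambda>i. ((*v) A ^^ i) w"])
  define p where "p = (\<Sum>i\<le>?N. monom (complex_of_real (c i)) i)"
  have p: "coeff p i = (if i \<le> ?N then complex_of_real (c i) else 0)" for i
    by (simp add: p_def coeff_sum coeff_monom)
  have "p \<noteq> 0" using c(1) p by (metis coeff_0 of_real_eq_0_iff)
  moreover have "degree p \<le> ?N" by (rule degree_le) (simp add: p)
  then have "poly_mv A p w = (\<Sum>i\<le>?N. c i *\<^sub>R ((*v) A ^^ i) w)"
    by (simp add: poly_mv_altdef p vec_eq_iff scaleR_conv_of_real[where 'a = complex])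
  ultimately show ?thesis using c(2) by auto
qed

text \<open>Triangularization without bases: every vector is reached from \<open>0\<close> by inverting factors
  \<open>A - \<lambda>I\<close> at eigenvalues \<open>\<lambda>\<close>.\<close>

lemma eigenvalue_induct:
  fixes A :: "complex^'n^'n"
  assumes zero: "Q 0"
    and step: "\<And>w l. det (mat l - A) = 0 \<Longrightarrow> Q (A *v w - l *s w) \<Longrightarrow> Q w"
  shows "Q w"
proof -
  \<comment> \<open>Induction on the degree of an annihilating polynomial of \<open>w\<close>: a
    root is split off, and the remaining factor annihilates \<open>A w - l w\<close>.\<close>
  have "Q w" if "p \<noteq> 0" "poly_mv A p w = 0" for p w
    using that
  proof (induction "degree p" arbitrary: p w)
    case 0
    then obtain c where "p = [:c:]" by (metis degree_eq_zeroE)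
    with 0 have "w = 0" by (simp add: poly_mv_def)
    with zero show ?case by simp
  next
    case (Suc d)
    then have "\<not> constant (poly p)" by (simp add: constant_degree)
    then obtain l where "poly p l = 0" using fundamental_theorem_of_algebra by blast
    then obtain q where q: "p = [:-l, 1:] * q" by (metis dvdE poly_eq_0_iff_dvd)
    have q0: "q \<noteq> 0" using Suc.prems q by auto
    then have dq: "d = degree q"
      using Suc.hyps(2) degree_mult_eq[of "[:-l, 1:]" q] unfolding q by simp
    have *: "poly_mv A q (A *v w - l *s w) = 0"
      using Suc.prems(2) unfolding q poly_mv_linear_factor .
    show ?case
    proof (cases "det (mat l - A) = 0")
      case True
      from Suc.hyps(1)[OF dq q0 *] show ?thesis by (rule step[OF True])
    next
      case False
      \<comment> \<open>If the root \<open>l\<close> is no eigenvalue, \<open>A - l I\<close> is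
        injective and cancels, so that \<open>q\<close> annihilates \<open>w\<close> itself and the
        induction continues with the same vector.\<close>
      let ?u = "poly_mv A q w"
      have "(mat l - A) *v ?u = l *s ?u - A *v ?u"
        by (simp add: matrix_vector_mult_diff_rdistrib) (simp add: mat_def matrix_vector_mult_def vec_eq_iff if_distrib [where f = "\<lambda>x. x * _"] cong: if_cong)
      also have "\<dots> = 0" using * by (simp add: poly_mv_linear_right poly_mv_mult_A)
      finally have "?u = 0"
        using False by (metis invertible_det_nz invertible_left_inverse matrix_left_invertible_ker)
      then show ?thesis by (rule Suc.hyps(1)[OF dq q0])
    qed
  qed
  then show ?thesis using annihilating_poly_exists by blast
qed

section \<open>Lyapunov equations\<close>

text \<open>There is no conjugation: the pairing stays complex linear in \<open>u\<close>, and a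
  real matrix moves across it as its transpose.\<close>

definition cdot :: "complex^'n \<Rightarrow> real^'n \<Rightarrow> complex" where
  "cdot u x = (\<Sum>i\<in>UNIV. u $ i * of_real (x $ i))"

text \<open>For a symmetric semidefinite \<open>R\<close> this is the complexified range of
  \<open>R\<close>, that is, the covectors vanishing on its kernel. Its dimension measures how far
  \<open>R\<close> is from being definite.\<close>

definition dominated :: "real^'n^'n \<Rightarrow> (complex^'n) set" where
  "dominated R = {u. \<exists>C. \<forall>x. (cmod (cdot u x))\<^sup>2 \<le> C * (x \<bullet> (R *v x))}"

lemma cdot_add: "cdot (u + v) x = cdot u x + cdot v x"
  by (simp add: cdot_def distrib_right sum.distrib)

lemma cdot_scaleR: "cdot (c *\<^sub>R u) x = c *\<^sub>R cdot u x"
  by (simp add: cdot_def scaleR_conv_of_real[where 'a = complex] sum_distrib_left mult_ac)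

lemma cdot_scale: "cdot (c *s u) x = c * cdot u x"
  by (simp add: cdot_def sum_distrib_left mult_ac)

lemma cdot_transpose:
  "cdot w (transpose A *v x) = cdot ((\<chi> i j. complex_of_real (A $ i $ j)) *v w) x"
  unfolding cdot_def transpose_def matrix_vector_mult_def
  by (simp add: sum_distrib_left sum_distrib_right mult_ac) (rule sum.swap)

lemma subspace_dominated:
  assumes "\<And>x. 0 \<le> x \<bullet> (R *v x)"
  shows "subspace (dominated R)"
proof (rule subspaceI)
  show "0 \<in> dominated R" by (auto simp: dominated_def cdot_def intro!: exI[of _ 0])
next
  fix u v assume "u \<in> dominated R" "v \<in> dominated R"
  then obtain C D where C: "(cmod (cdot u x))\<^sup>2 \<le> C * (x \<bullet> (R *v x))"
    and D: "(cmod (cdot v x))\<^sup>2 \<le> D * (x \<bullet> (R *v x))" for x by (auto simp: dominated_def)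
  have "(cmod (cdot (u + v) x))\<^sup>2 \<le> (2 * C + 2 * D) * (x \<bullet> (R *v x))" for x
  proof -
    have "(cmod (cdot (u + v) x))\<^sup>2 \<le> (cmod (cdot u x) + cmod (cdot v x))\<^sup>2"
      unfolding cdot_add by (intro power_mono norm_triangle_ineq) auto
    also have "\<dots> \<le> 2 * (cmod (cdot u x))\<^sup>2 + 2 * (cmod (cdot v x))\<^sup>2"
      using sum_squares_bound[of "cmod (cdot u x)" "cmod (cdot v x)"] by (simp add: power2_sum)
    also have "\<dots> \<le> (2 * C + 2 * D) * (x \<bullet> (R *v x))" using C[of x] D[of x] by (simp add: distrib_right)
    finally show ?thesis .
  qed
  then show "u + v \<in> dominated R" by (auto simp: dominated_def)
next
  fix c :: real and u assume "u \<in> dominated R"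
  then obtain C where C: "(cmod (cdot u x))\<^sup>2 \<le> C * (x \<bullet> (R *v x))" for x by (auto simp: dominated_def)
  have "(cmod (cdot (c *\<^sub>R u) x))\<^sup>2 \<le> (c\<^sup>2 * C) * (x \<bullet> (R *v x))" for x
    using mult_left_mono[OF C[of x], of "c\<^sup>2"] by (simp add: cdot_scaleR power_mult_distrib mult.assoc)
  then show "c *\<^sub>R u \<in> dominated R" by (auto simp: dominated_def)
qed

text \<open>The real part of \<open>w w\<^sup>*\<close>; its quadratic form at a real
  \<open>x\<close> is the squared modulus of \<open>cdot w x\<close>.\<close>

definition hermitian_dyad :: "complex^'n \<Rightarrow> real^'n^'n" where
  "hermitian_dyad w = (\<chi> i j. Re (w $ i * cnj (w $ j)))"

lemma transpose_hermitian_dyad: "transpose (hermitian_dyad w) = hermitian_dyad w"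
  by (simp add: hermitian_dyad_def transpose_def vec_eq_iff mult_ac)

lemma inner_hermitian_dyad:
  "y \<bullet> (hermitian_dyad w *v x) = Re (cdot w y * cnj (cdot w x))"
proof -
  have "cdot w y * cnj (cdot w x)
      = (\<Sum>i\<in>UNIV. \<Sum>j\<in>UNIV. w $ i * of_real (y $ i) * (cnj (w $ j) * of_real (x $ j)))"
    by (simp add: cdot_def sum_product)
  also have "Re \<dots> = y \<bullet> (hermitian_dyad w *v x)"
    by (simp add: inner_vec_def matrix_vector_mult_def hermitian_dyad_def sum_distrib_left algebra_simps)
  finally show ?thesis by simp
qed

text \<open>A relaxed Lyapunov inequality in which the gain is measured by \<open>R\<close> itself.
  It admits \<open>R = 0\<close> as a starting point, and it becomes the strict inequality as soon
  as \<open>R\<close> is definite.\<close>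

definition lyapunov_pre :: "real^'n^'n \<Rightarrow> real^'n^'n \<Rightarrow> bool" where
  "lyapunov_pre A R \<longleftrightarrow> transpose R = R \<and> (\<forall>x. 0 \<le> x \<bullet> (R *v x)) \<and>
    (\<exists>c>0. \<forall>x. c * (x \<bullet> (R *v x)) \<le> 2 * ((transpose A *v x) \<bullet> (R *v x)))"

text \<open>\<open>R' = m R + Re (w w\<^sup>*)\<close> with \<open>m\<close> large enough to absorb the coupling term.\<close>

lemma lyapunov_pre_extend:
  fixes A R :: "real^'n^'n"
  defines "AC \<equiv> \<chi> i j. complex_of_real (A $ i $ j)"
  assumes R: "lyapunov_pre A R" and l: "Re l > 0"
    and w: "AC *v w - l *s w \<in> dominated R"
  shows "\<exists>R'. lyapunov_pre A R' \<and> dominated R \<subseteq> dominated R' \<and> w \<in> dominated R'"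
proof -
  let ?r = "Re l" and ?u = "AC *v w - l *s w"
  from R obtain c where sym: "transpose R = R" and pos: "\<And>x. 0 \<le> x \<bullet> (R *v x)" and c: "c > 0"
    "\<And>x. c * (x \<bullet> (R *v x)) \<le> 2 * ((transpose A *v x) \<bullet> (R *v x))"
    by (auto simp: lyapunov_pre_def)
  from w obtain C0 where C0: "(cmod (cdot ?u x))\<^sup>2 \<le> C0 * (x \<bullet> (R *v x))" for x
    by (auto simp: dominated_def)
  define C where "C = \<bar>C0\<bar>"
  have C: "(cmod (cdot ?u x))\<^sup>2 \<le> C * (x \<bullet> (R *v x))" "C \<ge> 0" for x
    using order_trans[OF C0[of x] mult_right_mono[OF abs_ge_self pos[of x]]] by (auto simp: C_def)
  \<comment> \<open>Young's inequality with weight \<open>Re l\<close> leaves a coupling term of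
    size \<open>C / Re l\<close> times the form of \<open>R\<close>, which half of the gain
    \<open>m c\<close> has to cover. The summand 1 keeps \<open>m\<close> positive when
    \<open>C = 0\<close>.\<close>
  define m where "m = 2 * C / (?r * c) + 1"
  have m: "m > 0" "m * c / 2 \<ge> C / ?r"
  proof -
    have "0 \<le> 2 * C / (?r * c)" using c(1) l C(2) by simp
    then show "m > 0" by (simp add: m_def)
    have "m * c / 2 = C / ?r + c / 2" using c(1) l by (simp add: m_def field_simps)
    then show "m * c / 2 \<ge> C / ?r" using c(1) by simp
  qed
  define R' where "R' = m *\<^sub>R R + hermitian_dyad w"
  have R': "y \<bullet> (R' *v x) = m * (y \<bullet> (R *v x)) + Re (cdot w y * cnj (cdot w x))" for x y
    by (simp add: R'_def matrix_vector_mult_add_rdistrib inner_add_right scaleR_matrix_vector_assoc[symmetric] inner_hermitian_dyad)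
  have R'q: "x \<bullet> (R' *v x) = m * (x \<bullet> (R *v x)) + (cmod (cdot w x))\<^sup>2" for x
    unfolding R' by (simp only: complex_norm_square[symmetric] Re_complex_of_real)
  have symR': "transpose R' = R'"
    using sym transpose_hermitian_dyad[of w] by (simp add: R'_def transpose_def vec_eq_iff)
  have pos': "0 \<le> x \<bullet> (R' *v x)" for x using pos[of x] m by (simp add: R'q)
  \<comment> \<open>After the coupling is absorbed, half of the rate \<open>c\<close> is left on
    \<open>m R\<close> and half of the rate \<open>2 Re l\<close> on the dyad.\<close>
  define c' where "c' = min ?r (c / 2)"
  have c': "c' > 0" using c l by (simp add: c'_def)
  have "c' * (x \<bullet> (R' *v x)) \<le> 2 * ((transpose A *v x) \<bullet> (R' *v x))" for x
  proof -
    let ?a = "cdot w x" and ?g = "cdot ?u x" and ?q = "x \<bullet> (R *v x)"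
    have "AC *v w = l *s w + ?u" by simp
    then have "cdot w (transpose A *v x) = l * ?a + ?g"
      unfolding cdot_transpose AC_def[symmetric] by (metis cdot_add cdot_scale)
    then have 1: "2 * ((transpose A *v x) \<bullet> (R' *v x))
        = m * (2 * ((transpose A *v x) \<bullet> (R *v x))) + 2 * Re ((l * ?a + ?g) * cnj ?a)"
      unfolding R' by simp
    have 2: "Re ((l * ?a + ?g) * cnj ?a) = ?r * (cmod ?a)\<^sup>2 + Re (?g * cnj ?a)"
    proof -
      have "(l * ?a + ?g) * cnj ?a = l * of_real ((cmod ?a)\<^sup>2) + ?g * cnj ?a"
        by (simp only: complex_norm_square distrib_right mult.assoc)
      then show ?thesis by simp
    qed
    have "\<bar>Re (?g * cnj ?a)\<bar> \<le> cmod ?g * cmod ?a"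
      by (metis abs_Re_le_cmod norm_mult complex_mod_cnj)
    moreover have "2 * (cmod ?g * cmod ?a) \<le> (cmod ?g)\<^sup>2 / ?r + ?r * (cmod ?a)\<^sup>2"
    proof -
      have "0 \<le> (cmod ?g - ?r * cmod ?a)\<^sup>2 / ?r" using l by simp
      also have "\<dots> = (cmod ?g)\<^sup>2 / ?r + ?r * (cmod ?a)\<^sup>2 - 2 * (cmod ?g * cmod ?a)"
        using l by (simp add: power2_eq_square field_simps)
      finally show ?thesis by simp
    qed
    ultimately have 3: "2 * Re (?g * cnj ?a) \<ge> - ((cmod ?g)\<^sup>2 / ?r + ?r * (cmod ?a)\<^sup>2)" by linarith
    have 4: "(cmod ?g)\<^sup>2 / ?r \<le> m * c / 2 * ?q"
    proof -
      have "(cmod ?g)\<^sup>2 / ?r \<le> C / ?r * ?q" using C(1)[of x] l by (simp add: field_simps)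
      also have "\<dots> \<le> m * c / 2 * ?q" using m(2) pos[of x] by (rule mult_right_mono)
      finally show ?thesis .
    qed
    have 5: "m * (c * ?q) \<le> m * (2 * ((transpose A *v x) \<bullet> (R *v x)))"
      using c(2)[of x] m(1) by (intro mult_left_mono) auto
    have 6: "c' * (m * ?q) \<le> c / 2 * (m * ?q)" "c' * (cmod ?a)\<^sup>2 \<le> ?r * (cmod ?a)\<^sup>2"
      by (rule mult_right_mono; use m(1) pos[of x] in \<open>simp add: c'_def\<close>)+
    have "c' * (m * ?q + (cmod ?a)\<^sup>2) \<le> 2 * ((transpose A *v x) \<bullet> (R' *v x))"
      unfolding 1 2 using 3 4 5 6 by (simp add: algebra_simps)
    then show ?thesis unfolding R'q .
  qed
  then have "lyapunov_pre A R'"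
    unfolding lyapunov_pre_def using symR' pos' c' by blast
  moreover have "dominated R \<subseteq> dominated R'"
  proof
    fix v assume "v \<in> dominated R"
    then obtain D where D: "(cmod (cdot v x))\<^sup>2 \<le> D * (x \<bullet> (R *v x))" for x by (auto simp: dominated_def)
    have "(cmod (cdot v x))\<^sup>2 \<le> (\<bar>D\<bar> / m) * (x \<bullet> (R' *v x))" for x
    proof -
      have "(cmod (cdot v x))\<^sup>2 \<le> \<bar>D\<bar> * (x \<bullet> (R *v x))"
        using order_trans[OF D[of x] mult_right_mono[OF abs_ge_self pos[of x]]] .
      also have "\<dots> = (\<bar>D\<bar> / m) * (m * (x \<bullet> (R *v x)))" using m(1) by simp
      also have "\<dots> \<le> (\<bar>D\<bar> / m) * (x \<bullet> (R' *v x))"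
        unfolding R'q using m(1) by (intro mult_left_mono) auto
      finally show ?thesis .
    qed
    then show "v \<in> dominated R'" unfolding dominated_def by blast
  qed
  moreover have "w \<in> dominated R'"
    using m(1) pos by (auto simp: dominated_def R'q intro!: exI[of _ 1])
  ultimately show ?thesis by blast
qed

text \<open>Choose \<open>R\<close> with the space \<open>dominated R\<close> of maximal dimension; by the extension lemma and
  \<open>eigenvalue_induct\<close> it is the whole space.\<close>

lemma lyapunov_exists:
  fixes A :: "real^'n^'n"
  assumes eig: "\<And>l. det (mat l - (\<chi> i j. complex_of_real (A $ i $ j))) = 0 \<Longrightarrow> Re l > 0"
  obtains R where "transpose R = R" "\<And>x. x \<noteq> 0 \<Longrightarrow> 0 < x \<bullet> (R *v x)"
    "\<And>x. x \<noteq> 0 \<Longrightarrow> 0 < (transpose A *v x) \<bullet> (R *v x)"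
proof -
  have "lyapunov_pre A 0"
    by (auto simp: lyapunov_pre_def transpose_def vec_eq_iff intro!: exI[of _ 1])
  moreover have "dim (dominated S) \<le> DIM(complex^'n)" for S :: "real^'n^'n"
    by (rule dim_subset_UNIV)
  ultimately obtain R where R: "lyapunov_pre A R"
    and max: "\<And>R'. lyapunov_pre A R' \<Longrightarrow> dim (dominated R') \<le> dim (dominated R)"
    using ex_has_greatest_nat[of "lyapunov_pre A" 0 "\<lambda>R. dim (dominated R)" "Suc DIM(complex^'n)"]
    unfolding less_Suc_eq_le by blast
  have pre: "\<And>x. 0 \<le> x \<bullet> (S *v x)" if "lyapunov_pre A S" for S using that by (auto simp: lyapunov_pre_def)
  have all: "w \<in> dominated R" for w
  proof (rule eigenvalue_induct[where Q = "\<lambda>w. w \<in> dominated R"])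
    show "0 \<in> dominated R" using subspace_dominated[OF pre[OF R]] by (rule subspace_0)
    fix w l assume "det (mat l - (\<chi> i j. complex_of_real (A $ i $ j))) = 0"
      and "(\<chi> i j. complex_of_real (A $ i $ j)) *v w - l *s w \<in> dominated R"
    then obtain R' where R': "lyapunov_pre A R'" "dominated R \<subseteq> dominated R'" "w \<in> dominated R'"
      using lyapunov_pre_extend[OF R eig] by blast
    have "dominated R = dominated R'"
      using subspace_dim_equal[OF subspace_dominated[OF pre[OF R]] subspace_dominated[OF pre[OF R'(1)]] R'(2) max[OF R'(1)]] .
    with R'(3) show "w \<in> dominated R" by simp
  qed
  have pos: "0 < x \<bullet> (R *v x)" if "x \<noteq> 0" for x
  proof -
    from that obtain i where i: "x $ i \<noteq> 0" by (auto simp: vec_eq_iff)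
    \<comment> \<open>A dominated coordinate covector forces the form of \<open>R\<close> to be
      positive wherever that coordinate is nonzero.\<close>
    have "cdot (axis i 1) x = of_real (x $ i)"
      by (simp add: cdot_def axis_def if_distrib [where f = "\<lambda>x. x * _"] cong: if_cong)
    with all[of "axis i 1"] obtain C where "(x $ i)\<^sup>2 \<le> C * (x \<bullet> (R *v x))"
      by (auto simp: dominated_def) (metis norm_of_real power2_abs)
    with i have "C * (x \<bullet> (R *v x)) > 0" by (smt (verit) zero_less_power2)
    then show ?thesis using pre[OF R, of x] by (metis less_eq_real_def mult_zero_right less_irrefl)
  qed
  from R obtain c where sym: "transpose R = R" and c: "c > 0"
    "\<And>x. c * (x \<bullet> (R *v x)) \<le> 2 * ((transpose A *v x) \<bullet> (R *v x))"
    by (auto simp: lyapunov_pre_def)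
  have "0 < (transpose A *v x) \<bullet> (R *v x)" if "x \<noteq> 0" for x
    using c(2)[of x] mult_pos_pos[OF c(1) pos[OF that]] by linarith
  with sym pos show ?thesis by (rule that)
qed

section \<open>Semidefinite forms and solvability of the Lyapunov equation\<close>

lemma matrix_add_rdistrib: "(X + Y) ** Z = X ** Z + Y ** Z" for X Y :: "'a::semiring_1^'n^'m"
  by (simp add: matrix_matrix_mult_def vec_eq_iff sum.distrib distrib_right)

lemma matrix_mult_scaleR:
  fixes X :: "real^'n^'m"
  shows "X ** (c *\<^sub>R Y) = c *\<^sub>R (X ** Y)" "(c *\<^sub>R X) ** Y = c *\<^sub>R (X ** Y)"
  by (simp_all add: matrix_matrix_mult_def vec_eq_iff sum_distrib_left mult_ac)

lemma transpose_add: "transpose (X + Y) = transpose X + transpose Y"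
  and transpose_diff: "transpose (X - Y) = transpose X - transpose Y"
  for X Y :: "real^'n^'m"
  by (simp_all add: transpose_def vec_eq_iff)

lemma transpose_scaleR: "transpose (c *\<^sub>R X) = c *\<^sub>R transpose X" for X :: "real^'n^'m"
  by (simp add: transpose_def vec_eq_iff)

lemma unit_sphere_nonempty: "sphere (0::real^'n) 1 \<noteq> {}"
  using norm_axis_1[of undefined] by (metis dist_0_norm mem_sphere empty_iff)

lemma inner_transpose_mv: "x \<bullet> (transpose A *v y) = (A *v x) \<bullet> y" for A :: "real^'n^'m"
  by (metis dot_lmul_matrix inner_commute transpose_matrix_vector)

lemma inner_symmetric_mv: "transpose R = R \<Longrightarrow> x \<bullet> (R *v y) = y \<bullet> (R *v x)" for R :: "real^'n^'n"
  by (metis inner_commute inner_transpose_mv)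

lemma matrix_vector_mult_minus_left: "(- A) *v x = - (A *v x)" for A :: "'a::ring_1^'n^'m"
  by (simp add: matrix_vector_mult_def vec_eq_iff sum_negf)

lemma quadratic_nonneg_discriminant:
  fixes a b c :: real
  assumes q: "\<And>t. 0 \<le> a + 2 * t * b + t\<^sup>2 * c" and c: "0 \<le> c"
  shows "b\<^sup>2 \<le> a * c"
proof (cases "c = 0")
  case True
  have "b = 0"
  proof (rule ccontr)
    assume "b \<noteq> 0"
    \<comment> \<open>This \<open>t\<close> makes the affine function \<open>a + 2 t b\<close> equal
      to -1.\<close>
    with q[of "- (a + 1) / (2 * b)"] True show False by (simp add: field_simps)
  qed
  then show ?thesis using True by simp
next
  case False
  with c have "c > 0" by simp
  with q[of "- b / c"] show ?thesis by (simp add: field_simps power2_eq_square)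
qed

lemma psd_Cauchy_Schwarz:
  fixes Y :: "real^'n^'n"
  assumes sym: "transpose Y = Y" and pos: "\<And>x. 0 \<le> x \<bullet> (Y *v x)"
  shows "(x \<bullet> (Y *v y))\<^sup>2 \<le> (x \<bullet> (Y *v x)) * (y \<bullet> (Y *v y))"
proof -
  let ?a = "x \<bullet> (Y *v x)" and ?b = "x \<bullet> (Y *v y)" and ?c = "y \<bullet> (Y *v y)"
  have "0 \<le> ?a + 2 * t * ?b + t\<^sup>2 * ?c" for t
  proof -
    have "(x + t *\<^sub>R y) \<bullet> (Y *v (x + t *\<^sub>R y)) = ?a + 2 * t * ?b + t\<^sup>2 * ?c"
      using inner_symmetric_mv[OF sym, of y x]
      by (simp add: matrix_vector_right_distrib matrix_vector_mult_scaleR inner_add_left inner_add_right power2_eq_square algebra_simps)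
    with pos show ?thesis by metis
  qed
  then show ?thesis by (rule quadratic_nonneg_discriminant[OF _ pos])
qed

text \<open>Cauchy-Schwarz against \<open>Y *v v\<close> itself bounds the norm of that vector by
  the vanishing value of the form at \<open>v\<close>.\<close>

lemma psd_kernel:
  fixes Y :: "real^'n^'n"
  assumes "transpose Y = Y" "\<And>x. 0 \<le> x \<bullet> (Y *v x)" "v \<bullet> (Y *v v) = 0"
  shows "Y *v v = 0"
  using psd_Cauchy_Schwarz[OF assms(1,2), of "Y *v v" v] assms(3) by simp

text \<open>If \<open>X\<close> were not positive semidefinite, then \<open>X + s R\<close> would be so, but singular, for some
  \<open>s > 0\<close>; a kernel vector contradicts the two inequalities.\<close>

lemma lyapunov_positive:
  fixes A R X :: "real^'n^'n"
  assumes R: "transpose R = R" "\<And>x. x \<noteq> 0 \<Longrightarrow> 0 < x \<bullet> (R *v x)"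
    "\<And>x. x \<noteq> 0 \<Longrightarrow> 0 < (transpose A *v x) \<bullet> (R *v x)"
    and X: "transpose X = X" "\<And>x. 0 \<le> (transpose A *v x) \<bullet> (X *v x)"
  shows "0 \<le> x \<bullet> (X *v x)"
proof -
  \<comment> \<open>The Rayleigh quotient of \<open>X\<close> relative to \<open>R\<close>. Its
    minimum over the sphere is the smallest generalized eigenvalue, and minus this minimum is the
    critical \<open>s\<close>.\<close>
  define f where "f = (\<lambda>x. (x \<bullet> (X *v x)) / (x \<bullet> (R *v x)))"
  have "x \<bullet> (R *v x) \<noteq> 0" if "x \<in> sphere 0 1" for x
  proof -
    have "x \<noteq> 0" using that by auto
    then show ?thesis using R(2) by (metis less_irrefl)
  qed
  then have "continuous_on (sphere 0 1) f"
    unfolding f_def by (intro continuous_intros matrix_vector_mult_linear_continuous_on) auto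
  moreover note unit_sphere_nonempty
  ultimately obtain v where v: "norm v = 1" "\<And>y. norm y = 1 \<Longrightarrow> f v \<le> f y"
    using continuous_attains_inf[of "sphere 0 1" f] by auto
  define Y where "Y = X - f v *\<^sub>R R"
  have Yq: "x \<bullet> (Y *v y) = x \<bullet> (X *v y) - f v * (x \<bullet> (R *v y))" for x y
    by (simp add: Y_def matrix_vector_mult_diff_rdistrib inner_diff_right scaleR_matrix_vector_assoc[symmetric])
  have Ypos: "0 \<le> y \<bullet> (Y *v y)" for y
  proof (cases "y = 0")
    case False
    let ?y = "y /\<^sub>R norm y"
    have "f ?y = f y" using False
      by (simp add: f_def matrix_vector_mult_scaleR)
    moreover have "norm ?y = 1" using False by simp
    ultimately have "f v \<le> f y" using v(2) by metis
    then show ?thesis using R(2)[OF False] by (simp add: Yq f_def field_simps)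
  qed simp
  have v0: "v \<noteq> 0" using v(1) by auto
  have "v \<bullet> (Y *v v) = 0" using R(2)[OF v0] by (simp add: Yq f_def)
  moreover have "transpose Y = Y" using R(1) X(1) by (simp add: Y_def transpose_def vec_eq_iff)
  ultimately have "Y *v v = 0" using psd_kernel Ypos by blast
  \<comment> \<open>On the kernel vector the form of \<open>X\<close> is \<open>f v\<close> times
    that of \<open>R\<close>. As the latter is strictly positive when paired with
    \<open>A\<^sup>T v\<close> and the former nonnegative, the minimum \<open>f v\<close> cannot be
    negative.\<close>
  then have "(transpose A *v v) \<bullet> (Y *v v) = 0" by simp
  then have "f v * ((transpose A *v v) \<bullet> (R *v v)) \<ge> 0" using X(2)[of v] unfolding Yq by linarith
  then have "f v \<ge> 0" using R(3)[OF v0] by (simp add: zero_le_mult_iff)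
  moreover have "0 \<le> x \<bullet> (R *v x)" using R(2)[of x] by (cases "x = 0") auto
  ultimately have "0 \<le> f v * (x \<bullet> (R *v x))" by simp
  with Ypos[of x] show ?thesis unfolding Yq by linarith
qed

text \<open>In finite dimension it suffices that the Lyapunov operator is injective on symmetric
  matrices. A symmetric \<open>S\<close> in its kernel is semidefinite together with
  \<open>- S\<close> by \<open>lyapunov_positive\<close>, hence zero. Semidefiniteness of the
  solution is a further use of that lemma.\<close>

lemma lyapunov_solve:
  fixes A R G :: "real^'n^'n"
  assumes R: "transpose R = R" "\<And>x. x \<noteq> 0 \<Longrightarrow> 0 < x \<bullet> (R *v x)"
    "\<And>x. x \<noteq> 0 \<Longrightarrow> 0 < (transpose A *v x) \<bullet> (R *v x)"
    and G: "transpose G = G" "\<And>x. 0 \<le> x \<bullet> (G *v x)"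
  obtains S where "transpose S = S" "\<And>x. 0 \<le> x \<bullet> (S *v x)" "A ** S + S ** transpose A = G"
proof -
  have qf: "x \<bullet> ((A ** S + S ** transpose A) *v x) = 2 * ((transpose A *v x) \<bullet> (S *v x))"
    if "transpose S = S" for S x
  proof -
    have "x \<bullet> (A *v (S *v x)) = (transpose A *v x) \<bullet> (S *v x)"
      by (metis inner_transpose_mv transpose_transpose)
    moreover have "x \<bullet> (S *v (transpose A *v x)) = (transpose A *v x) \<bullet> (S *v x)"
      using inner_symmetric_mv[OF that] by metis
    ultimately show ?thesis
      by (simp add: matrix_vector_mult_add_rdistrib inner_add_right matrix_vector_mul_assoc[symmetric]
          del: transpose_matrix_vector)
  qed
  have inj: "S = 0" if S: "transpose S = S" "A ** S + S ** transpose A = 0" for S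
  proof -
    have z: "(transpose A *v x) \<bullet> (S *v x) = 0" for x using qf[OF S(1), of x] S(2) by simp
    have "0 \<le> x \<bullet> (S *v x)" for x
      using lyapunov_positive[OF R S(1)] z by simp
    moreover have "0 \<le> x \<bullet> ((- S) *v x)" for x
      using lyapunov_positive[OF R, of "- S"] S(1) z
      by (simp add: transpose_def vec_eq_iff matrix_vector_mult_minus_left)
    then have "x \<bullet> (S *v x) \<le> 0" for x
      by (simp add: matrix_vector_mult_minus_left)
    ultimately have "x \<bullet> (S *v x) = 0" for x by (metis antisym)
    then have "S *v x = 0" for x
      using psd_kernel[OF S(1)] by simp
    then show "S = 0" by (simp add: matrix_eq)
  qed
  \<comment> \<open>An extension of the operator to all matrices, so that injectivity gives
    surjectivity on a full Euclidean space: the symmetric part of \<open>X\<close> is mapped to a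
    symmetric matrix by twice the Lyapunov operator, and the antisymmetric part is doubled.\<close>
  define T where "T = (\<lambda>X. A ** (X + transpose X) + (X + transpose X) ** transpose A + (X - transpose X))"
  note tr = transpose_add transpose_diff transpose_scaleR
  have trT: "transpose (A ** (X + transpose X) + (X + transpose X) ** transpose A)
      = A ** (X + transpose X) + (X + transpose X) ** transpose A" for X
    by (simp add: tr matrix_transpose_mul add.commute)
  have "linear T"
    unfolding T_def
    by (rule linearI)
      (simp_all add: tr matrix_mult_scaleR matrix_add_ldistrib matrix_add_rdistrib scaleR_add_right scaleR_diff_right)
  have split: "A ** (X + transpose X) + (X + transpose X) ** transpose A = G' \<and> X = transpose X"
    if "T X = G'" "transpose G' = G'" for X G'
  proof -
    let ?P = "A ** (X + transpose X) + (X + transpose X) ** transpose A"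
    have "transpose (?P + (X - transpose X)) = ?P + (X - transpose X)"
      using that unfolding T_def by simp
    then have "?P - (X - transpose X) = ?P + (X - transpose X)"
      by (simp add: tr(1)[of ?P] trT tr(2) del: add_diff_eq)
    then have "2 *\<^sub>R (X - transpose X) = 0" by (simp add: scaleR_2 algebra_simps)
    then have "X = transpose X" by simp
    with that(1) show ?thesis by (simp add: T_def)
  qed
  have "inj T"
  proof (subst linear_injective_0[OF \<open>linear T\<close>], intro allI impI)
    fix X assume "T X = 0"
    then have *: "A ** (X + transpose X) + (X + transpose X) ** transpose A = 0" "X = transpose X"
      using split[of X 0] by (auto simp: transpose_def vec_eq_iff)
    have "X + transpose X = 0" by (rule inj[OF _ *(1)]) (simp add: tr add.commute)
    with *(2) have "2 *\<^sub>R X = 0" by (metis scaleR_2)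
    then show "X = 0" by simp
  qed
  then have "surj T" using linear_injective_imp_surjective[OF \<open>linear T\<close>] by simp
  then obtain X where "T X = G" by (metis surjD)
  then have X: "A ** (X + transpose X) + (X + transpose X) ** transpose A = G"
    using split G(1) by blast
  have symX: "transpose (X + transpose X) = X + transpose X" by (simp add: tr add.commute)
  have "0 \<le> (transpose A *v x) \<bullet> ((X + transpose X) *v x)" for x
    using qf[OF symX, of x] G(2)[of x] unfolding X by simp
  then have "0 \<le> x \<bullet> ((X + transpose X) *v x)" for x
    using lyapunov_positive[OF R symX] by blast
  then show ?thesis using that[OF symX _ X] by blast
qed

section \<open>Stabilizing feedback\<close>

lemma pd_inverse:
  fixes S :: "real^'n^'n"
  assumes sym: "transpose S = S" and pos: "\<And>x. x \<noteq> 0 \<Longrightarrow> 0 < x \<bullet> (S *v x)"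
  obtains Q where "S ** Q = mat 1" "Q ** S = mat 1" "transpose Q = Q" "\<And>x. x \<noteq> 0 \<Longrightarrow> 0 < x \<bullet> (Q *v x)"
proof -
  have "\<forall>x. S *v x = 0 \<longrightarrow> x = 0" using pos by (metis inner_zero_right less_irrefl)
  then obtain Q where QS: "Q ** S = mat 1" using matrix_left_invertible_ker[of S] by blast
  then have SQ: "S ** Q = mat 1" by (simp add: matrix_left_right_inverse)
  have "transpose Q ** S = mat 1"
    using SQ sym by (metis matrix_transpose_mul transpose_mat)
  then have "transpose Q = Q" using SQ by (metis matrix_mul_assoc matrix_mul_lid matrix_mul_rid)
  moreover have "0 < x \<bullet> (Q *v x)" if "x \<noteq> 0" for x
  proof -
    have "S *v (Q *v x) = x" using SQ by (simp add: matrix_vector_mul_assoc)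
    then have "Q *v x \<noteq> 0" using that by auto
    then have "0 < (Q *v x) \<bullet> (S *v (Q *v x))" by (rule pos)
    then show ?thesis using \<open>S *v (Q *v x) = x\<close> by (simp add: inner_commute)
  qed
  ultimately show ?thesis using that[of Q] SQ QS by simp
qed

lemma complexified_eigenvalue_transpose:
  fixes A :: "real^'n^'n"
  assumes "(\<chi> i j. complex_of_real (A $ j $ i)) *v w = l *s w" "w \<noteq> 0"
  shows "det (mat l - (\<chi> i j. complex_of_real (A $ i $ j))) = 0"
proof (rule ccontr)
  let ?M = "mat l - (\<chi> i j. complex_of_real (A $ i $ j))"
  assume "det ?M \<noteq> 0"
  then have "det (transpose ?M) \<noteq> 0" by simp
  then have "transpose ?M *v x = 0 \<Longrightarrow> x = 0" for x
    by (metis invertible_det_nz invertible_left_inverse matrix_left_invertible_ker)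
  moreover have "transpose ?M = mat l - (\<chi> i j. complex_of_real (A $ j $ i))"
    by (simp add: transpose_def mat_def vec_eq_iff)
  moreover have "mat l *v w = l *s w"
    by (simp add: mat_def matrix_vector_mult_def vec_eq_iff if_distrib [where f = "\<lambda>x. x * _"] cong: if_cong)
  ultimately show False using assms by (simp add: matrix_vector_mult_diff_rdistrib)
qed

text \<open>On the kernel, \<open>A\<^sup>T\<close> and \<open>(A + BK)\<^sup>T\<close> agree, so their common eigenvalues would lie in both half-planes.\<close>

lemma stabilizable_gramian_kernel:
  fixes A S :: "real^'n^'n" and B :: "real^'m^'n"
  assumes eig: "\<And>l. det (mat l - (\<chi> i j. complex_of_real (A $ i $ j))) = 0 \<Longrightarrow> Re l > 0"
    and stab: "stabilizable A B"
    and ker: "\<And>v. S *v v = 0 \<Longrightarrow> S *v (transpose A *v v) = 0 \<and> transpose B *v v = 0"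
    and v: "S *v v = 0"
  shows "v = 0"
proof -
  obtain K where K: "hurwitz (A + B ** K)" using stab by (auto simp: stabilizable_def)
  let ?SC = "\<chi> i j. complex_of_real (S $ i $ j)" and ?AT = "\<chi> i j. complex_of_real (A $ j $ i)"
  define re im where "re = (\<lambda>w::complex^'n. \<chi> i. Re (w $ i))" and "im = (\<lambda>w::complex^'n. \<chi> i. Im (w $ i))"
  have SC: "?SC *v w = 0 \<longleftrightarrow> S *v re w = 0 \<and> S *v im w = 0" for w
    by (auto simp: vec_eq_iff matrix_vector_mult_def re_def im_def complex_eq_iff)
  have AT: "re (?AT *v w) = transpose A *v re w" "im (?AT *v w) = transpose A *v im w" for w
    by (simp_all add: vec_eq_iff matrix_vector_mult_def re_def im_def transpose_def del: transpose_matrix_vector)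
  define H where "H = A + B ** K"
  \<comment> \<open>The kernel of \<open>S\<close> is invariant under \<open>A\<^sup>T\<close>. So
    for \<open>w\<close> in it, \<open>A\<^sup>T w - l w\<close> lies in it as well and vanishes by
    induction; only eigenvectors remain to be excluded.\<close>
  have "?SC *v w = 0 \<longrightarrow> w = 0" for w
  proof (rule eigenvalue_induct[where A = ?AT and Q = "\<lambda>w. ?SC *v w = 0 \<longrightarrow> w = 0"]; intro impI)
    fix w l
    assume IH: "?SC *v (?AT *v w - l *s w) = 0 \<longrightarrow> ?AT *v w - l *s w = 0" and w: "?SC *v w = 0"
    have re_im: "S *v re w = 0" "S *v im w = 0" using w SC by auto
    then have "?SC *v (?AT *v w) = 0" unfolding SC AT using ker by blast
    then have "?SC *v (?AT *v w - l *s w) = 0"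
      using w by (simp add: matrix_vector_mult_diff_distrib matrix_vector_mult_scalar)
    with IH have Aw: "?AT *v w = l *s w" by simp
    have Bw: "(\<Sum>i\<in>UNIV. complex_of_real (B $ i $ j) * w $ i) = 0" for j
    proof -
      have "(transpose B *v re w) $ j = 0" "(transpose B *v im w) $ j = 0" using ker re_im by auto
      then show ?thesis
        by (simp add: complex_eq_iff matrix_vector_mult_def re_def im_def transpose_def del: transpose_matrix_vector)
    qed
    \<comment> \<open>The feedback contributes \<open>K\<^sup>T B\<^sup>T w\<close>, which is zero,
      so \<open>w\<close> is an eigenvector of the closed loop transpose for the same
      \<open>l\<close>.\<close>
    have "(\<chi> i j. complex_of_real (H $ j $ i)) *v w = ?AT *v w"
    proof (unfold vec_eq_iff, intro allI)
      fix j
      have "(\<Sum>i\<in>UNIV. complex_of_real ((B ** K) $ i $ j) * w $ i)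
          = (\<Sum>i\<in>UNIV. \<Sum>k\<in>UNIV. complex_of_real (K $ k $ j) * (complex_of_real (B $ i $ k) * w $ i))"
        by (simp add: matrix_matrix_mult_def sum_distrib_right sum_distrib_left mult_ac)
      also have "\<dots> = (\<Sum>k\<in>UNIV. complex_of_real (K $ k $ j) * (\<Sum>i\<in>UNIV. complex_of_real (B $ i $ k) * w $ i))"
        by (subst sum.swap) (simp add: sum_distrib_left)
      finally have "(\<Sum>i\<in>UNIV. complex_of_real ((B ** K) $ i $ j) * w $ i) = 0" by (simp add: Bw)
      then show "((\<chi> i j. complex_of_real (H $ j $ i)) *v w) $ j = (?AT *v w) $ j"
        by (simp add: H_def matrix_vector_mult_def distrib_right sum.distrib)
    qed
    then have Hw: "(\<chi> i j. complex_of_real (H $ j $ i)) *v w = l *s w" using Aw by simp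
    show "w = 0"
    proof (rule ccontr)
      assume "w \<noteq> 0"
      then have "Re l > 0" "l \<in># eigvals H"
        using eig complexified_eigenvalue_transpose[OF Aw] complexified_eigenvalue_transpose[OF Hw]
        by (auto simp: mem_eigvals)
      with K show False by (auto simp: hurwitz_def H_def)
    qed
  qed simp
  moreover have "re (\<chi> i. complex_of_real (v $ i)) = v" "im (\<chi> i. complex_of_real (v $ i)) = 0"
    by (simp_all add: re_def im_def vec_eq_iff)
  ultimately have "(\<chi> i. complex_of_real (v $ i)) = 0" using v SC by (metis matrix_vector_mult_0_right)
  then show ?thesis by (simp add: vec_eq_iff)
qed

lemma single_input_mv:
  fixes B :: "real^1^'n" and K :: "real^'m^1"
  shows "(B ** K) *v x = (row 1 K \<bullet> x) *\<^sub>R column 1 B"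
  by (simp add: vec_eq_iff matrix_vector_mult_def matrix_matrix_mult_def row_def column_def inner_vec_def
      sum_distrib_right sum_distrib_left sum_1 mult_ac)

lemma trace_dyad:
  fixes B :: "real^1^'n"
  shows "trace (Q ** (B ** transpose B)) = column 1 B \<bullet> (Q *v column 1 B)"
proof -
  have "trace (Q ** (B ** transpose B)) = (\<Sum>i\<in>UNIV. \<Sum>j\<in>UNIV. Q $ i $ j * (B $ j $ 1 * B $ i $ 1))"
    by (simp add: trace_def matrix_matrix_mult_def transpose_def sum_1)
  also have "\<dots> = column 1 B \<bullet> (Q *v column 1 B)"
    by (simp add: inner_vec_def matrix_vector_mult_def column_def sum_distrib_left mult_ac)
  finally show ?thesis .
qed

lemma trace_transpose: "trace (transpose A) = trace A"
  by (simp add: trace_def transpose_def)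

text \<open>With \<open>S\<close> the Gramian of \<open>A + \<epsilon>I\<close> and \<open>Q = S\<^sup>-\<^sup>1\<close>, the gain \<open>K = - B\<^sup>T Q / \<mu>\<close> works: the
  noise term is controlled by \<open>B\<^sup>T Q B = 2 trace (A + \<epsilon>I)\<close>.\<close>

lemma stabilizing_feedback_exists:
  fixes A :: "real^'n^'n" and B :: "real^1^'n" and \<mu> \<sigma> :: real
  assumes mu: "\<mu> \<noteq> 0" and sigma: "\<sigma> > 0" and eig: "\<forall>z \<in># eigvals A. Re z > 0"
    and stab: "stabilizable A B" and tr: "2 * (\<sigma>\<^sup>2 / \<mu>\<^sup>2) * trace A < 1"
  obtains K :: "real^'n^1" and Q :: "real^'n^'n" and \<epsilon> :: real
  where "\<epsilon> > 0" "transpose Q = Q" "\<And>x. x \<noteq> 0 \<Longrightarrow> 0 < x \<bullet> (Q *v x)"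
    "\<And>x. 2 * (x \<bullet> (Q *v ((A + \<mu> *\<^sub>R (B ** K)) *v x)))
        + ((\<sigma> *\<^sub>R (B ** K)) *v x) \<bullet> (Q *v ((\<sigma> *\<^sub>R (B ** K)) *v x)) \<le> - 2 * \<epsilon> * (x \<bullet> (Q *v x))"
proof -
  have eig': "Re l > 0" if "det (mat l - (\<chi> i j. complex_of_real (A $ i $ j))) = 0" for l
    using eig that mem_eigvals by blast
  obtain R where R: "transpose R = R" "\<And>x. x \<noteq> 0 \<Longrightarrow> 0 < x \<bullet> (R *v x)"
    "\<And>x. x \<noteq> 0 \<Longrightarrow> 0 < (transpose A *v x) \<bullet> (R *v x)"
    using lyapunov_exists eig' by blast
  \<comment> \<open>The shift raises the trace by \<open>CARD('n)\<close> times \<epsilon>, which is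
    half of its distance to the threshold, so the strict condition survives for
    \<open>At\<close>.\<close>
  define \<epsilon> where "\<epsilon> = (\<mu>\<^sup>2 / (2 * \<sigma>\<^sup>2) - trace A) / (2 * CARD('n))"
  have tr': "trace A < \<mu>\<^sup>2 / (2 * \<sigma>\<^sup>2)" using tr mu sigma by (simp add: field_simps)
  then have \<epsilon>: "\<epsilon> > 0" by (simp add: \<epsilon>_def)
  define At where "At = A + \<epsilon> *\<^sub>R mat 1"
  have traceAt: "trace At = trace A + \<epsilon> * CARD('n)"
    by (simp add: At_def trace_def mat_def sum.distrib)
  also have "\<epsilon> * CARD('n) = (\<mu>\<^sup>2 / (2 * \<sigma>\<^sup>2) - trace A) / 2" by (simp add: \<epsilon>_def)
  finally have "trace At = trace A + (\<mu>\<^sup>2 / (2 * \<sigma>\<^sup>2) - trace A) / 2" .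
  moreover have "a < b \<Longrightarrow> a + (b - a) / 2 < b" for a b :: real by (simp add: field_simps)
  ultimately have trAt: "trace At < \<mu>\<^sup>2 / (2 * \<sigma>\<^sup>2)" using tr' by metis
  have At: "At *v x = A *v x + \<epsilon> *\<^sub>R x" for x
    by (simp add: At_def matrix_vector_mult_add_rdistrib scaleR_matrix_vector_assoc[symmetric])
  have tAt: "transpose At *v x = transpose A *v x + \<epsilon> *\<^sub>R x" for x
  proof -
    have "transpose At = transpose A + \<epsilon> *\<^sub>R mat 1"
      by (simp add: At_def transpose_def mat_def vec_eq_iff)
    then show ?thesis
      by (simp add: matrix_vector_mult_add_rdistrib scaleR_matrix_vector_assoc[symmetric] del: transpose_matrix_vector)
  qed
  have RAt: "0 < (transpose At *v x) \<bullet> (R *v x)" if "x \<noteq> 0" for x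
    using R(2,3)[OF that] \<epsilon> unfolding tAt inner_add_left by (simp add: add_pos_pos)
  let ?b = "column 1 B" and ?G = "B ** transpose B"
  have G: "?G *v x = (?b \<bullet> x) *\<^sub>R ?b" for x
    unfolding single_input_mv by (simp add: row_transpose)
  obtain S where S: "transpose S = S" "\<And>x. 0 \<le> x \<bullet> (S *v x)" "At ** S + S ** transpose At = ?G"
    by (rule lyapunov_solve[OF R(1,2) RAt, of ?G]) (auto simp: matrix_transpose_mul G inner_commute[of _ ?b])
  have SG: "At *v (S *v x) + S *v (transpose At *v x) = (?b \<bullet> x) *\<^sub>R ?b" for x
    using arg_cong[OF S(3), of "\<lambda>M. M *v x"] unfolding G
    by (simp add: matrix_vector_mult_add_rdistrib matrix_vector_mul_assoc[symmetric] del: transpose_matrix_vector)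
  have SG2: "2 * (x \<bullet> (At *v (S *v x))) = (?b \<bullet> x)\<^sup>2" for x
  proof -
    have "x \<bullet> (S *v (transpose At *v x)) = x \<bullet> (At *v (S *v x))"
      by (metis S(1) inner_commute inner_symmetric_mv inner_transpose_mv transpose_transpose)
    then show ?thesis
      using arg_cong[OF SG[of x], of "\<lambda>y. x \<bullet> y"] by (simp add: inner_add_right power2_eq_square inner_commute)
  qed
  have ker: "S *v (transpose A *v v) = 0 \<and> transpose B *v v = 0" if v: "S *v v = 0" for v
  proof -
    have bv: "?b \<bullet> v = 0" using SG2[of v] v by simp
    then have "S *v (transpose At *v v) = 0" using SG[of v] v by simp
    then have "S *v (transpose A *v v) = 0"
      unfolding tAt by (simp add: matrix_vector_right_distrib matrix_vector_mult_scaleR v del: transpose_matrix_vector)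
    moreover have "transpose B *v v = 0"
      using bv by (simp add: vec_eq_iff matrix_vector_mult_def transpose_def column_def inner_vec_def forall_1
          del: transpose_matrix_vector)
    ultimately show ?thesis by simp
  qed
  have "0 < x \<bullet> (S *v x)" if "x \<noteq> 0" for x
  proof (rule ccontr)
    assume "\<not> 0 < x \<bullet> (S *v x)"
    with S(2)[of x] have "S *v x = 0" by (intro psd_kernel[OF S(1,2)]) auto
    then have "x = 0" using stabilizable_gramian_kernel[of A B S] eig' stab ker by blast
    with that show False by simp
  qed
  then obtain Q where Q: "S ** Q = mat 1" "Q ** S = mat 1" "transpose Q = Q" "\<And>x. x \<noteq> 0 \<Longrightarrow> 0 < x \<bullet> (Q *v x)"
    using pd_inverse[OF S(1)] by blast
  define \<beta> where "\<beta> = ?b \<bullet> (Q *v ?b)"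
  \<comment> \<open>Multiplying the Lyapunov equation by the inverse of its solution and taking
    traces removes \<open>S\<close> altogether.\<close>
  have "\<beta> = trace (Q ** (At ** S + S ** transpose At))"
    unfolding S(3) trace_dyad \<beta>_def ..
  also have "\<dots> = trace ((Q ** At) ** S) + trace ((Q ** S) ** transpose At)"
    by (simp add: matrix_add_ldistrib trace_add matrix_mul_assoc)
  also have "\<dots> = 2 * trace At"
    by (subst trace_mul_sym) (simp add: matrix_mul_assoc Q S trace_transpose)
  finally have "\<beta> = 2 * trace At" .
  with trAt have \<beta>: "\<sigma>\<^sup>2 * \<beta> / \<mu>\<^sup>2 < 1" using mu sigma by (simp add: field_simps)
  define k where "k = (- 1 / \<mu>) *\<^sub>R (Q *v ?b)"
  define K :: "real^'n^1" where "K = (\<chi> i. k)"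
  have rK: "row 1 K = k" by (simp add: K_def row_def vec_eq_iff)
  have "2 * (x \<bullet> (Q *v ((A + \<mu> *\<^sub>R (B ** K)) *v x)))
        + ((\<sigma> *\<^sub>R (B ** K)) *v x) \<bullet> (Q *v ((\<sigma> *\<^sub>R (B ** K)) *v x)) \<le> - 2 * \<epsilon> * (x \<bullet> (Q *v x))" for x
  proof -
    define y where "y = ?b \<bullet> (Q *v x)"
    have kx: "k \<bullet> x = - y / \<mu>"
      using inner_symmetric_mv[OF Q(3), of x ?b] by (simp add: k_def y_def inner_commute)
    have xQb: "x \<bullet> (Q *v ?b) = y" using inner_symmetric_mv[OF Q(3), of x ?b] by (simp add: y_def)
    \<comment> \<open>Read at the vector \<open>Q x\<close>, the Lyapunov equation says that the
      open loop with shift contributes \<open>y\<^sup>2\<close> to the decay balance. The feedback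
      contributes \<open>- 2 y\<^sup>2\<close> and the noise at most \<open>y\<^sup>2\<close>, so
      only the shift remains.\<close>
    have "x = S *v (Q *v x)" using Q(1) by (simp add: matrix_vector_mul_assoc)
    then have "2 * (x \<bullet> (Q *v (At *v x))) = 2 * ((Q *v x) \<bullet> (At *v (S *v (Q *v x))))"
      using inner_symmetric_mv[OF Q(3), of x "At *v x"] by (simp add: inner_commute)
    also have "\<dots> = y\<^sup>2" unfolding SG2 y_def ..
    finally have 1: "2 * (x \<bullet> (Q *v (A *v x))) = y\<^sup>2 - 2 * \<epsilon> * (x \<bullet> (Q *v x))"
      unfolding At by (simp add: matrix_vector_right_distrib matrix_vector_mult_scaleR inner_add_right)
    have "2 * (x \<bullet> (Q *v ((A + \<mu> *\<^sub>R (B ** K)) *v x)))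
        = 2 * (x \<bullet> (Q *v (A *v x))) + 2 * \<mu> * (k \<bullet> x) * y"
      by (simp add: matrix_vector_mult_add_rdistrib scaleR_matrix_vector_assoc[symmetric] single_input_mv rK
          matrix_vector_right_distrib matrix_vector_mult_scaleR inner_add_right xQb)
    also have "\<dots> = - y\<^sup>2 - 2 * \<epsilon> * (x \<bullet> (Q *v x))"
      unfolding 1 kx using mu by (simp add: power2_eq_square)
    finally have 2: "2 * (x \<bullet> (Q *v ((A + \<mu> *\<^sub>R (B ** K)) *v x))) = - y\<^sup>2 - 2 * \<epsilon> * (x \<bullet> (Q *v x))" .
    have "((\<sigma> *\<^sub>R (B ** K)) *v x) \<bullet> (Q *v ((\<sigma> *\<^sub>R (B ** K)) *v x)) = \<sigma>\<^sup>2 * (k \<bullet> x)\<^sup>2 * \<beta>"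
      by (simp add: scaleR_matrix_vector_assoc[symmetric] single_input_mv rK
          matrix_vector_mult_scaleR \<beta>_def power2_eq_square)
    also have "\<dots> = (\<sigma>\<^sup>2 * \<beta> / \<mu>\<^sup>2) * y\<^sup>2" unfolding kx by (simp add: power_divide)
    also have "\<dots> \<le> 1 * y\<^sup>2" using \<beta> by (intro mult_right_mono) auto
    finally show ?thesis using 2 by simp
  qed
  with \<epsilon> Q(3,4) show ?thesis by (rule that)
qed

text \<open>The hypothesis is the trace of \<open>S\<^sup>-\<^sup>1\<close> times the moment equation for \<open>S\<close>; the left-hand side
  is minimised over the value of \<open>k \<bullet> b\<close>.\<close>

lemma trace_condition_necessary:
  fixes S Q :: "real^'n^'n"
  assumes mu: "\<mu> \<noteq> 0" and sigma: "\<sigma> > 0"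
    and S: "transpose S = S" "\<And>x. 0 \<le> x \<bullet> (S *v x)" and Q: "S ** Q = mat 1"
    and neg: "2 * a + 2 * \<mu> * (k \<bullet> b) + \<sigma>\<^sup>2 * ((k \<bullet> (S *v k)) * (b \<bullet> (Q *v b))) < 0"
  shows "2 * (\<sigma>\<^sup>2 / \<mu>\<^sup>2) * a < 1"
proof -
  let ?y = "k \<bullet> b"
  \<comment> \<open>Applied to \<open>k\<close> and \<open>Q b\<close>, Cauchy-Schwarz for
    \<open>S\<close> has \<open>k \<bullet> b\<close> on the left and exactly the product from the
    noise term on the right.\<close>
  have SQb: "S *v (Q *v b) = b" using Q by (simp add: matrix_vector_mul_assoc)
  have "?y\<^sup>2 \<le> (k \<bullet> (S *v k)) * (b \<bullet> (Q *v b))"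
    using psd_Cauchy_Schwarz[OF S, of k "Q *v b"] unfolding SQb by (simp add: inner_commute)
  then have "\<sigma>\<^sup>2 * ?y\<^sup>2 \<le> \<sigma>\<^sup>2 * ((k \<bullet> (S *v k)) * (b \<bullet> (Q *v b)))" by (intro mult_left_mono) auto
  with neg have "2 * a + 2 * \<mu> * ?y + \<sigma>\<^sup>2 * ?y\<^sup>2 < 0" by linarith
  \<comment> \<open>The factor \<open>\<sigma>\<^sup>2\<close> completes the square
    \<open>(\<sigma>\<^sup>2 y + \<mu>)\<^sup>2\<close>, which is then dropped.\<close>
  then have "\<sigma>\<^sup>2 * (2 * a + 2 * \<mu> * ?y + \<sigma>\<^sup>2 * ?y\<^sup>2) < 0"
    using sigma by (simp add: mult_pos_neg)
  moreover have "\<sigma>\<^sup>2 * (2 * a + 2 * \<mu> * ?y + \<sigma>\<^sup>2 * ?y\<^sup>2) = 2 * \<sigma>\<^sup>2 * a + (\<sigma>\<^sup>2 * ?y + \<mu>)\<^sup>2 - \<mu>\<^sup>2"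
    by (simp add: power2_eq_square algebra_simps)
  ultimately have "2 * \<sigma>\<^sup>2 * a < \<mu>\<^sup>2" by (smt (verit) zero_le_power2)
  then show ?thesis using mu by (simp add: field_simps)
qed

section \<open>Square integrable functions\<close>

text \<open>Membership in \<open>L\<^sup>2\<close> for vector-valued functions. Measurability of
  \<open>U\<close> is listed because integrability of its squared norm does not imply it.\<close>

definition sqint :: "'a measure \<Rightarrow> ('a \<Rightarrow> 'b::euclidean_space) \<Rightarrow> bool" where
  "sqint M U \<longleftrightarrow> U \<in> borel_measurable M \<and> integrable M (\<lambda>x. (norm (U x))\<^sup>2)"

lemma sqint_measurable [measurable_dest]: "sqint M U \<Longrightarrow> U \<in> borel_measurable M"
  and sqint_integrable: "sqint M U \<Longrightarrow> integrable M (\<lambda>x. (norm (U x))\<^sup>2)"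
  by (auto simp: sqint_def)

lemma sqintI_le:
  assumes "U \<in> borel_measurable M" "integrable M g" "\<And>x. x \<in> space M \<Longrightarrow> (norm (U x))\<^sup>2 \<le> g x"
  shows "sqint M U"
  unfolding sqint_def
proof
  show "integrable M (\<lambda>x. (norm (U x))\<^sup>2)"
    by (rule Bochner_Integration.integrable_bound[OF assms(2)])
      (use assms in \<open>auto intro!: AE_I2 order_trans[OF assms(3)]\<close>)
qed fact

lemma norm_add_square_le: "(norm (x + y))\<^sup>2 \<le> 2 * (norm x)\<^sup>2 + 2 * (norm y)\<^sup>2" for x y :: "'b::real_inner"
proof -
  have "(norm (x + y))\<^sup>2 + (norm (x - y))\<^sup>2 = 2 * (norm x)\<^sup>2 + 2 * (norm y)\<^sup>2"
    by (simp add: power2_norm_eq_inner inner_add_left inner_add_right inner_diff_left inner_diff_right)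
  then show ?thesis by (smt (verit) zero_le_power2)
qed

lemma sqint_add: "sqint M U \<Longrightarrow> sqint M V \<Longrightarrow> sqint M (\<lambda>x. U x + V x)"
  by (rule sqintI_le[where g = "\<lambda>x. 2 * (norm (U x))\<^sup>2 + 2 * (norm (V x))\<^sup>2"])
    (auto simp: sqint_def norm_add_square_le)

lemma sqint_linear:
  fixes f :: "'b::euclidean_space \<Rightarrow> 'c::euclidean_space"
  assumes f: "bounded_linear f" and U: "sqint M U"
  shows "sqint M (\<lambda>x. f (U x))"
proof -
  obtain K where K: "\<And>x. norm (f x) \<le> norm x * K" using bounded_linear.bounded[OF f] by auto
  have "(norm (f x))\<^sup>2 \<le> K\<^sup>2 * (norm x)\<^sup>2" for x
    using power_mono[OF K[of x], of 2] by (simp add: power_mult_distrib mult.commute)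
  moreover have "f \<in> borel_measurable borel"
    using f by (intro borel_measurable_continuous_onI linear_continuous_on)
  ultimately show ?thesis using U
    by (intro sqintI_le[where g = "\<lambda>x. K\<^sup>2 * (norm (U x))\<^sup>2"])
      (auto simp: sqint_def intro: measurable_compose)
qed

lemma sqint_scaleR: "sqint M U \<Longrightarrow> sqint M (\<lambda>x. c *\<^sub>R U x)"
  by (rule sqint_linear[OF bounded_linear_scaleR_right])

lemma sqint_diff: "sqint M U \<Longrightarrow> sqint M V \<Longrightarrow> sqint M (\<lambda>x. U x - V x)"
  using sqint_add[of M U "\<lambda>x. (-1) *\<^sub>R V x"] sqint_scaleR[of M V "-1"] by simp

lemma measurable_mv: "U \<in> borel_measurable N \<Longrightarrow> (\<lambda>x. B *v U x) \<in> borel_measurable N" for B :: "real^'n^'m"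
  by (rule measurable_compose[of _ _ borel])
    (auto intro!: borel_measurable_continuous_onI matrix_vector_mult_linear_continuous_on)

lemma sqint_mv: "sqint M U \<Longrightarrow> sqint M (\<lambda>x. A *v U x)" for A :: "real^'n^'m"
  by (rule sqint_linear[OF matrix_vector_mul_bounded_linear])

lemma sqint_0: "sqint M (\<lambda>x. 0)"
  by (simp add: sqint_def)

lemma sqint_sum: "(\<And>i. i \<in> I \<Longrightarrow> sqint M (U i)) \<Longrightarrow> sqint M (\<lambda>x. \<Sum>i\<in>I. U i x)"
  by (induction I rule: infinite_finite_induct) (auto simp: sqint_0 sqint_add)

lemma (in finite_measure) sqint_const: "sqint M (\<lambda>x. c)"
  by (simp add: sqint_def)

lemma sqint_inner:
  assumes U: "sqint M U" and V: "sqint M V"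
  shows "integrable M (\<lambda>x. U x \<bullet> V x)"
proof (rule Bochner_Integration.integrable_bound[of M "\<lambda>x. (norm (U x))\<^sup>2 + (norm (V x))\<^sup>2"])
  have "norm (u \<bullet> v) \<le> (norm u)\<^sup>2 + (norm v)\<^sup>2" for u v :: 'b
  proof -
    have "norm (u \<bullet> v) \<le> norm u * norm v" using Cauchy_Schwarz_ineq2 by simp
    also have "\<dots> \<le> (norm u)\<^sup>2 + (norm v)\<^sup>2"
      using sum_squares_bound[of "norm u" "norm v"] mult_nonneg_nonneg[OF norm_ge_zero norm_ge_zero, of u v]
      by linarith
    finally show ?thesis .
  qed
  then show "AE x in M. norm (U x \<bullet> V x) \<le> norm ((norm (U x))\<^sup>2 + (norm (V x))\<^sup>2)"
    by (intro AE_I2) (simp add: abs_of_nonneg)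
qed (use U V in \<open>auto simp: sqint_def\<close>)

text \<open>The integral of the squared norm of \<open>U + t V\<close> is a nonnegative quadratic
  polynomial in \<open>t\<close>.\<close>

lemma integral_inner_Cauchy_Schwarz:
  assumes U: "sqint M U" and V: "sqint M V"
  shows "(\<integral>x. U x \<bullet> V x \<partial>M)\<^sup>2 \<le> (\<integral>x. (norm (U x))\<^sup>2 \<partial>M) * (\<integral>x. (norm (V x))\<^sup>2 \<partial>M)"
proof (rule quadratic_nonneg_discriminant)
  fix t :: real
  have "0 \<le> (\<integral>x. (norm (U x + t *\<^sub>R V x))\<^sup>2 \<partial>M)" by simp
  also have "\<dots> = (\<integral>x. (norm (U x))\<^sup>2 + 2 * t * (U x \<bullet> V x) + t\<^sup>2 * (norm (V x))\<^sup>2 \<partial>M)"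
  proof (intro Bochner_Integration.integral_cong refl)
    fix x
    show "(norm (U x + t *\<^sub>R V x))\<^sup>2 = (norm (U x))\<^sup>2 + 2 * t * (U x \<bullet> V x) + t\<^sup>2 * (norm (V x))\<^sup>2"
      unfolding power2_norm_eq_inner
      by (simp add: inner_add_left inner_add_right inner_commute power2_eq_square algebra_simps)
  qed
  also have "\<dots> = (\<integral>x. (norm (U x))\<^sup>2 \<partial>M) + 2 * t * (\<integral>x. U x \<bullet> V x \<partial>M) + t\<^sup>2 * (\<integral>x. (norm (V x))\<^sup>2 \<partial>M)"
    using sqint_integrable[OF U] sqint_integrable[OF V] sqint_inner[OF U V] by simp
  finally show "0 \<le> \<dots>" .
qed simp

text \<open>The difference of the two inner products is a sum of three terms, each containing an
  error factor, and Cauchy-Schwarz sends each of them to zero.\<close>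

lemma sqint_tendsto_inner:
  assumes "\<And>k. sqint M (U' k)" "sqint M U" "\<And>k. sqint M (V' k)" "sqint M V"
    and U: "(\<lambda>k. \<integral>x. (norm (U x - U' k x))\<^sup>2 \<partial>M) \<longlonglongrightarrow> 0"
    and V: "(\<lambda>k. \<integral>x. (norm (V x - V' k x))\<^sup>2 \<partial>M) \<longlonglongrightarrow> 0"
  shows "(\<lambda>k. \<integral>x. U' k x \<bullet> V' k x \<partial>M) \<longlonglongrightarrow> (\<integral>x. U x \<bullet> V x \<partial>M)"
proof -
  note sq = assms(1-4) sqint_diff[OF assms(2) assms(1)] sqint_diff[OF assms(4) assms(3)]
  have small: "(\<lambda>k. \<integral>x. f k x \<bullet> g k x \<partial>M) \<longlonglongrightarrow> 0"
    if "\<And>k. sqint M (f k)" "\<And>k. sqint M (g k)"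
      "(\<lambda>k. (\<integral>x. (norm (f k x))\<^sup>2 \<partial>M) * (\<integral>x. (norm (g k x))\<^sup>2 \<partial>M)) \<longlonglongrightarrow> 0" for f g :: "nat \<Rightarrow> 'a \<Rightarrow> 'b"
  proof -
    have "(\<lambda>k. (\<integral>x. f k x \<bullet> g k x \<partial>M)\<^sup>2) \<longlonglongrightarrow> 0"
      by (rule tendsto_sandwich[OF _ _ tendsto_const that(3)])
        (auto intro!: eventuallyI integral_inner_Cauchy_Schwarz that)
    from tendsto_real_sqrt[OF this] show ?thesis by (simp add: tendsto_rabs_zero_iff)
  qed
  have 1: "(\<lambda>k. \<integral>x. (U x - U' k x) \<bullet> (V x - V' k x) \<partial>M) \<longlonglongrightarrow> 0"
    using tendsto_mult[OF U V] by (intro small sq) simp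
  have 2: "(\<lambda>k. \<integral>x. (U x - U' k x) \<bullet> V x \<partial>M) \<longlonglongrightarrow> 0"
    using tendsto_mult[OF U tendsto_const] by (intro small sq) simp
  have 3: "(\<lambda>k. \<integral>x. U x \<bullet> (V x - V' k x) \<partial>M) \<longlonglongrightarrow> 0"
    using tendsto_mult[OF tendsto_const V] by (intro small sq) simp
  have "(\<integral>x. U' k x \<bullet> V' k x \<partial>M) = (\<integral>x. U x \<bullet> V x \<partial>M) + (\<integral>x. (U x - U' k x) \<bullet> (V x - V' k x) \<partial>M)
      - (\<integral>x. (U x - U' k x) \<bullet> V x \<partial>M) - (\<integral>x. U x \<bullet> (V x - V' k x) \<partial>M)" for k
  proof -
    have "(\<integral>x. U' k x \<bullet> V' k x \<partial>M) = (\<integral>x. U x \<bullet> V x + (U x - U' k x) \<bullet> (V x - V' k x)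
      - (U x - U' k x) \<bullet> V x - U x \<bullet> (V x - V' k x) \<partial>M)"
      by (simp add: inner_diff_left inner_diff_right algebra_simps)
    also have "\<dots> = (\<integral>x. U x \<bullet> V x \<partial>M) + (\<integral>x. (U x - U' k x) \<bullet> (V x - V' k x) \<partial>M)
      - (\<integral>x. (U x - U' k x) \<bullet> V x \<partial>M) - (\<integral>x. U x \<bullet> (V x - V' k x) \<partial>M)"
      by (subst Bochner_Integration.integral_diff Bochner_Integration.integral_add;
          (intro Bochner_Integration.integrable_diff Bochner_Integration.integrable_add sqint_inner sq)?)+ simp
    finally show ?thesis .
  qed
  then show ?thesis
    using tendsto_diff[OF tendsto_diff[OF tendsto_add[OF tendsto_const[of "\<integral>x. U x \<bullet> V x \<partial>M"] 1] 2] 3] by simp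
qed

lemma sqint_integrable_fun: "sqint M U \<Longrightarrow> finite_measure M \<Longrightarrow> integrable M U"
proof (rule Bochner_Integration.integrable_bound[of M "\<lambda>x. 1 + (norm (U x))\<^sup>2"])
  assume U: "sqint M U" and "finite_measure M"
  then interpret finite_measure M by simp
  show "integrable M (\<lambda>x. 1 + (norm (U x))\<^sup>2)" using sqint_integrable[OF U] by simp
  have "norm u \<le> 1 + (norm u)\<^sup>2" for u :: 'b
    using sum_squares_bound[of 1 "norm u"] by (simp add: power2_eq_square) (smt (verit) norm_ge_zero)
  then show "AE x in M. norm (U x) \<le> norm (1 + (norm (U x))\<^sup>2)" by (intro AE_I2) (simp add: abs_of_nonneg)
qed auto

section \<open>The Ito integral\<close>

context wiener_process
begin

lemma measurable_F_mono: "s \<le> t \<Longrightarrow> f \<in> measurable (F s) N \<Longrightarrow> f \<in> measurable (F t) N"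
  using measurable_mono[of N N "F s" "F t"] sets_F_mono[of s t] by (auto simp: space_F)

lemma measurable_F_M: "f \<in> measurable (F s) N \<Longrightarrow> f \<in> measurable M N"
  using measurable_mono[of N N "F s" M] F_subset[of s] by (auto simp: space_F)

lemma W_measurable: "0 \<le> t \<Longrightarrow> W t \<in> borel_measurable M"
  using adapted measurable_F_M by blast

lemma increment_moments:
  assumes "0 \<le> a" "a < b"
  shows "integrable M (\<lambda>\<omega>. W b \<omega> - W a \<omega>)" "expectation (\<lambda>\<omega>. W b \<omega> - W a \<omega>) = 0"
    "integrable M (\<lambda>\<omega>. (W b \<omega> - W a \<omega>)\<^sup>2)" "expectation (\<lambda>\<omega>. (W b \<omega> - W a \<omega>)\<^sup>2) = b - a"
proof -
  note D = increments_normal[OF assms]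
  have s: "0 < sqrt (b - a)" using assms by simp
  show "integrable M (\<lambda>\<omega>. W b \<omega> - W a \<omega>)"
    using distributed_integrable_var[OF D] integrable_normal_moment[OF s, of 0 1] by simp
  show "expectation (\<lambda>\<omega>. W b \<omega> - W a \<omega>) = 0"
    using distributed_integral[OF D, of "\<lambda>x. x"] integral_normal_moment_odd[OF s, of 0 0] by simp
  show "integrable M (\<lambda>\<omega>. (W b \<omega> - W a \<omega>)\<^sup>2)"
    using distributed_integrable[OF D, of "\<lambda>x. x\<^sup>2"] integrable_normal_moment[OF s, of 0 2] by simp
  show "expectation (\<lambda>\<omega>. (W b \<omega> - W a \<omega>)\<^sup>2) = b - a"
    using distributed_integral[OF D, of "\<lambda>x. x\<^sup>2"] integral_normal_moment_even[OF s, of 0 1] assms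
    by (simp add: fact_2)
qed

text \<open>The locale states independence for the preimages under the increment; as they are stable
  under intersection, it passes to the generated sigma-algebras and then down to the one generated
  by \<open>f\<close>.\<close>

lemma indep_increment:
  assumes "0 \<le> a" "a < b" and f: "f \<in> borel_measurable (F a)"
  shows "indep_var borel f borel (\<lambda>\<omega>. W b \<omega> - W a \<omega>)"
proof -
  let ?D = "\<lambda>\<omega>. W b \<omega> - W a \<omega>"
  let ?E = "{?D -` S \<inter> space M | S. S \<in> sets borel}"
  have "indep_set (sigma_sets (space M) (sets (F a))) (sigma_sets (space M) ?E)"
  proof (rule indep_set_sigma_sets[OF increments_indep[OF assms(1,2)]])
    show "Int_stable (sets (F a))" by (rule sets.Int_stable)
    show "Int_stable ?E"
      by (auto simp: Int_stable_def) (metis (no_types, lifting) Int_assoc Int_left_absorb inf_commute sets.Int vimage_Int)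
  qed
  moreover have "sigma_sets (space M) {f -` A \<inter> space M | A. A \<in> sets borel} \<subseteq> sigma_sets (space M) (sets (F a))"
    using measurable_sets[OF f] by (intro sigma_sets_mono') (auto simp: space_F)
  ultimately have "indep_set (sigma_sets (space M) {f -` A \<inter> space M | A. A \<in> sets borel}) (sigma_sets (space M) ?E)"
    unfolding indep_sets2_eq by blast
  moreover have "?D \<in> borel_measurable M" using W_measurable assms by simp
  ultimately show ?thesis
    unfolding indep_var_eq using measurable_F_M[OF f] by simp
qed

text \<open>Independence factorizes the expectations. The case \<open>a = b\<close> is separate
  because the normal law is stated for increments over \<open>s < t\<close>.\<close>

lemma increment_mult:
  assumes ab: "0 \<le> a" "a \<le> b" and f: "f \<in> borel_measurable (F a)" "integrable M f"
  shows "integrable M (\<lambda>\<omega>. f \<omega> * (W b \<omega> - W a \<omega>))"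
    and "expectation (\<lambda>\<omega>. f \<omega> * (W b \<omega> - W a \<omega>)) = 0"
    and "integrable M (\<lambda>\<omega>. f \<omega> * (W b \<omega> - W a \<omega>)\<^sup>2)"
    and "expectation (\<lambda>\<omega>. f \<omega> * (W b \<omega> - W a \<omega>)\<^sup>2) = (b - a) * expectation f"
proof -
  let ?D = "\<lambda>\<omega>. W b \<omega> - W a \<omega>"
  have "integrable M (\<lambda>\<omega>. f \<omega> * ?D \<omega>) \<and> expectation (\<lambda>\<omega>. f \<omega> * ?D \<omega>) = 0 \<and>
    integrable M (\<lambda>\<omega>. f \<omega> * (?D \<omega>)\<^sup>2) \<and> expectation (\<lambda>\<omega>. f \<omega> * (?D \<omega>)\<^sup>2) = (b - a) * expectation f"
  proof (cases "a = b")
    case False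
    with ab have ab': "a < b" by simp
    note m = increment_moments[OF ab(1) ab']
    note I = indep_increment[OF ab(1) ab' f(1)]
    have "indep_var borel (id \<circ> f) borel ((\<lambda>x. x\<^sup>2) \<circ> ?D)"
      by (rule indep_var_compose[OF I]) auto
    then have I2: "indep_var borel f borel (\<lambda>\<omega>. (?D \<omega>)\<^sup>2)" by (simp add: comp_def)
    show ?thesis
      using indep_var_integrable[OF I f(2) m(1)] indep_var_lebesgue_integral[OF I f(2) m(1)] m(2,4)
        indep_var_integrable[OF I2 f(2) m(3)] indep_var_lebesgue_integral[OF I2 f(2) m(3)] by simp
  qed simp
  then show "integrable M (\<lambda>\<omega>. f \<omega> * (W b \<omega> - W a \<omega>))"
    and "expectation (\<lambda>\<omega>. f \<omega> * (W b \<omega> - W a \<omega>)) = 0"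
    and "integrable M (\<lambda>\<omega>. f \<omega> * (W b \<omega> - W a \<omega>)\<^sup>2)"
    and "expectation (\<lambda>\<omega>. f \<omega> * (W b \<omega> - W a \<omega>)\<^sup>2) = (b - a) * expectation f" by auto
qed

lemma sqint_increment:
  assumes "0 \<le> a" "a \<le> b" "h \<in> borel_measurable (F a)" "sqint M h"
  shows "sqint M (\<lambda>\<omega>. (W b \<omega> - W a \<omega>) *\<^sub>R h \<omega>)"
  unfolding sqint_def
proof
  show "(\<lambda>\<omega>. (W b \<omega> - W a \<omega>) *\<^sub>R h \<omega>) \<in> borel_measurable M"
    using W_measurable assms by (auto simp: sqint_def)
  have "integrable M (\<lambda>\<omega>. (norm (h \<omega>))\<^sup>2 * (W b \<omega> - W a \<omega>)\<^sup>2)"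
    using assms by (intro increment_mult(3)) (auto simp: sqint_def)
  then show "integrable M (\<lambda>\<omega>. (norm ((W b \<omega> - W a \<omega>) *\<^sub>R h \<omega>))\<^sup>2)"
    by (simp add: power_mult_distrib mult.commute)
qed

lemma increment_orthogonal:
  assumes "0 \<le> a" "a \<le> b" and Z: "sqint M Z" "Z \<in> borel_measurable (F a)"
    and h: "sqint M h" "h \<in> borel_measurable (F a)"
  shows "expectation (\<lambda>\<omega>. Z \<omega> \<bullet> ((W b \<omega> - W a \<omega>) *\<^sub>R h \<omega>)) = 0"
  using increment_mult(2)[of a b "\<lambda>\<omega>. Z \<omega> \<bullet> h \<omega>"] sqint_inner[OF Z(1) h(1)] assms by (simp add: mult.commute)

lemma increments_disjoint:
  assumes "0 \<le> a" "a \<le> b" "b \<le> c" "c \<le> d"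
    and h: "sqint M h" "h \<in> borel_measurable (F a)" and g: "sqint M g" "g \<in> borel_measurable (F c)"
  shows "expectation (\<lambda>\<omega>. ((W b \<omega> - W a \<omega>) *\<^sub>R h \<omega>) \<bullet> ((W d \<omega> - W c \<omega>) *\<^sub>R g \<omega>)) = 0"
proof (rule increment_orthogonal)
  show "sqint M (\<lambda>\<omega>. (W b \<omega> - W a \<omega>) *\<^sub>R h \<omega>)" using assms by (intro sqint_increment) auto
  have "W a \<in> borel_measurable (F c)" "W b \<in> borel_measurable (F c)" "h \<in> borel_measurable (F c)"
    using assms measurable_F_mono[of a c] measurable_F_mono[of b c] adapted[of a] adapted[of b] by auto
  then show "(\<lambda>\<omega>. (W b \<omega> - W a \<omega>) *\<^sub>R h \<omega>) \<in> borel_measurable (F c)" by simp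
qed (use assms in auto)

text \<open>Allowing arbitrary positions of the two intervals spares the isometry a common
  refinement of two grids. Both intervals are cut at the ends of their overlap; pieces over disjoint
  intervals are orthogonal, and only the common piece contributes.\<close>

lemma increments_inner:
  assumes ab: "0 \<le> a" "a \<le> b" and cd: "0 \<le> c" "c \<le> d"
    and h: "sqint M h" "h \<in> borel_measurable (F a)" and g: "sqint M g" "g \<in> borel_measurable (F c)"
  shows "expectation (\<lambda>\<omega>. ((W b \<omega> - W a \<omega>) *\<^sub>R h \<omega>) \<bullet> ((W d \<omega> - W c \<omega>) *\<^sub>R g \<omega>))
    = measure lborel ({a<..b} \<inter> {c<..d}) * expectation (\<lambda>\<omega>. h \<omega> \<bullet> g \<omega>)"
proof -
  consider "b \<le> c" | "d \<le> a" | "c < b" "a < d" by linarith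
  then show ?thesis
  proof cases
    case 1
    then have e: "{a<..b} \<inter> {c<..d} = {}" by auto
    show ?thesis unfolding e using increments_disjoint[OF ab 1 cd(2) h g] by simp
  next
    case 2
    then have e: "{a<..b} \<inter> {c<..d} = {}" by auto
    show ?thesis unfolding e using increments_disjoint[OF cd 2 ab(2) g h] by (simp add: inner_commute)
  next
    case 3
    define p q where "p = max a c" and "q = min b d"
    let ?E = "\<lambda>s t u v. expectation (\<lambda>\<omega>. ((W t \<omega> - W s \<omega>) *\<^sub>R h \<omega>) \<bullet> ((W v \<omega> - W u \<omega>) *\<^sub>R g \<omega>))"
    have o: "0 \<le> p" "a \<le> p" "c \<le> p" "p \<le> q" "q \<le> b" "q \<le> d" "0 \<le> q"
      using ab cd 3 by (auto simp: p_def q_def)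
    have hp: "h \<in> borel_measurable (F p)" "g \<in> borel_measurable (F p)" "h \<in> borel_measurable (F q)" "g \<in> borel_measurable (F q)"
      using measurable_F_mono h(2) g(2) o by (meson order_trans)+
    have hs: "sqint M (\<lambda>\<omega>. (W t \<omega> - W s \<omega>) *\<^sub>R f \<omega>)"
      if "p \<le> s" "s \<le> t" "sqint M f" "f \<in> borel_measurable (F p)" for s t f
      by (rule sqint_increment[OF _ that(2) measurable_F_mono[OF that(1,4)] that(3)]) (use that o in auto)
    have ha: "sqint M (\<lambda>\<omega>. (W p \<omega> - W a \<omega>) *\<^sub>R h \<omega>)" and gc: "sqint M (\<lambda>\<omega>. (W p \<omega> - W c \<omega>) *\<^sub>R g \<omega>)"
      using sqint_increment h g ab cd o by auto
    note sq = ha gc hs[OF order_refl o(4) h(1) hp(1)] hs[OF o(4,5) h(1) hp(1)]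
      hs[OF order_refl o(4) g(1) hp(2)] hs[OF o(4,6) g(1) hp(2)]
    have "?E a b c d = expectation (\<lambda>\<omega>.
        ((W p \<omega> - W a \<omega>) *\<^sub>R h \<omega> + (W q \<omega> - W p \<omega>) *\<^sub>R h \<omega> + (W b \<omega> - W q \<omega>) *\<^sub>R h \<omega>) \<bullet>
        ((W p \<omega> - W c \<omega>) *\<^sub>R g \<omega> + (W q \<omega> - W p \<omega>) *\<^sub>R g \<omega> + (W d \<omega> - W q \<omega>) *\<^sub>R g \<omega>))"
      by (simp only: scaleR_add_left[symmetric]) simp
    also have "\<dots> = ?E a p c p + ?E a p p q + ?E a p q d + (?E p q c p + ?E p q p q + ?E p q q d)
        + (?E q b c p + ?E q b p q + ?E q b q d)"
      unfolding inner_add_left inner_add_right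
      by (subst Bochner_Integration.integral_add;
          (intro Bochner_Integration.integrable_add sqint_inner sq)?)+ simp
    \<comment> \<open>Here \<open>p\<close> is one of the two left ends, so one of the two
      increments is zero.\<close>
    also have "?E a p c p = 0" by (cases "a \<le> c") (simp_all add: p_def max_def)
    also have "?E a p p q = 0" using ab o h g hp by (intro increments_disjoint) auto
    also have "?E a p q d = 0" using ab o h g hp by (intro increments_disjoint) auto
    also have "?E p q q d = 0" using ab o h g hp by (intro increments_disjoint) auto
    also have "?E p q c p = 0"
      using increments_disjoint[of c p p q g h] cd o h g hp by (simp add: inner_commute)
    also have "?E q b c p = 0"
      using increments_disjoint[of c p q b g h] cd o h g hp by (simp add: inner_commute)
    also have "?E q b p q = 0"
      using increments_disjoint[of p q q b g h] cd o h g hp by (simp add: inner_commute)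
    also have "?E q b q d = 0" by (cases "b \<le> d") (simp_all add: q_def min_def)
    also have "?E p q p q = expectation (\<lambda>\<omega>. (h \<omega> \<bullet> g \<omega>) * (W q \<omega> - W p \<omega>)\<^sup>2)"
      by (simp add: power2_eq_square mult_ac)
    also have "\<dots> = (q - p) * expectation (\<lambda>\<omega>. h \<omega> \<bullet> g \<omega>)"
      using hp o by (intro increment_mult(4) sqint_inner h g) auto
    also have "{a<..b} \<inter> {c<..d} = {p<..q}" by (auto simp: p_def q_def)
    then have "q - p = measure lborel ({a<..b} \<inter> {c<..d})" using o(4) by simp
    finally show ?thesis by simp
  qed
qed

end

text \<open>A finite distance to a single \<open>U' k\<close> already makes \<open>U\<close> square
  integrable. From then on the extended integrals are real ones, and the calculus of inner products
  applies.\<close>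

lemma sqint_limit:
  fixes U :: "'a \<Rightarrow> 'b::euclidean_space"
  assumes U: "U \<in> borel_measurable M" and U': "\<And>k. sqint M (U' k)"
    and lim: "(\<lambda>k. \<integral>\<^sup>+x. ennreal ((norm (U x - U' k x))\<^sup>2) \<partial>M) \<longlonglongrightarrow> 0"
  shows "sqint M U" "(\<lambda>k. \<integral>x. (norm (U x - U' k x))\<^sup>2 \<partial>M) \<longlonglongrightarrow> 0"
proof -
  have m: "(\<lambda>x. U x - U' k x) \<in> borel_measurable M" for k
    using U U'[of k] by (auto simp: sqint_def)
  from order_tendstoD(2)[OF lim, of 1] obtain k where "(\<integral>\<^sup>+x. ennreal ((norm (U x - U' k x))\<^sup>2) \<partial>M) < 1"
    by (auto simp: eventually_sequentially)
  then have "(\<integral>\<^sup>+x. ennreal ((norm (U x - U' k x))\<^sup>2) \<partial>M) < \<infinity>"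
    using ennreal_one_less_top order_less_trans by fastforce
  then have "sqint M (\<lambda>x. U x - U' k x)"
    using m[of k] by (auto simp: sqint_def integrable_iff_bounded)
  from sqint_add[OF this U'[of k]] show sq: "sqint M U" by simp
  have "(\<integral>\<^sup>+x. ennreal ((norm (U x - U' k x))\<^sup>2) \<partial>M) = ennreal (\<integral>x. (norm (U x - U' k x))\<^sup>2 \<partial>M)" for k
    using sqint_integrable[OF sqint_diff[OF sq U'[of k]]] by (intro nn_integral_eq_integral) auto
  with lim have "(\<lambda>k. ennreal (\<integral>x. (norm (U x - U' k x))\<^sup>2 \<partial>M)) \<longlonglongrightarrow> ennreal 0" by simp
  then show "(\<lambda>k. \<integral>x. (norm (U x - U' k x))\<^sup>2 \<partial>M) \<longlonglongrightarrow> 0"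
    by (rule tendsto_ennrealD) auto
qed

lemma integral_norm_diff_square:
  assumes U: "sqint M U" and V: "sqint M V"
  shows "(\<integral>x. (norm (U x - V x))\<^sup>2 \<partial>M)
    = (\<integral>x. U x \<bullet> U x \<partial>M) - 2 * (\<integral>x. U x \<bullet> V x \<partial>M) + (\<integral>x. V x \<bullet> V x \<partial>M)"
proof -
  have "(\<integral>x. (norm (U x - V x))\<^sup>2 \<partial>M) = (\<integral>x. U x \<bullet> U x - 2 * (U x \<bullet> V x) + V x \<bullet> V x \<partial>M)"
    unfolding power2_norm_eq_inner
    by (simp add: inner_diff_left inner_diff_right inner_commute algebra_simps)
  then show ?thesis using sqint_inner[OF U U] sqint_inner[OF U V] sqint_inner[OF V V] by simp
qed

lemma integral_norm_add_square_le:
  assumes U: "sqint M U" and V: "sqint M V"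
  shows "(\<integral>x. (norm (U x + V x))\<^sup>2 \<partial>M) \<le> 2 * (\<integral>x. (norm (U x))\<^sup>2 \<partial>M) + 2 * (\<integral>x. (norm (V x))\<^sup>2 \<partial>M)"
proof -
  have "(\<integral>x. (norm (U x + V x))\<^sup>2 \<partial>M) \<le> (\<integral>x. 2 * (norm (U x))\<^sup>2 + 2 * (norm (V x))\<^sup>2 \<partial>M)"
    using sqint_integrable[OF U] sqint_integrable[OF V] sqint_integrable[OF sqint_add[OF U V]]
    by (intro integral_mono) (auto simp: norm_add_square_le)
  then show ?thesis using sqint_integrable[OF U] sqint_integrable[OF V] by simp
qed

lemma sqint_minus: "sqint M U \<Longrightarrow> sqint M (\<lambda>x. - U x)"
  using sqint_scaleR[of M U "-1"] by simp

lemma integral_norm_diff_square_le: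
  assumes U: "sqint M U" and V: "sqint M V"
  shows "(\<integral>x. (norm (U x - V x))\<^sup>2 \<partial>M) \<le> 2 * (\<integral>x. (norm (U x))\<^sup>2 \<partial>M) + 2 * (\<integral>x. (norm (V x))\<^sup>2 \<partial>M)"
  using integral_norm_add_square_le[OF U sqint_minus[OF V]] by simp

lemma sets_restrict_lborel: "sets (restrict_space lborel A) = sets (restrict_space borel A)"
  by (simp add: sets_restrict_space)

lemma measurable_restrict_lborel: "f \<in> measurable borel N \<Longrightarrow> f \<in> measurable (restrict_space lborel A) N"
  by (simp add: measurable_restrict_space1)

lemma finite_measure_restrict_lborel: "finite_measure (restrict_space lborel {0..t::real})"
  by (rule finite_measureI) (simp add: emeasure_restrict_space space_restrict_space ennreal_mult_less_top emeasure_lborel_Icc_eq)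

section \<open>Processes as functions on the product of time and probability space\<close>

context wiener_process
begin

text \<open>The energy of a process is its squared norm in \<open>L\<^sup>2\<close> of this measure,
  so that the Ito integral becomes an isometry from \<open>PM t\<close> to \<open>M\<close>. The
  second factor carries all of \<open>M\<close>; adaptedness is tracked separately.\<close>

definition PM :: "real \<Rightarrow> (real \<times> 'a) measure" where
  "PM t = restrict_space lborel {0..t} \<Otimes>\<^sub>M M"

lemma finite_measure_PM: "finite_measure (PM t)"
  unfolding PM_def by (intro finite_measure_pair_measure finite_measure_restrict_lborel finite_measure_axioms)

lemma pair_sigma_finite_PM: "pair_sigma_finite (restrict_space lborel {0..t::real}) M"
proof -
  interpret finite_measure "restrict_space lborel {0..t}" by (rule finite_measure_restrict_lborel)
  show ?thesis by (simp add: pair_sigma_finite_def sigma_finite_measure_axioms prob_space_imp_sigma_finite[OF prob_space_axioms])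
qed

lemma measurable_fst_PM [measurable]: "fst \<in> borel_measurable (PM t)"
  unfolding PM_def by (intro measurable_compose[OF measurable_fst measurable_restrict_lborel]) auto

lemma measurable_snd_PM [measurable]: "snd \<in> measurable (PM t) M"
  unfolding PM_def by simp

lemma progressive_measurable:
  assumes "progressive F H" "0 \<le> t"
  shows "(\<lambda>p. H (fst p) (snd p)) \<in> borel_measurable (PM t)"
proof -
  have "(\<lambda>\<omega>. \<omega>) \<in> measurable M (F t)"
    using F_subset[of t] by (auto simp: measurable_def space_F sets.sets_into_space[THEN Int_absorb2])
  then have "(\<lambda>p. (fst p, snd p)) \<in> measurable (PM t) (restrict_space borel {0..t} \<Otimes>\<^sub>M F t)"
    unfolding PM_def by (intro measurable_Pair) (auto intro: measurable_compose[OF measurable_snd]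
        simp: measurable_cong_sets[OF refl sets_restrict_lborel[symmetric]])
  from measurable_compose[OF this] assms show ?thesis
    by (auto simp: progressive_def case_prod_unfold)
qed

lemma energy_eq:
  assumes "(\<lambda>p. H (fst p) (snd p)) \<in> borel_measurable (PM t)"
  shows "energy M t H = (\<integral>\<^sup>+p. ennreal ((norm (H (fst p) (snd p)))\<^sup>2) \<partial>PM t)"
proof -
  interpret P: pair_sigma_finite "restrict_space lborel {0..t}" M by (rule pair_sigma_finite_PM)
  have "(\<integral>\<^sup>+p. ennreal ((norm (H (fst p) (snd p)))\<^sup>2) \<partial>PM t)
      = (\<integral>\<^sup>+\<omega>. \<integral>\<^sup>+s. ennreal ((norm (H s \<omega>))\<^sup>2) \<partial>restrict_space lborel {0..t} \<partial>M)"
    using P.nn_integral_snd[of "\<lambda>p. ennreal ((norm (H (fst p) (snd p)))\<^sup>2)"] assms unfolding PM_def by simp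
  also have "\<dots> = energy M t H"
    unfolding energy_def by (simp add: nn_integral_restrict_space)
  finally show ?thesis ..
qed

lemma integrable_fst_snd:
  fixes f :: "real \<Rightarrow> real" and g :: "'a \<Rightarrow> real"
  assumes f: "integrable (restrict_space lborel {0..t}) f" and g: "integrable M g"
  shows "integrable (PM t) (\<lambda>p. f (fst p) * g (snd p))"
proof -
  interpret P: pair_sigma_finite "restrict_space lborel {0..t}" M by (rule pair_sigma_finite_PM)
  have "integrable (restrict_space lborel {0..t}) (\<lambda>s. \<bar>f s\<bar> * expectation (\<lambda>\<omega>. \<bar>g \<omega>\<bar>))"
    using f by simp
  then show ?thesis
    unfolding PM_def using f g by (intro P.Fubini_integrable) (auto simp: abs_mult)
qed

lemma integral_fst_snd:
  fixes f :: "real \<Rightarrow> real" and g :: "'a \<Rightarrow> real"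
  assumes f: "integrable (restrict_space lborel {0..t}) f" and g: "integrable M g"
  shows "(\<integral>p. f (fst p) * g (snd p) \<partial>PM t) = (\<integral>s. f s \<partial>restrict_space lborel {0..t}) * expectation g"
proof -
  interpret P: pair_sigma_finite "restrict_space lborel {0..t}" M by (rule pair_sigma_finite_PM)
  show ?thesis
    using P.integral_fst'[OF integrable_fst_snd[OF f g, unfolded PM_def]] unfolding PM_def by simp
qed

lemma integrable_indicator_restrict:
  fixes S :: "real set"
  shows "S \<in> sets borel \<Longrightarrow> integrable (restrict_space lborel {0..t}) (indicat_real S)"
proof -
  assume S: "S \<in> sets borel"
  interpret finite_measure "restrict_space lborel {0..t}" by (rule finite_measure_restrict_lborel)
  show ?thesis
    by (rule integrable_const_bound[of _ 1]) (use S in \<open>auto intro!: measurable_restrict_lborel\<close>)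
qed

lemma sqint_indicator_PM:
  assumes h: "sqint M h" and S: "S \<in> sets borel"
  shows "sqint (PM t) (\<lambda>p. indicat_real S (fst p) *\<^sub>R h (snd p))"
  unfolding sqint_def
proof
  show "(\<lambda>p. indicat_real S (fst p) *\<^sub>R h (snd p)) \<in> borel_measurable (PM t)"
    using h S by (auto simp: sqint_def intro!: borel_measurable_scaleR measurable_compose[OF measurable_fst_PM]
        measurable_compose[OF measurable_snd_PM])
  have "(\<lambda>p. (norm (indicat_real S (fst p) *\<^sub>R h (snd p)))\<^sup>2) = (\<lambda>p. indicat_real S (fst p) * (norm (h (snd p)))\<^sup>2)"
    by (auto simp: indicator_def fun_eq_iff)
  then show "integrable (PM t) (\<lambda>p. (norm (indicat_real S (fst p) *\<^sub>R h (snd p)))\<^sup>2)"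
    using integrable_fst_snd[OF integrable_indicator_restrict[OF S, of t] sqint_integrable[OF h]] by simp
qed

text \<open>The counterpart of \<open>increments_inner\<close> on the side of the integrands. The
  inclusion in the time interval keeps the restricted measure from truncating the overlap.\<close>

lemma integral_indicator_inner_PM:
  assumes h: "sqint M h" "S \<in> sets borel" and g: "sqint M g" "T \<in> sets borel" and sub: "S \<inter> T \<subseteq> {0..t}"
  shows "(\<integral>p. (indicat_real S (fst p) *\<^sub>R h (snd p)) \<bullet> (indicat_real T (fst p) *\<^sub>R g (snd p)) \<partial>PM t)
    = measure lborel (S \<inter> T) * expectation (\<lambda>\<omega>. h \<omega> \<bullet> g \<omega>)"
proof -
  have "(\<integral>p. (indicat_real S (fst p) *\<^sub>R h (snd p)) \<bullet> (indicat_real T (fst p) *\<^sub>R g (snd p)) \<partial>PM t)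
    = (\<integral>p. indicat_real (S \<inter> T) (fst p) * (h (snd p) \<bullet> g (snd p)) \<partial>PM t)"
    by (simp add: indicator_inter_arith mult_ac)
  also have "\<dots> = (\<integral>s. indicat_real (S \<inter> T) s \<partial>restrict_space lborel {0..t}) * expectation (\<lambda>\<omega>. h \<omega> \<bullet> g \<omega>)"
    using h g by (intro integral_fst_snd integrable_indicator_restrict sqint_inner) auto
  also have "(\<integral>s. indicat_real (S \<inter> T) s \<partial>restrict_space lborel {0..t}) = measure lborel (S \<inter> T)"
  proof -
    have "(\<lambda>s. indicat_real {0..t} s *\<^sub>R indicat_real (S \<inter> T) s) = indicat_real (S \<inter> T)"
      using sub by (auto simp: indicator_def fun_eq_iff)
    then have "(\<integral>s. indicat_real (S \<inter> T) s \<partial>restrict_space lborel {0..t}) = (\<integral>s. indicat_real (S \<inter> T) s \<partial>lborel)"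
      by (subst integral_restrict_space) auto
    then show ?thesis using h g by simp
  qed
  finally show ?thesis .
qed

section \<open>Isometry and martingale property of the Ito integral\<close>

lemma elementaryD:
  assumes e: "elementary M F t n \<tau> h"
  shows "\<And>i. i < n \<Longrightarrow> h i \<in> borel_measurable (F (\<tau> i))" "\<And>i. i < n \<Longrightarrow> sqint M (h i)"
    "\<And>i. i < n \<Longrightarrow> \<tau> i \<le> \<tau> (Suc i)" "\<And>i. i \<le> n \<Longrightarrow> 0 \<le> \<tau> i" "\<And>i. i \<le> n \<Longrightarrow> \<tau> i \<le> t"
proof -
  from e show h: "\<And>i. i < n \<Longrightarrow> h i \<in> borel_measurable (F (\<tau> i))" and step: "\<And>i. i < n \<Longrightarrow> \<tau> i \<le> \<tau> (Suc i)"
    by (auto simp: elementary_def)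
  from e h show "\<And>i. i < n \<Longrightarrow> sqint M (h i)"
    using measurable_F_M by (auto simp: elementary_def sqint_def)
  show "0 \<le> \<tau> i" if "i \<le> n" for i
    using that
  proof (induction i)
    case 0 then show ?case using e by (simp add: elementary_def)
  next
    case (Suc i) then show ?case using step[of i] by simp
  qed
  show "\<tau> i \<le> t" if "i \<le> n" for i
    using that
  proof (induction i rule: inc_induct)
    case base then show ?case using e by (simp add: elementary_def)
  next
    case (step i) then show ?case using \<open>\<And>i. i < n \<Longrightarrow> \<tau> i \<le> \<tau> (Suc i)\<close>[of i] by simp
  qed
qed

lemma sqint_step_integral:
  assumes e: "elementary M F t n \<tau> h"
  shows "sqint M (step_integral W n \<tau> h)"
  unfolding step_integral_def
  by (intro sqint_sum sqint_increment) (use elementaryD[OF e] in auto)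

lemma sqint_step_process:
  assumes e: "elementary M F t n \<tau> h"
  shows "sqint (PM T) (\<lambda>p. step_process n \<tau> h (fst p) (snd p))"
  unfolding step_process_def
  by (intro sqint_sum sqint_indicator_PM) (use elementaryD[OF e] in auto)

lemma integral_double_sum:
  assumes "\<And>i j. i \<in> I \<Longrightarrow> j \<in> J \<Longrightarrow> integrable N (f i j)"
  shows "(\<integral>x. (\<Sum>i\<in>I. \<Sum>j\<in>J. f i j x) \<partial>N) = (\<Sum>i\<in>I. \<Sum>j\<in>J. integral\<^sup>L N (f i j))"
  by (subst Bochner_Integration.integral_sum)
    (auto intro!: sum.cong Bochner_Integration.integral_sum Bochner_Integration.integrable_sum assms)

text \<open>Both sides expand into the same double sum of overlap lengths times expectations of
  \<open>h i \<bullet> g j\<close>. In this polarized form the two processes may live on different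
  grids, so differences of approximants need no separate treatment.\<close>

lemma step_isometry:
  assumes e: "elementary M F t n \<tau> h" and e': "elementary M F t m \<rho> g"
  shows "expectation (\<lambda>\<omega>. step_integral W n \<tau> h \<omega> \<bullet> step_integral W m \<rho> g \<omega>)
    = (\<integral>p. step_process n \<tau> h (fst p) (snd p) \<bullet> step_process m \<rho> g (fst p) (snd p) \<partial>PM t)"
proof -
  note E = elementaryD[OF e] and E' = elementaryD[OF e']
  have "expectation (\<lambda>\<omega>. step_integral W n \<tau> h \<omega> \<bullet> step_integral W m \<rho> g \<omega>) =
    (\<Sum>i<n. \<Sum>j<m. expectation (\<lambda>\<omega>. ((W (\<tau> (Suc i)) \<omega> - W (\<tau> i) \<omega>) *\<^sub>R h i \<omega>) \<bullet> ((W (\<rho> (Suc j)) \<omega> - W (\<rho> j) \<omega>) *\<^sub>R g j \<omega>)))"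
    unfolding step_integral_def inner_sum_left unfolding inner_sum_right
    by (intro integral_double_sum sqint_inner sqint_increment) (use E E' in auto)
  also have "\<dots> = (\<Sum>i<n. \<Sum>j<m. measure lborel ({\<tau> i<..\<tau> (Suc i)} \<inter> {\<rho> j<..\<rho> (Suc j)}) * expectation (\<lambda>\<omega>. h i \<omega> \<bullet> g j \<omega>))"
    by (intro sum.cong refl increments_inner) (use E E' in auto)
  also have "\<dots> = (\<Sum>i<n. \<Sum>j<m. \<integral>p. (indicat_real {\<tau> i<..\<tau> (Suc i)} (fst p) *\<^sub>R h i (snd p)) \<bullet>
      (indicat_real {\<rho> j<..\<rho> (Suc j)} (fst p) *\<^sub>R g j (snd p)) \<partial>PM t)"
  proof (intro sum.cong refl integral_indicator_inner_PM[symmetric])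
    fix i j assume "i \<in> {..<n}" "j \<in> {..<m}"
    then show "{\<tau> i<..\<tau> (Suc i)} \<inter> {\<rho> j<..\<rho> (Suc j)} \<subseteq> {0..t}"
      using E(4)[of i] E(5)[of "Suc i"] by auto
  qed (use E E' in auto)
  also have "\<dots> = (\<integral>p. step_process n \<tau> h (fst p) (snd p) \<bullet> step_process m \<rho> g (fst p) (snd p) \<partial>PM t)"
    unfolding step_process_def inner_sum_left unfolding inner_sum_right
    by (intro integral_double_sum[symmetric] sqint_inner sqint_indicator_PM) (use E E' in auto)
  finally show ?thesis .
qed

lemma step_isometry_diff:
  assumes e: "elementary M F t n \<tau> h" and e': "elementary M F t m \<rho> g"
  shows "expectation (\<lambda>\<omega>. (norm (step_integral W n \<tau> h \<omega> - step_integral W m \<rho> g \<omega>))\<^sup>2)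
    = (\<integral>p. (norm (step_process n \<tau> h (fst p) (snd p) - step_process m \<rho> g (fst p) (snd p)))\<^sup>2 \<partial>PM t)"
  using e e' by (simp add: integral_norm_diff_square sqint_step_integral sqint_step_process step_isometry)

text \<open>Extended integrals become real ones on \<open>PM t\<close>, with square integrability of
  integrand and integral as a by-product. The convergence of the energies is kept as well, since it
  can be restricted to a shorter time interval.\<close>

lemma has_ito_integralD:
  assumes I: "has_ito_integral M F W H t Y" and t: "0 \<le> t"
  obtains n \<tau> h where "\<And>k. elementary M F t (n k) (\<tau> k) (h k)"
    "sqint (PM t) (\<lambda>p. H (fst p) (snd p))" "sqint M Y"
    "(\<lambda>k. energy M t (\<lambda>s \<omega>. H s \<omega> - step_process (n k) (\<tau> k) (h k) s \<omega>)) \<longlonglongrightarrow> 0"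
    "(\<lambda>k. \<integral>p. (norm (H (fst p) (snd p) - step_process (n k) (\<tau> k) (h k) (fst p) (snd p)))\<^sup>2 \<partial>PM t) \<longlonglongrightarrow> 0"
    "(\<lambda>k. expectation (\<lambda>\<omega>. (norm (Y \<omega> - step_integral W (n k) (\<tau> k) (h k) \<omega>))\<^sup>2)) \<longlonglongrightarrow> 0"
proof -
  from I obtain n \<tau> h where p: "progressive F H" and Y: "Y \<in> borel_measurable M"
    and e: "\<And>k. elementary M F t (n k) (\<tau> k) (h k)"
    and en: "(\<lambda>k. energy M t (\<lambda>s \<omega>. H s \<omega> - step_process (n k) (\<tau> k) (h k) s \<omega>)) \<longlonglongrightarrow> 0"
    and Yl: "(\<lambda>k. \<integral>\<^sup>+\<omega>. ennreal ((norm (Y \<omega> - step_integral W (n k) (\<tau> k) (h k) \<omega>))\<^sup>2) \<partial>M) \<longlonglongrightarrow> 0"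
    by (auto simp: has_ito_integral_def)
  note H = progressive_measurable[OF p t]
  have m: "(\<lambda>p. H (fst p) (snd p) - step_process (n k) (\<tau> k) (h k) (fst p) (snd p)) \<in> borel_measurable (PM t)" for k
    using H sqint_measurable[OF sqint_step_process[OF e[of k]], of t] by simp
  have "energy M t (\<lambda>s \<omega>. H s \<omega> - step_process (n k) (\<tau> k) (h k) s \<omega>)
      = (\<integral>\<^sup>+p. ennreal ((norm (H (fst p) (snd p) - step_process (n k) (\<tau> k) (h k) (fst p) (snd p)))\<^sup>2) \<partial>PM t)" for k
    by (rule energy_eq[OF m])
  with en have "(\<lambda>k. \<integral>\<^sup>+p. ennreal ((norm (H (fst p) (snd p) - step_process (n k) (\<tau> k) (h k) (fst p) (snd p)))\<^sup>2) \<partial>PM t) \<longlonglongrightarrow> 0"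
    by simp
  note 1 = sqint_limit[OF H sqint_step_process[OF e] this]
  note 2 = sqint_limit[OF Y sqint_step_integral[OF e] Yl]
  show ?thesis by (rule that[OF e 1(1) 2(1) en 1(2) 2(2)])
qed

text \<open>Applying \<open>Q\<close> to the values of an elementary process gives an elementary
  process on the same grid, so the polarized isometry applies to the pair; the limit uses that
  \<open>Q\<close> is bounded.\<close>

lemma ito_isometry:
  fixes Q :: "real^'n^'n"
  assumes I: "has_ito_integral M F W H t Y" and t: "0 \<le> t"
  shows "expectation (\<lambda>\<omega>. Y \<omega> \<bullet> (Q *v Y \<omega>)) = (\<integral>p. H (fst p) (snd p) \<bullet> (Q *v H (fst p) (snd p)) \<partial>PM t)"
proof -
  obtain n \<tau> h where e: "\<And>k. elementary M F t (n k) (\<tau> k) (h k)"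
    and H: "sqint (PM t) (\<lambda>p. H (fst p) (snd p))" and Y: "sqint M Y"
    and en: "(\<lambda>k. energy M t (\<lambda>s \<omega>. H s \<omega> - step_process (n k) (\<tau> k) (h k) s \<omega>)) \<longlonglongrightarrow> 0"
    and Hl: "(\<lambda>k. \<integral>p. (norm (H (fst p) (snd p) - step_process (n k) (\<tau> k) (h k) (fst p) (snd p)))\<^sup>2 \<partial>PM t) \<longlonglongrightarrow> 0"
    and Yl: "(\<lambda>k. expectation (\<lambda>\<omega>. (norm (Y \<omega> - step_integral W (n k) (\<tau> k) (h k) \<omega>))\<^sup>2)) \<longlonglongrightarrow> 0"
    by (rule has_ito_integralD[OF I t]) iprover
  have lin: "(\<lambda>k. \<integral>x. (norm (Q *v U x - Q *v U' k x))\<^sup>2 \<partial>N) \<longlonglongrightarrow> 0"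
    if "(\<lambda>k. \<integral>x. (norm (U x - U' k x))\<^sup>2 \<partial>N) \<longlonglongrightarrow> 0" "sqint N U" "\<And>k. sqint N (U' k)"
    for N :: "'z measure" and U :: "'z \<Rightarrow> real^'n" and U'
  proof -
    obtain K where K: "\<And>x. norm (Q *v x) \<le> norm x * K"
      using bounded_linear.bounded[OF matrix_vector_mul_bounded_linear[of Q]] by auto
    have Kx: "(norm (Q *v x - Q *v y))\<^sup>2 \<le> K\<^sup>2 * (norm (x - y))\<^sup>2" for x y
      using power_mono[OF K[of "x - y"], of 2] by (simp add: matrix_vector_mult_diff_distrib power_mult_distrib mult.commute)
    have "(\<integral>x. (norm (Q *v U x - Q *v U' k x))\<^sup>2 \<partial>N) \<le> K\<^sup>2 * (\<integral>x. (norm (U x - U' k x))\<^sup>2 \<partial>N)" for k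
    proof -
      have "(\<integral>x. (norm (Q *v U x - Q *v U' k x))\<^sup>2 \<partial>N) \<le> (\<integral>x. K\<^sup>2 * (norm (U x - U' k x))\<^sup>2 \<partial>N)"
        using that(2) that(3)[of k]
        by (intro integral_mono Kx sqint_integrable Bochner_Integration.integrable_mult_right sqint_diff sqint_mv)
      then show ?thesis by simp
    qed
    then show ?thesis
      by (intro tendsto_sandwich[OF _ _ tendsto_const tendsto_mult_right_zero[OF that(1), of "K\<^sup>2"]])
        (auto intro!: eventuallyI)
  qed
  note sqI = sqint_step_integral[OF e] and sqP = sqint_step_process[OF e]
  have 1: "(\<lambda>k. expectation (\<lambda>\<omega>. step_integral W (n k) (\<tau> k) (h k) \<omega> \<bullet> (Q *v step_integral W (n k) (\<tau> k) (h k) \<omega>)))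
    \<longlonglongrightarrow> expectation (\<lambda>\<omega>. Y \<omega> \<bullet> (Q *v Y \<omega>))"
    by (rule sqint_tendsto_inner[OF sqI Y sqint_mv[OF sqI] sqint_mv[OF Y] Yl lin[OF Yl Y sqI]])
  have 2: "(\<lambda>k. \<integral>p. step_process (n k) (\<tau> k) (h k) (fst p) (snd p) \<bullet> (Q *v step_process (n k) (\<tau> k) (h k) (fst p) (snd p)) \<partial>PM t)
    \<longlonglongrightarrow> (\<integral>p. H (fst p) (snd p) \<bullet> (Q *v H (fst p) (snd p)) \<partial>PM t)"
    by (rule sqint_tendsto_inner[OF sqP H sqint_mv[OF sqP] sqint_mv[OF H] Hl lin[OF Hl H sqP]])
  have "expectation (\<lambda>\<omega>. step_integral W (n k) (\<tau> k) (h k) \<omega> \<bullet> (Q *v step_integral W (n k) (\<tau> k) (h k) \<omega>))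
    = (\<integral>p. step_process (n k) (\<tau> k) (h k) (fst p) (snd p) \<bullet> (Q *v step_process (n k) (\<tau> k) (h k) (fst p) (snd p)) \<partial>PM t)" for k
  proof -
    have "Q *v step_integral W (n k) (\<tau> k) (h k) \<omega> = step_integral W (n k) (\<tau> k) (\<lambda>i \<omega>. Q *v h k i \<omega>) \<omega>"
      and "Q *v step_process (n k) (\<tau> k) (h k) s \<omega> = step_process (n k) (\<tau> k) (\<lambda>i \<omega>. Q *v h k i \<omega>) s \<omega>" for s \<omega>
      by (simp_all add: step_integral_def step_process_def matrix_vector_mult_sum matrix_vector_mult_scaleR)
    moreover have "elementary M F t (n k) (\<tau> k) (\<lambda>i \<omega>. Q *v h k i \<omega>)"
    proof -
      show ?thesis
        using e[of k] elementaryD(1)[OF e[of k]] sqint_integrable[OF sqint_mv[OF elementaryD(2)[OF e[of k]]]]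
        by (auto simp: elementary_def intro: measurable_mv)
    qed
    ultimately show ?thesis using step_isometry[OF e[of k]] by simp
  qed
  with 1 2 show ?thesis by (simp add: LIMSEQ_unique)
qed

text \<open>The number of pieces is kept, and those starting at or after \<open>s\<close> collapse
  to empty intervals. Their values are set to 0 because \<open>h i\<close> need not be measurable at
  the earlier time \<open>s\<close>.\<close>

lemma elementary_cut:
  assumes e: "elementary M F t n \<tau> h" and s: "0 \<le> s" "s \<le> t"
  shows "elementary M F s n (\<lambda>i. min (\<tau> i) s) (\<lambda>i. if \<tau> i < s then h i else (\<lambda>_. 0))"
  using e s by (auto simp: elementary_def min_def)

lemma step_process_cut:
  assumes "u \<le> s"
  shows "step_process n (\<lambda>i. min (\<tau> i) s) (\<lambda>i. if \<tau> i < s then h i else (\<lambda>_. 0)) u \<omega> = step_process n \<tau> h u \<omega>"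
  unfolding step_process_def using assms by (intro sum.cong) (auto simp: indicator_def)

text \<open>Increments after \<open>s\<close> are orthogonal to what is known at \<open>s\<close>.
  The one piece that straddles \<open>s\<close> is split there.\<close>

lemma step_integral_cut:
  assumes e: "elementary M F t n \<tau> h" and s: "0 \<le> s" "s \<le> t"
    and Z: "sqint M Z" "Z \<in> borel_measurable (F s)"
  shows "expectation (\<lambda>\<omega>. Z \<omega> \<bullet> step_integral W n \<tau> h \<omega>)
    = expectation (\<lambda>\<omega>. Z \<omega> \<bullet> step_integral W n (\<lambda>i. min (\<tau> i) s) (\<lambda>i. if \<tau> i < s then h i else (\<lambda>_. 0)) \<omega>)"
proof -
  note E = elementaryD[OF e] and E' = elementaryD[OF elementary_cut[OF e s]]
  have "expectation (\<lambda>\<omega>. Z \<omega> \<bullet> ((W (\<tau> (Suc i)) \<omega> - W (\<tau> i) \<omega>) *\<^sub>R h i \<omega>))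
    = expectation (\<lambda>\<omega>. Z \<omega> \<bullet> ((W (min (\<tau> (Suc i)) s) \<omega> - W (min (\<tau> i) s) \<omega>) *\<^sub>R (if \<tau> i < s then h i else (\<lambda>_. 0)) \<omega>))"
    if i: "i < n" for i
  proof -
    note Ei = E(1)[OF i] E(2)[OF i] E(3)[OF i] E(4)[OF less_imp_le[OF i]]
    consider "s \<le> \<tau> i" | "\<tau> i < s" "\<tau> (Suc i) \<le> s" | "\<tau> i < s" "s < \<tau> (Suc i)" by linarith
    then show ?thesis
    proof cases
      case 1
      have "expectation (\<lambda>\<omega>. Z \<omega> \<bullet> ((W (\<tau> (Suc i)) \<omega> - W (\<tau> i) \<omega>) *\<^sub>R h i \<omega>)) = 0"
        by (rule increment_orthogonal[OF Ei(4,3) Z(1) measurable_F_mono[OF 1 Z(2)] Ei(2,1)])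
      then show ?thesis using 1 by simp
    next
      case 2
      then show ?thesis by simp
    next
      case 3
      have hF: "h i \<in> borel_measurable (F s)" by (rule measurable_F_mono[OF less_imp_le[OF 3(1)] Ei(1)])
      have sq: "sqint M (\<lambda>\<omega>. (W s \<omega> - W (\<tau> i) \<omega>) *\<^sub>R h i \<omega>)"
          "sqint M (\<lambda>\<omega>. (W (\<tau> (Suc i)) \<omega> - W s \<omega>) *\<^sub>R h i \<omega>)"
        by (rule sqint_increment[OF Ei(4) less_imp_le[OF 3(1)] Ei(1,2)])
          (rule sqint_increment[OF s(1) less_imp_le[OF 3(2)] hF Ei(2)])
      have "expectation (\<lambda>\<omega>. Z \<omega> \<bullet> ((W (\<tau> (Suc i)) \<omega> - W (\<tau> i) \<omega>) *\<^sub>R h i \<omega>))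
        = expectation (\<lambda>\<omega>. Z \<omega> \<bullet> ((W s \<omega> - W (\<tau> i) \<omega>) *\<^sub>R h i \<omega>) + Z \<omega> \<bullet> ((W (\<tau> (Suc i)) \<omega> - W s \<omega>) *\<^sub>R h i \<omega>))"
        by (simp add: scaleR_diff_left inner_diff_right)
      also have "\<dots> = expectation (\<lambda>\<omega>. Z \<omega> \<bullet> ((W s \<omega> - W (\<tau> i) \<omega>) *\<^sub>R h i \<omega>))
         + expectation (\<lambda>\<omega>. Z \<omega> \<bullet> ((W (\<tau> (Suc i)) \<omega> - W s \<omega>) *\<^sub>R h i \<omega>))"
        by (intro Bochner_Integration.integral_add sqint_inner Z(1) sq)
      also have "expectation (\<lambda>\<omega>. Z \<omega> \<bullet> ((W (\<tau> (Suc i)) \<omega> - W s \<omega>) *\<^sub>R h i \<omega>)) = 0"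
        by (rule increment_orthogonal[OF s(1) less_imp_le[OF 3(2)] Z Ei(2) hF])
      finally show ?thesis using 3 by simp
    qed
  qed
  moreover have "expectation (\<lambda>\<omega>. Z \<omega> \<bullet> step_integral W n \<tau> h \<omega>)
    = (\<Sum>i<n. expectation (\<lambda>\<omega>. Z \<omega> \<bullet> ((W (\<tau> (Suc i)) \<omega> - W (\<tau> i) \<omega>) *\<^sub>R h i \<omega>)))"
    unfolding step_integral_def inner_sum_right
    by (intro Bochner_Integration.integral_sum sqint_inner sqint_increment Z) (use E in auto)
  moreover have "expectation (\<lambda>\<omega>. Z \<omega> \<bullet> step_integral W n (\<lambda>i. min (\<tau> i) s) (\<lambda>i. if \<tau> i < s then h i else (\<lambda>_. 0)) \<omega>)
    = (\<Sum>i<n. expectation (\<lambda>\<omega>. Z \<omega> \<bullet> ((W (min (\<tau> (Suc i)) s) \<omega> - W (min (\<tau> i) s) \<omega>) *\<^sub>R (if \<tau> i < s then h i else (\<lambda>_. 0)) \<omega>)))"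
    unfolding step_integral_def inner_sum_right
    by (intro Bochner_Integration.integral_sum sqint_inner sqint_increment Z) (use E' in auto)
  ultimately show ?thesis by simp
qed

text \<open>\<open>Y\<close> and \<open>Y'\<close> come with unrelated approximating sequences.
  Cutting the sequence of \<open>Y\<close> at \<open>s\<close> changes no inner product with
  \<open>Z\<close>, and the cut sequence also converges to \<open>Y'\<close>, because its integrands
  approximate \<open>H\<close> on the shorter interval.\<close>

lemma ito_martingale:
  assumes I: "has_ito_integral M F W H t Y" and I': "has_ito_integral M F W H s Y'"
    and s: "0 \<le> s" "s \<le> t" and Z: "sqint M Z" "Z \<in> borel_measurable (F s)"
  shows "expectation (\<lambda>\<omega>. Z \<omega> \<bullet> Y \<omega>) = expectation (\<lambda>\<omega>. Z \<omega> \<bullet> Y' \<omega>)"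
proof -
  have t: "0 \<le> t" using s by simp
  obtain n \<tau> h where e: "\<And>k. elementary M F t (n k) (\<tau> k) (h k)"
    and Ht: "sqint (PM t) (\<lambda>p. H (fst p) (snd p))" and Y: "sqint M Y"
    and en: "(\<lambda>k. energy M t (\<lambda>s \<omega>. H s \<omega> - step_process (n k) (\<tau> k) (h k) s \<omega>)) \<longlonglongrightarrow> 0"
    and Htl: "(\<lambda>k. \<integral>p. (norm (H (fst p) (snd p) - step_process (n k) (\<tau> k) (h k) (fst p) (snd p)))\<^sup>2 \<partial>PM t) \<longlonglongrightarrow> 0"
    and Yl: "(\<lambda>k. expectation (\<lambda>\<omega>. (norm (Y \<omega> - step_integral W (n k) (\<tau> k) (h k) \<omega>))\<^sup>2)) \<longlonglongrightarrow> 0"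
    by (rule has_ito_integralD[OF I t]) iprover
  obtain n' \<tau>' h' where e': "\<And>k. elementary M F s (n' k) (\<tau>' k) (h' k)"
    and H: "sqint (PM s) (\<lambda>p. H (fst p) (snd p))" and Y': "sqint M Y'"
    and en': "(\<lambda>k. energy M s (\<lambda>s \<omega>. H s \<omega> - step_process (n' k) (\<tau>' k) (h' k) s \<omega>)) \<longlonglongrightarrow> 0"
    and Hl': "(\<lambda>k. \<integral>p. (norm (H (fst p) (snd p) - step_process (n' k) (\<tau>' k) (h' k) (fst p) (snd p)))\<^sup>2 \<partial>PM s) \<longlonglongrightarrow> 0"
    and Yl': "(\<lambda>k. expectation (\<lambda>\<omega>. (norm (Y' \<omega> - step_integral W (n' k) (\<tau>' k) (h' k) \<omega>))\<^sup>2)) \<longlonglongrightarrow> 0"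
    by (rule has_ito_integralD[OF I' s(1)]) iprover
  define \<rho> where "\<rho> k = (\<lambda>i. min (\<tau> k i) s)" for k
  define g where "g k = (\<lambda>i. if \<tau> k i < s then h k i else (\<lambda>_. 0))" for k
  have eg: "elementary M F s (n k) (\<rho> k) (g k)" for k
    unfolding \<rho>_def g_def by (rule elementary_cut[OF e s])
  let ?J = "\<lambda>k. step_integral W (n k) (\<rho> k) (g k)" and ?I' = "\<lambda>k. step_integral W (n' k) (\<tau>' k) (h' k)"
  let ?P = "\<lambda>k p. step_process (n k) (\<rho> k) (g k) (fst p) (snd p)"
  let ?P' = "\<lambda>k p. step_process (n' k) (\<tau>' k) (h' k) (fst p) (snd p)"
  have cut: "(\<lambda>k. \<integral>p. (norm (H (fst p) (snd p) - ?P k p))\<^sup>2 \<partial>PM s) \<longlonglongrightarrow> 0"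
  proof (rule sqint_limit(2))
    have "(\<integral>\<^sup>+p. ennreal ((norm (H (fst p) (snd p) - ?P k p))\<^sup>2) \<partial>PM s)
        \<le> energy M t (\<lambda>s \<omega>. H s \<omega> - step_process (n k) (\<tau> k) (h k) s \<omega>)" for k
    proof -
      have "(\<integral>\<^sup>+p. ennreal ((norm (H (fst p) (snd p) - ?P k p))\<^sup>2) \<partial>PM s)
        = energy M s (\<lambda>u \<omega>. H u \<omega> - step_process (n k) (\<rho> k) (g k) u \<omega>)"
        using sqint_measurable[OF sqint_diff[OF H sqint_step_process[OF eg]]] by (intro energy_eq[symmetric]) simp
      also have "\<dots> = energy M s (\<lambda>u \<omega>. H u \<omega> - step_process (n k) (\<tau> k) (h k) u \<omega>)"
        unfolding energy_def \<rho>_def g_def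
        by (intro nn_integral_cong) (auto simp: step_process_cut indicator_def)
      also have "\<dots> \<le> energy M t (\<lambda>u \<omega>. H u \<omega> - step_process (n k) (\<tau> k) (h k) u \<omega>)"
        unfolding energy_def using s by (intro nn_integral_mono) (auto simp: indicator_def)
      finally show ?thesis .
    qed
    then show "(\<lambda>k. \<integral>\<^sup>+p. ennreal ((norm (H (fst p) (snd p) - ?P k p))\<^sup>2) \<partial>PM s) \<longlonglongrightarrow> 0"
      by (intro tendsto_sandwich[OF _ _ tendsto_const en]) (auto intro!: eventuallyI)
  qed (use H sqint_step_process[OF eg] in \<open>auto simp: sqint_def\<close>)
  \<comment> \<open>The detour through the sequence of \<open>Y'\<close> compares two step
    integrals, whose distance the isometry replaces by the distance of two step processes that are
    both close to \<open>H\<close>.\<close>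
  have bound: "expectation (\<lambda>\<omega>. (norm (Y' \<omega> - ?J k \<omega>))\<^sup>2) \<le> 2 * expectation (\<lambda>\<omega>. (norm (Y' \<omega> - ?I' k \<omega>))\<^sup>2)
      + 2 * (2 * (\<integral>p. (norm (H (fst p) (snd p) - ?P k p))\<^sup>2 \<partial>PM s) + 2 * (\<integral>p. (norm (H (fst p) (snd p) - ?P' k p))\<^sup>2 \<partial>PM s))" for k
  proof -
    note sq = sqint_diff[OF Y' sqint_step_integral[OF e', of k]]
      sqint_diff[OF sqint_step_integral[OF e', of k] sqint_step_integral[OF eg, of k]]
      sqint_diff[OF H sqint_step_process[OF e', of s k]] sqint_diff[OF H sqint_step_process[OF eg, of s k]]
    have "expectation (\<lambda>\<omega>. (norm (Y' \<omega> - ?J k \<omega>))\<^sup>2)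
        = expectation (\<lambda>\<omega>. (norm ((Y' \<omega> - ?I' k \<omega>) + (?I' k \<omega> - ?J k \<omega>)))\<^sup>2)" by simp
    also have "\<dots> \<le> 2 * expectation (\<lambda>\<omega>. (norm (Y' \<omega> - ?I' k \<omega>))\<^sup>2) + 2 * expectation (\<lambda>\<omega>. (norm (?I' k \<omega> - ?J k \<omega>))\<^sup>2)"
      by (rule integral_norm_add_square_le[OF sq(1,2)])
    also have "expectation (\<lambda>\<omega>. (norm (?I' k \<omega> - ?J k \<omega>))\<^sup>2) = (\<integral>p. (norm (?P' k p - ?P k p))\<^sup>2 \<partial>PM s)"
      by (rule step_isometry_diff[OF e' eg])
    also have "\<dots> = (\<integral>p. (norm ((H (fst p) (snd p) - ?P k p) - (H (fst p) (snd p) - ?P' k p)))\<^sup>2 \<partial>PM s)" by simp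
    also have "\<dots> \<le> 2 * (\<integral>p. (norm (H (fst p) (snd p) - ?P k p))\<^sup>2 \<partial>PM s) + 2 * (\<integral>p. (norm (H (fst p) (snd p) - ?P' k p))\<^sup>2 \<partial>PM s)"
      by (rule integral_norm_diff_square_le[OF sq(4,3)])
    finally show ?thesis by simp
  qed
  have lim: "(\<lambda>k. 2 * expectation (\<lambda>\<omega>. (norm (Y' \<omega> - ?I' k \<omega>))\<^sup>2)
      + 2 * (2 * (\<integral>p. (norm (H (fst p) (snd p) - ?P k p))\<^sup>2 \<partial>PM s) + 2 * (\<integral>p. (norm (H (fst p) (snd p) - ?P' k p))\<^sup>2 \<partial>PM s))) \<longlonglongrightarrow> 2 * 0 + 2 * (2 * 0 + 2 * 0)"
    by (intro tendsto_intros Yl' Hl' cut)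
  have Jl: "(\<lambda>k. expectation (\<lambda>\<omega>. (norm (Y' \<omega> - ?J k \<omega>))\<^sup>2)) \<longlonglongrightarrow> 0"
    by (rule tendsto_sandwich[OF always_eventually always_eventually tendsto_const lim[simplified]])
      (use bound in \<open>auto simp: algebra_simps\<close>)
  have z: "(\<lambda>k. expectation (\<lambda>\<omega>. (norm (Z \<omega> - Z \<omega>))\<^sup>2)) \<longlonglongrightarrow> 0" by simp
  have "(\<lambda>k. expectation (\<lambda>\<omega>. Z \<omega> \<bullet> step_integral W (n k) (\<tau> k) (h k) \<omega>)) \<longlonglongrightarrow> expectation (\<lambda>\<omega>. Z \<omega> \<bullet> Y \<omega>)"
    by (rule sqint_tendsto_inner[OF Z(1) Z(1) sqint_step_integral[OF e] Y z Yl])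
  moreover have "(\<lambda>k. expectation (\<lambda>\<omega>. Z \<omega> \<bullet> ?J k \<omega>)) \<longlonglongrightarrow> expectation (\<lambda>\<omega>. Z \<omega> \<bullet> Y' \<omega>)"
    by (rule sqint_tendsto_inner[OF Z(1) Z(1) sqint_step_integral[OF eg] Y' z Jl])
  moreover have "expectation (\<lambda>\<omega>. Z \<omega> \<bullet> step_integral W (n k) (\<tau> k) (h k) \<omega>) = expectation (\<lambda>\<omega>. Z \<omega> \<bullet> ?J k \<omega>)" for k
    unfolding \<rho>_def g_def by (rule step_integral_cut[OF e s Z])
  ultimately show ?thesis by (simp add: LIMSEQ_unique)
qed

end

section \<open>Second moments of solutions\<close>

abbreviation TL :: "real \<Rightarrow> real measure" where "TL t \<equiv> restrict_space lborel {0..t}"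

lemma sqintI_AE:
  assumes "U \<in> borel_measurable M" "integrable M g" "AE x in M. (norm (U x))\<^sup>2 \<le> g x"
  shows "sqint M U"
  unfolding sqint_def
proof
  show "integrable M (\<lambda>x. (norm (U x))\<^sup>2)"
    by (rule Bochner_Integration.integrable_bound[OF assms(2)])
      (use assms in \<open>auto elim!: eventually_mono\<close>)
qed fact

text \<open>Cauchy-Schwarz for \<open>f\<close> against the constant function with value
  \<open>?v\<close>, after which one factor of the squared norm of \<open>?v\<close>
  cancels.\<close>

lemma norm_integral_square_le:
  fixes f :: "real \<Rightarrow> 'b::euclidean_space"
  assumes f: "sqint (TL t) f" and t: "0 \<le> t"
  shows "(norm (\<integral>s. f s \<partial>TL t))\<^sup>2 \<le> t * (\<integral>s. (norm (f s))\<^sup>2 \<partial>TL t)"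
proof -
  interpret finite_measure "TL t" by (rule finite_measure_restrict_lborel)
  let ?v = "\<integral>s. f s \<partial>TL t"
  have int: "integrable (TL t) f" by (rule sqint_integrable_fun[OF f finite_measure_axioms])
  have "?v \<bullet> ?v = (\<integral>s. ?v \<bullet> f s \<partial>TL t)" using int by simp
  then have "(?v \<bullet> ?v)\<^sup>2 \<le> (\<integral>s. (norm ?v)\<^sup>2 \<partial>TL t) * (\<integral>s. (norm (f s))\<^sup>2 \<partial>TL t)"
    using integral_inner_Cauchy_Schwarz[OF sqint_const f, of ?v] by simp
  also have "(\<integral>s. (norm ?v)\<^sup>2 \<partial>TL t) = t * (norm ?v)\<^sup>2"
    using t by (simp add: measure_restrict_space space_restrict_space)
  finally have "(norm ?v)\<^sup>2 * (norm ?v)\<^sup>2 \<le> (norm ?v)\<^sup>2 * (t * (\<integral>s. (norm (f s))\<^sup>2 \<partial>TL t))"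
    by (simp add: power2_norm_eq_inner[symmetric] power2_eq_square mult_ac)
  moreover have "0 < (norm ?v)\<^sup>2" if "?v \<noteq> 0" using that by simp
  ultimately show ?thesis
    using t by (cases "?v = 0") (simp, metis mult_le_cancel_left_pos)
qed

lemma integral_TL: "0 \<le> s \<Longrightarrow> s \<le> t \<Longrightarrow> (\<integral>r. indicat_real {..s} r *\<^sub>R f r \<partial>TL t) = (\<integral>r. f r \<partial>TL s)"
  for f :: "real \<Rightarrow> 'b::euclidean_space"
proof -
  assume "0 \<le> s" "s \<le> t"
  then have "(\<lambda>r. indicat_real {0..t} r *\<^sub>R indicat_real {..s} r *\<^sub>R f r) = (\<lambda>r. indicat_real {0..s} r *\<^sub>R f r)"
    by (auto simp: indicator_def fun_eq_iff)
  then show ?thesis by (simp add: integral_restrict_space)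
qed

lemma set_integral_TL:
  fixes f :: "real \<Rightarrow> 'b::euclidean_space"
  shows "(LBINT s:{0..t}. f s) = (\<integral>s. f s \<partial>TL t)"
  by (simp add: set_lebesgue_integral_def integral_restrict_space)

text \<open>The integrated chain rule for the quadratic form of a primitive, valid for merely
  integrable \<open>f\<close>: the left-hand side is an integral over a square, which splits into
  two triangles of equal contribution since \<open>Q\<close> is symmetric.\<close>

lemma integral_quadratic_primitive:
  fixes f :: "real \<Rightarrow> real^'n" and Q :: "real^'n^'n"
  assumes f: "integrable (TL t) f" and Q: "\<And>x y. x \<bullet> (Q *v y) = y \<bullet> (Q *v x)"
  shows "(\<integral>s. f s \<partial>TL t) \<bullet> (Q *v (\<integral>s. f s \<partial>TL t)) = 2 * (\<integral>s. f s \<bullet> (Q *v (\<integral>r. f r \<partial>TL s)) \<partial>TL t)"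
proof -
  interpret finite_measure "TL t" by (rule finite_measure_restrict_lborel)
  interpret P: pair_sigma_finite "TL t" "TL t"
    by (simp add: pair_sigma_finite_def sigma_finite_measure_axioms)
  define h where "h = (\<lambda>p. f (fst p) \<bullet> (Q *v f (snd p)))"
  have fm[measurable]: "f \<in> borel_measurable (TL t)" using f by simp
  have Qm[measurable]: "(*v) Q \<in> borel_measurable borel"
    using measurable_mv[of "\<lambda>x. x" borel Q] by simp
  have hm[measurable]: "h \<in> borel_measurable (TL t \<Otimes>\<^sub>M TL t)" unfolding h_def by measurable
  obtain K where K: "\<And>x. norm (Q *v x) \<le> norm x * K" and K0: "K \<ge> 0"
    using bounded_linear.nonneg_bounded[OF matrix_vector_mul_bounded_linear[of Q]] by auto
  have h: "integrable (TL t \<Otimes>\<^sub>M TL t) h"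
  proof (rule P.Fubini_integrable[OF hm])
    have Qf: "integrable (TL t) (\<lambda>r. Q *v f r)"
      using f by (rule integrable_bounded_linear[OF matrix_vector_mul_bounded_linear])
    show "integrable (TL t) (\<lambda>s. \<integral>r. norm (h (s, r)) \<partial>TL t)"
    proof (rule Bochner_Integration.integrable_bound)
      show "integrable (TL t) (\<lambda>s. norm (f s) * (\<integral>r. norm (Q *v f r) \<partial>TL t))" using f by simp
      show "AE s in TL t. norm (\<integral>r. norm (h (s, r)) \<partial>TL t) \<le> norm (norm (f s) * (\<integral>r. norm (Q *v f r) \<partial>TL t))"
      proof (intro AE_I2)
        fix s
        have "(\<integral>r. norm (h (s, r)) \<partial>TL t) \<le> (\<integral>r. norm (f s) * norm (Q *v f r) \<partial>TL t)"
          using Qf unfolding h_def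
          by (intro integral_mono integrable_norm Bochner_Integration.integrable_mult_right integrable_inner_right)
            (auto simp: Cauchy_Schwarz_ineq2)
        then show "norm (\<integral>r. norm (h (s, r)) \<partial>TL t) \<le> norm (norm (f s) * (\<integral>r. norm (Q *v f r) \<partial>TL t))" by simp
      qed
    qed measurable
    show "AE s in TL t. integrable (TL t) (\<lambda>r. h (s, r))"
      using Qf unfolding h_def by (intro AE_I2) simp
  qed
  have ind: "integrable (TL t \<Otimes>\<^sub>M TL t) (\<lambda>p. indicat_real S p * h p)" if "S \<in> sets (TL t \<Otimes>\<^sub>M TL t)" for S
    using integrable_mult_indicator[OF that h] by simp
  have idm[measurable]: "(\<lambda>x. x) \<in> borel_measurable (TL t)" by (rule measurable_restrict_lborel) simp
  define S1 where "S1 = {p \<in> space (TL t \<Otimes>\<^sub>M TL t). snd p \<le> fst p}"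
  define S2 where "S2 = {p \<in> space (TL t \<Otimes>\<^sub>M TL t). fst p < snd p}"
  have S: "S1 \<in> sets (TL t \<Otimes>\<^sub>M TL t)" "S2 \<in> sets (TL t \<Otimes>\<^sub>M TL t)"
    unfolding S1_def S2_def by measurable
  have sp: "space (TL t) = {0..t}" by (simp add: space_restrict_space)
  have Qint: "(\<integral>r. f s \<bullet> (Q *v g r) \<partial>N) = f s \<bullet> (Q *v (\<integral>r. g r \<partial>N))"
    if "integrable N g" for s g and N :: "real measure"
    by (rule integral_bounded_linear[OF bounded_linear_compose[OF bounded_linear_inner_right matrix_vector_mul_bounded_linear] that])
  have fs: "integrable (TL t) (\<lambda>r. indicat_real {..s} r *\<^sub>R f r)" for s
  proof (rule Bochner_Integration.integrable_bound[OF f])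
    have "indicat_real {..s} \<in> borel_measurable (TL t)" by (rule measurable_restrict_lborel) simp
    then show "(\<lambda>r. indicat_real {..s} r *\<^sub>R f r) \<in> borel_measurable (TL t)" by measurable
  qed (auto simp: indicator_def)
  have I1: "(\<integral>p. indicat_real S1 p * h p \<partial>(TL t \<Otimes>\<^sub>M TL t)) = (\<integral>s. f s \<bullet> (Q *v (\<integral>r. f r \<partial>TL s)) \<partial>TL t)"
  proof -
    have "(\<integral>p. indicat_real S1 p * h p \<partial>(TL t \<Otimes>\<^sub>M TL t)) = (\<integral>s. \<integral>r. indicat_real S1 (s, r) * h (s, r) \<partial>TL t \<partial>TL t)"
      by (rule P.integral_fst'[symmetric, OF ind[OF S(1)]])
    also have "\<dots> = (\<integral>s. f s \<bullet> (Q *v (\<integral>r. f r \<partial>TL s)) \<partial>TL t)"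
    proof (intro Bochner_Integration.integral_cong refl)
      fix s assume s: "s \<in> space (TL t)"
      have "(\<integral>r. indicat_real S1 (s, r) * h (s, r) \<partial>TL t) = (\<integral>r. f s \<bullet> (Q *v (indicat_real {..s} r *\<^sub>R f r)) \<partial>TL t)"
        using s by (intro Bochner_Integration.integral_cong refl)
          (auto simp: S1_def h_def indicator_def space_pair_measure matrix_vector_mult_scaleR)
      also have "\<dots> = f s \<bullet> (Q *v (\<integral>r. indicat_real {..s} r *\<^sub>R f r \<partial>TL t))" by (rule Qint[OF fs])
      also have "(\<integral>r. indicat_real {..s} r *\<^sub>R f r \<partial>TL t) = (\<integral>r. f r \<partial>TL s)"
        using s by (intro integral_TL) (auto simp: sp)
      finally show "(\<integral>r. indicat_real S1 (s, r) * h (s, r) \<partial>TL t) = f s \<bullet> (Q *v (\<integral>r. f r \<partial>TL s))" .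
    qed
    finally show ?thesis .
  qed
  have I2: "(\<integral>p. indicat_real S2 p * h p \<partial>(TL t \<Otimes>\<^sub>M TL t)) = (\<integral>p. indicat_real S1 p * h p \<partial>(TL t \<Otimes>\<^sub>M TL t))"
  proof -
    have f1: "(\<lambda>(r, s). indicat_real S2 (s, r) * h (s, r)) \<in> borel_measurable (TL t \<Otimes>\<^sub>M TL t)"
      by (rule measurable_pair_swap[OF borel_measurable_integrable[OF ind[OF S(2)]]])
    have f2: "(\<lambda>p. indicat_real S1 p * h p) \<in> borel_measurable (TL t \<Otimes>\<^sub>M TL t)"
      by (rule borel_measurable_integrable[OF ind[OF S(1)]])
    have "(\<integral>p. indicat_real S2 p * h p \<partial>(TL t \<Otimes>\<^sub>M TL t)) = (\<integral>(r, s). indicat_real S2 (s, r) * h (s, r) \<partial>(TL t \<Otimes>\<^sub>M TL t))"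
      using P.integral_product_swap[OF borel_measurable_integrable[OF ind[OF S(2)]]] by simp
    also have "\<dots> = (\<integral>p. indicat_real S1 p * h p \<partial>(TL t \<Otimes>\<^sub>M TL t))"
    proof -
      \<comment> \<open>The triangles are mirror images except for the diagonal, which meets every
        section in a single point.\<close>
      have "AE r in TL t. AE s in TL t. indicat_real S2 (s, r) * h (s, r) = indicat_real S1 (r, s) * h (r, s)"
      proof (rule AE_I2)
        fix r assume r: "r \<in> space (TL t)"
        have "AE s in lborel. s \<noteq> r" by (rule AE_lborel_singleton)
        then have "AE s in TL t. s \<noteq> r" by (subst AE_restrict_space_iff) auto
        then show "AE s in TL t. indicat_real S2 (s, r) * h (s, r) = indicat_real S1 (r, s) * h (r, s)"
          using AE_space by eventually_elim
            (use r Q in \<open>auto simp: S1_def S2_def indicator_def space_pair_measure h_def\<close>)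
      qed
      then have "AE p in TL t \<Otimes>\<^sub>M TL t. (\<lambda>(r, s). indicat_real S2 (s, r) * h (s, r)) p = indicat_real S1 p * h p"
        by (intro P.AE_pair_measure borel_measurable_eq[OF f1 f2]) simp
      then show ?thesis by (rule integral_cong_AE[OF f1 f2])
    qed
    finally show ?thesis .
  qed
  have "(\<integral>s. f s \<partial>TL t) \<bullet> (Q *v (\<integral>s. f s \<partial>TL t)) = (\<integral>s. f s \<bullet> (Q *v (\<integral>r. f r \<partial>TL t)) \<partial>TL t)"
    using f by simp
  also have "\<dots> = (\<integral>s. \<integral>r. h (s, r) \<partial>TL t \<partial>TL t)"
    unfolding h_def by (simp add: Qint[OF f])
  also have "\<dots> = (\<integral>p. h p \<partial>(TL t \<Otimes>\<^sub>M TL t))" by (rule P.integral_fst'[OF h])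
  also have "\<dots> = (\<integral>p. indicat_real S1 p * h p + indicat_real S2 p * h p \<partial>(TL t \<Otimes>\<^sub>M TL t))"
    by (intro Bochner_Integration.integral_cong refl) (auto simp: S1_def S2_def indicator_def)
  also have "\<dots> = 2 * (\<integral>p. indicat_real S1 p * h p \<partial>(TL t \<Otimes>\<^sub>M TL t))"
    using ind[OF S(1)] ind[OF S(2)] I2 by simp
  finally show ?thesis unfolding I1 .
qed

section \<open>Drift integrals and the moment equation\<close>

context wiener_process
begin

lemma AE_snd_PM:
  assumes "AE \<omega> in M. P \<omega>"
  shows "AE p in PM t. P (snd p)"
proof -
  obtain N where N: "{\<omega> \<in> space M. \<not> P \<omega>} \<subseteq> N" "N \<in> sets M" "emeasure M N = 0"
    using assms by (auto elim!: AE_E)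
  have "space (TL t) \<times> N \<in> null_sets (PM t)"
    unfolding PM_def null_sets_def
    using pair_measureI[OF sets.top N(2), of "TL t"] emeasure_pair_measure_Times[OF sets.top N(2), of "TL t"] N(3)
    by simp
  moreover have "{p \<in> space (PM t). \<not> P (snd p)} \<subseteq> space (TL t) \<times> N"
    using N(1) by (auto simp: PM_def space_pair_measure)
  ultimately show ?thesis by (rule AE_I')
qed

lemma solution_adapted:
  assumes "ito_solution M F W A C x0 X" "0 \<le> s"
  shows "X s \<in> borel_measurable (F s)"
proof -
  have m: "(\<lambda>(s, \<omega>). X s \<omega>) \<in> borel_measurable (restrict_space borel {0..s} \<Otimes>\<^sub>M F s)"
    using assms by (auto simp: ito_solution_def progressive_def)
  have "Pair s \<in> measurable (F s) (restrict_space borel {0..s} \<Otimes>\<^sub>M F s)"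
    using assms(2) by (intro measurable_Pair1') (simp add: space_restrict_space)
  from measurable_compose[OF this m] show ?thesis by simp
qed

lemma solution_sqint_PM:
  assumes "ito_solution M F W A C x0 X" "0 \<le> t"
  shows "sqint (PM t) (\<lambda>p. X (fst p) (snd p))"
  unfolding sqint_def
proof
  show m: "(\<lambda>p. X (fst p) (snd p)) \<in> borel_measurable (PM t)"
    using assms by (intro progressive_measurable) (auto simp: ito_solution_def)
  have "energy M t X < \<infinity>" using assms by (auto simp: ito_solution_def)
  with m show "integrable (PM t) (\<lambda>p. (norm (X (fst p) (snd p)))\<^sup>2)"
    by (simp add: integrable_iff_bounded energy_eq[OF m])
qed

lemma sqint_snd_PM: "sqint M V \<Longrightarrow> sqint (PM t) (\<lambda>p. V (snd p))"
  using sqint_indicator_PM[of V UNIV t] by simp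

text \<open>The variable upper limit moves into the integrand as an indicator, so that the
  integration runs over the fixed measure \<open>TL t\<close> with the point of \<open>PM t\<close>
  as a parameter.\<close>

lemma drift_measurable:
  assumes G: "sqint (PM t) (\<lambda>p. G (fst p) (snd p))" and t: "0 \<le> t"
  shows "(\<lambda>p. \<integral>r. G r (snd p) \<partial>TL (fst p)) \<in> borel_measurable (PM t)"
proof -
  interpret T: finite_measure "TL t" by (rule finite_measure_restrict_lborel)
  have [measurable]: "(\<lambda>p. G (fst p) (snd p)) \<in> borel_measurable (TL t \<Otimes>\<^sub>M M)"
    using G by (simp add: sqint_def PM_def)
  have [measurable]: "(\<lambda>x. x) \<in> borel_measurable (TL t)" by (rule measurable_restrict_lborel) simp
  have "(\<lambda>q. (snd q, snd (fst q))) \<in> measurable (PM t \<Otimes>\<^sub>M TL t) (TL t \<Otimes>\<^sub>M M)"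
    unfolding PM_def by measurable
  from measurable_compose[OF this \<open>(\<lambda>p. G (fst p) (snd p)) \<in> borel_measurable (TL t \<Otimes>\<^sub>M M)\<close>]
  have [measurable]: "(\<lambda>q. G (snd q) (snd (fst q))) \<in> borel_measurable (PM t \<Otimes>\<^sub>M TL t)" by simp
  have [measurable]: "(\<lambda>q. indicat_real {..fst (fst q)} (snd q)) \<in> borel_measurable (PM t \<Otimes>\<^sub>M TL t)"
  proof -
    have "(\<lambda>q. if snd q \<le> fst (fst q) then 1 else 0 :: real) \<in> borel_measurable (PM t \<Otimes>\<^sub>M TL t)"
      by measurable
    then show ?thesis by (simp add: indicator_def)
  qed
  have "(\<lambda>p. \<integral>r. indicat_real {..fst p} r *\<^sub>R G r (snd p) \<partial>TL t) \<in> borel_measurable (PM t)"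
    by (rule T.borel_measurable_lebesgue_integral) (simp add: case_prod_unfold)
  moreover have "(\<integral>r. indicat_real {..fst p} r *\<^sub>R G r (snd p) \<partial>TL t) = (\<integral>r. G r (snd p) \<partial>TL (fst p))"
    if "p \<in> space (PM t)" for p
    using that by (intro integral_TL) (auto simp: PM_def space_pair_measure space_restrict_space)
  ultimately show ?thesis by (simp cong: measurable_cong)
qed

lemma AE_sqint_section:
  assumes G: "sqint (PM t) (\<lambda>p. G (fst p) (snd p))"
  shows "AE \<omega> in M. sqint (TL t) (\<lambda>r. G r \<omega>)"
proof -
  interpret P: pair_sigma_finite "TL t" M by (rule pair_sigma_finite_PM)
  have "AE \<omega> in M. integrable (TL t) (\<lambda>r. (norm (G r \<omega>))\<^sup>2)"
    using P.AE_integrable_snd[of "\<lambda>r \<omega>. (norm (G r \<omega>))\<^sup>2"] sqint_integrable[OF G]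
    by (simp add: PM_def case_prod_unfold)
  then show ?thesis using AE_space
  proof eventually_elim
    case (elim \<omega>)
    have "(\<lambda>r. (r, \<omega>)) \<in> measurable (TL t) (PM t)"
      unfolding PM_def using elim(2) by (rule measurable_Pair2')
    from measurable_compose[OF this sqint_measurable[OF G]] elim(1) show ?case by (simp add: sqint_def)
  qed
qed

text \<open>The null set is chosen before \<open>s\<close>; this uniformity turns the estimate into
  one that holds almost everywhere on \<open>PM t\<close>.\<close>

lemma drift_bound:
  assumes G: "sqint (PM t) (\<lambda>p. G (fst p) (snd p))" and t: "0 \<le> t"
  shows "AE \<omega> in M. \<forall>s\<in>{0..t}. (norm (\<integral>r. G r \<omega> \<partial>TL s))\<^sup>2 \<le> t * (\<integral>r. (norm (G r \<omega>))\<^sup>2 \<partial>TL t)"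
  using AE_sqint_section[OF G]
proof eventually_elim
  case (elim \<omega>)
  show ?case
  proof
    fix s assume s: "s \<in> {0..t}"
    have ind[measurable]: "indicat_real {..s} \<in> borel_measurable (TL t)" by (rule measurable_restrict_lborel) simp
    have le: "(norm (indicat_real {..s} r *\<^sub>R G r \<omega>))\<^sup>2 \<le> (norm (G r \<omega>))\<^sup>2" for r by (auto simp: indicator_def)
    have sq: "sqint (TL t) (\<lambda>r. indicat_real {..s} r *\<^sub>R G r \<omega>)"
      by (rule sqintI_le[OF borel_measurable_scaleR[OF ind sqint_measurable[OF elim]] sqint_integrable[OF elim] le])
    have "(norm (\<integral>r. G r \<omega> \<partial>TL s))\<^sup>2 = (norm (\<integral>r. indicat_real {..s} r *\<^sub>R G r \<omega> \<partial>TL t))\<^sup>2"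
      using s by (subst integral_TL) auto
    also have "\<dots> \<le> t * (\<integral>r. (norm (indicat_real {..s} r *\<^sub>R G r \<omega>))\<^sup>2 \<partial>TL t)"
      by (rule norm_integral_square_le[OF sq t])
    also have "\<dots> \<le> t * (\<integral>r. (norm (G r \<omega>))\<^sup>2 \<partial>TL t)"
      using t by (intro mult_left_mono integral_mono le sqint_integrable sq elim)
    finally show "(norm (\<integral>r. G r \<omega> \<partial>TL s))\<^sup>2 \<le> t * (\<integral>r. (norm (G r \<omega>))\<^sup>2 \<partial>TL t)" .
  qed
qed

lemma integrable_section_square:
  assumes G: "sqint (PM t) (\<lambda>p. G (fst p) (snd p))"
  shows "integrable M (\<lambda>\<omega>. \<integral>r. (norm (G r \<omega>))\<^sup>2 \<partial>TL t)"
proof -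
  interpret P: pair_sigma_finite "TL t" M by (rule pair_sigma_finite_PM)
  show ?thesis
    using P.integrable_snd[of "\<lambda>r \<omega>. (norm (G r \<omega>))\<^sup>2"] sqint_integrable[OF G]
    by (simp add: PM_def case_prod_unfold)
qed

lemma sqint_drift_PM:
  assumes G: "sqint (PM t) (\<lambda>p. G (fst p) (snd p))" and t: "0 \<le> t"
  shows "sqint (PM t) (\<lambda>p. \<integral>r. G r (snd p) \<partial>TL (fst p))"
proof (rule sqintI_AE[OF drift_measurable[OF G t]])
  interpret T: finite_measure "TL t" by (rule finite_measure_restrict_lborel)
  show "integrable (PM t) (\<lambda>p. t * (\<integral>r. (norm (G r (snd p)))\<^sup>2 \<partial>TL t))"
    by (rule integrable_fst_snd[of t "\<lambda>_. t", OF _ integrable_section_square[OF G]]) simp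
  show "AE p in PM t. (norm (\<integral>r. G r (snd p) \<partial>TL (fst p)))\<^sup>2 \<le> t * (\<integral>r. (norm (G r (snd p)))\<^sup>2 \<partial>TL t)"
    using AE_snd_PM[OF drift_bound[OF G t], of t] AE_space
    by eventually_elim (auto simp: PM_def space_pair_measure space_restrict_space)
qed

lemma sqint_drift:
  assumes G: "sqint (PM t) (\<lambda>p. G (fst p) (snd p))" and t: "0 \<le> t"
  shows "sqint M (\<lambda>\<omega>. \<integral>r. G r \<omega> \<partial>TL t)"
proof (rule sqintI_AE)
  have "Pair t \<in> measurable M (PM t)"
    unfolding PM_def using t by (intro measurable_Pair1') (simp add: space_restrict_space)
  from measurable_compose[OF this drift_measurable[OF G t]]
  show "(\<lambda>\<omega>. \<integral>r. G r \<omega> \<partial>TL t) \<in> borel_measurable M" by simp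
  show "integrable M (\<lambda>\<omega>. t * (\<integral>r. (norm (G r \<omega>))\<^sup>2 \<partial>TL t))"
    using integrable_section_square[OF G] by simp
  show "AE \<omega> in M. (norm (\<integral>r. G r \<omega> \<partial>TL t))\<^sup>2 \<le> t * (\<integral>r. (norm (G r \<omega>))\<^sup>2 \<partial>TL t)"
    using drift_bound[OF G t] by eventually_elim (use t in auto)
qed

lemma expectation_section:
  assumes f: "integrable (PM t) (\<lambda>p. f (fst p) (snd p) :: real)"
    and g: "g \<in> borel_measurable M" and eq: "AE \<omega> in M. g \<omega> = (\<integral>r. f r \<omega> \<partial>TL t)"
  shows "expectation g = (\<integral>p. f (fst p) (snd p) \<partial>PM t)"
proof -
  interpret P: pair_sigma_finite "TL t" M by (rule pair_sigma_finite_PM)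
  have f': "integrable (TL t \<Otimes>\<^sub>M M) (case_prod f)" using f by (simp add: PM_def case_prod_unfold)
  have "expectation g = expectation (\<lambda>\<omega>. \<integral>r. f r \<omega> \<partial>TL t)"
    by (rule integral_cong_AE[OF g borel_measurable_integrable[OF P.integrable_snd[OF f']] eq])
  also have "\<dots> = (\<integral>p. f (fst p) (snd p) \<partial>PM t)"
    using P.integral_snd[OF f'] by (simp add: PM_def case_prod_unfold)
  finally show ?thesis .
qed

lemma integral_PM_fst:
  assumes f: "integrable (PM t) (\<lambda>p. f (fst p) (snd p) :: real)"
  shows "(\<integral>p. f (fst p) (snd p) \<partial>PM t) = (\<integral>s. expectation (f s) \<partial>TL t)"
    and "integrable (TL t) (\<lambda>s. expectation (f s))"
proof -
  interpret P: pair_sigma_finite "TL t" M by (rule pair_sigma_finite_PM)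
  have f': "integrable (TL t \<Otimes>\<^sub>M M) (case_prod f)" using f by (simp add: PM_def case_prod_unfold)
  show "(\<integral>p. f (fst p) (snd p) \<partial>PM t) = (\<integral>s. expectation (f s) \<partial>TL t)"
    using P.integral_fst[OF f'] by (simp add: PM_def case_prod_unfold)
  show "integrable (TL t) (\<lambda>s. expectation (f s))"
    using P.integrable_fst[OF f'] by simp
qed

lemma expectation_drift_inner:
  assumes G: "sqint (PM t) (\<lambda>p. G (fst p) (snd p))" and t: "0 \<le> t" and V: "sqint M V"
  shows "expectation (\<lambda>\<omega>. (\<integral>r. G r \<omega> \<partial>TL t) \<bullet> V \<omega>) = (\<integral>p. G (fst p) (snd p) \<bullet> V (snd p) \<partial>PM t)"
proof (rule expectation_section)
  show "integrable (PM t) (\<lambda>p. G (fst p) (snd p) \<bullet> V (snd p))"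
    by (rule sqint_inner[OF G sqint_snd_PM[OF V]])
  show "(\<lambda>\<omega>. (\<integral>r. G r \<omega> \<partial>TL t) \<bullet> V \<omega>) \<in> borel_measurable M"
    using sqint_inner[OF sqint_drift[OF G t] V] by (rule borel_measurable_integrable)
  show "AE \<omega> in M. (\<integral>r. G r \<omega> \<partial>TL t) \<bullet> V \<omega> = (\<integral>r. G r \<omega> \<bullet> V \<omega> \<partial>TL t)"
    using AE_sqint_section[OF G]
  proof eventually_elim
    case (elim \<omega>)
    from sqint_integrable_fun[OF this finite_measure_restrict_lborel] show ?case by simp
  qed
qed

lemma expectation_drift_quadratic:
  fixes Q :: "real^'n^'n"
  assumes G: "sqint (PM t) (\<lambda>p. G (fst p) (snd p))" and t: "0 \<le> t"
    and Q: "\<And>x y. x \<bullet> (Q *v y) = y \<bullet> (Q *v x)"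
  shows "expectation (\<lambda>\<omega>. (\<integral>r. G r \<omega> \<partial>TL t) \<bullet> (Q *v (\<integral>r. G r \<omega> \<partial>TL t)))
    = 2 * (\<integral>p. G (fst p) (snd p) \<bullet> (Q *v (\<integral>r. G r (snd p) \<partial>TL (fst p))) \<partial>PM t)"
proof -
  note D = sqint_drift[OF G t] and DP = sqint_drift_PM[OF G t]
  have "expectation (\<lambda>\<omega>. (\<integral>r. G r \<omega> \<partial>TL t) \<bullet> (Q *v (\<integral>r. G r \<omega> \<partial>TL t)))
    = (\<integral>p. 2 * (G (fst p) (snd p) \<bullet> (Q *v (\<integral>r. G r (snd p) \<partial>TL (fst p)))) \<partial>PM t)"
  proof (rule expectation_section[where f = "\<lambda>s \<omega>. 2 * (G s \<omega> \<bullet> (Q *v (\<integral>r. G r \<omega> \<partial>TL s)))"])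
    show "integrable (PM t) (\<lambda>p. 2 * (G (fst p) (snd p) \<bullet> (Q *v (\<integral>r. G r (snd p) \<partial>TL (fst p)))))"
      using sqint_inner[OF G sqint_mv[OF DP]] by simp
    show "(\<lambda>\<omega>. (\<integral>r. G r \<omega> \<partial>TL t) \<bullet> (Q *v (\<integral>r. G r \<omega> \<partial>TL t))) \<in> borel_measurable M"
      using sqint_inner[OF D sqint_mv[OF D]] by (rule borel_measurable_integrable)
    show "AE \<omega> in M. (\<integral>r. G r \<omega> \<partial>TL t) \<bullet> (Q *v (\<integral>r. G r \<omega> \<partial>TL t))
      = (\<integral>s. 2 * (G s \<omega> \<bullet> (Q *v (\<integral>r. G r \<omega> \<partial>TL s))) \<partial>TL t)"
      using AE_sqint_section[OF G]
    proof eventually_elim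
      case (elim \<omega>)
      have int: "integrable (TL t) (\<lambda>r. G r \<omega>)"
        by (rule sqint_integrable_fun[OF elim finite_measure_restrict_lborel])
      show ?case using integral_quadratic_primitive[OF int Q] by simp
    qed
  qed
  then show ?thesis by simp
qed

text \<open>Finite energy controls a solution only on average over time. That the second moment is
  finite at the given time \<open>t\<close> follows from the equation, whose right-hand side is
  square integrable.\<close>

lemma solution_decomposition:
  assumes sol: "ito_solution M F W A C x0 X" and t: "0 \<le> t"
  obtains Y where "has_ito_integral M F W (\<lambda>s \<omega>. C *v X s \<omega>) t Y"
    "AE \<omega> in M. X t \<omega> = x0 + (\<integral>s. A *v X s \<omega> \<partial>TL t) + Y \<omega>" "sqint M Y" "sqint M (X t)"
proof -
  obtain Y where Y: "has_ito_integral M F W (\<lambda>s \<omega>. C *v X s \<omega>) t Y"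
    and eq: "AE \<omega> in M. X t \<omega> = x0 + (\<integral>s. A *v X s \<omega> \<partial>TL t) + Y \<omega>"
    using sol t by (auto simp: ito_solution_def set_integral_TL)
  have sqY: "sqint M Y" by (rule has_ito_integralD[OF Y t]) iprover
  note G = sqint_mv[OF solution_sqint_PM[OF sol t], of A]
  have Z: "sqint M (\<lambda>\<omega>. x0 + (\<integral>s. A *v X s \<omega> \<partial>TL t) + Y \<omega>)"
    by (intro sqint_add sqint_const sqY sqint_drift[OF _ t]) (use G in simp)
  have "sqint M (X t)"
  proof (rule sqintI_AE[OF measurable_F_M[OF solution_adapted[OF sol t]] sqint_integrable[OF Z]])
    show "AE \<omega> in M. (norm (X t \<omega>))\<^sup>2 \<le> (norm (x0 + (\<integral>s. A *v X s \<omega> \<partial>TL t) + Y \<omega>))\<^sup>2"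
      using eq by eventually_elim simp
  qed
  with Y eq sqY show ?thesis by (rule that)
qed

text \<open>By the isometry the second moment of \<open>Y\<close> is an integral over
  \<open>PM 0\<close>, a null space, so \<open>Y\<close> vanishes in mean square.\<close>

lemma ito_integral_0:
  fixes Y :: "'a \<Rightarrow> real^'n"
  assumes "has_ito_integral M F W H 0 Y" and Z: "sqint M Z"
  shows "expectation (\<lambda>\<omega>. Z \<omega> \<bullet> Y \<omega>) = 0"
proof -
  interpret P: pair_sigma_finite "TL 0" M by (rule pair_sigma_finite_PM)
  have sqY: "sqint M Y" by (rule has_ito_integralD[OF assms(1) order_refl]) iprover
  have "emeasure (PM 0) (space (PM 0)) = 0"
    unfolding PM_def space_pair_measure emeasure_pair_measure_Times[OF sets.top sets.top]
    by (simp add: emeasure_restrict_space space_restrict_space)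
  then have AE0: "AE p in PM 0. f p = (0::real)" for f
    by (intro AE_I[OF Collect_restrict _ sets.top])
  have "(\<integral>p. H (fst p) (snd p) \<bullet> (mat 1 *v H (fst p) (snd p)) \<partial>PM 0) = 0"
    by (rule integral_eq_zero_AE[OF AE0])
  with ito_isometry[OF assms(1), of "mat 1"] have "expectation (\<lambda>\<omega>. (norm (Y \<omega>))\<^sup>2) = 0"
    by (simp add: power2_norm_eq_inner)
  with integral_inner_Cauchy_Schwarz[OF Z sqY] show ?thesis by simp
qed

text \<open>The drift \<open>D\<close> cancels: the cross term of \<open>D\<close> and the martingale part \<open>Y\<close> produces
  \<open>X - x0 - D\<close>, since conditioning on the past replaces \<open>Y\<^sub>t\<close> by \<open>Y\<^sub>s\<close>.\<close>

theorem moment_equation: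
  fixes Q :: "real^'n^'n"
  assumes sol: "ito_solution M F W A C x0 X" and t: "0 \<le> t"
    and Q: "\<And>x y. x \<bullet> (Q *v y) = y \<bullet> (Q *v x)"
  shows "expectation (\<lambda>\<omega>. X t \<omega> \<bullet> (Q *v X t \<omega>)) = x0 \<bullet> (Q *v x0) +
    (\<integral>p. 2 * ((A *v X (fst p) (snd p)) \<bullet> (Q *v X (fst p) (snd p)))
      + (C *v X (fst p) (snd p)) \<bullet> (Q *v (C *v X (fst p) (snd p))) \<partial>PM t)"
proof -
  define G where "G = (\<lambda>s \<omega>. A *v X s \<omega>)"
  define D where "D = (\<lambda>s \<omega>. \<integral>r. G r \<omega> \<partial>TL s)"
  note XP = solution_sqint_PM[OF sol t]
  have G: "sqint (PM t) (\<lambda>p. G (fst p) (snd p))" unfolding G_def by (rule sqint_mv[OF XP])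
  have DP: "sqint (PM t) (\<lambda>p. D (fst p) (snd p))" unfolding D_def by (rule sqint_drift_PM[OF G t])
  have sqD: "sqint M (D s)" if "0 \<le> s" for s
    unfolding D_def using sqint_mv[OF solution_sqint_PM[OF sol that], of A] that
    by (intro sqint_drift) (simp_all add: G_def)
  obtain Y where Y: "has_ito_integral M F W (\<lambda>s \<omega>. C *v X s \<omega>) t Y"
    "AE \<omega> in M. X t \<omega> = x0 + (\<integral>s. A *v X s \<omega> \<partial>TL t) + Y \<omega>" "sqint M Y" "sqint M (X t)"
    by (rule solution_decomposition[OF sol t])
  have XY: "AE \<omega> in M. X t \<omega> = x0 + D t \<omega> + Y \<omega>" unfolding D_def G_def by (rule Y(2))
  interpret PMt: finite_measure "PM t" by (rule finite_measure_PM)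
  note sq = sqD[OF t] Y(3) sqint_mv[OF sqD[OF t]] sqint_mv[OF Y(3)] sqint_const
  have *: "(x0 + d + y) \<bullet> (Q *v (x0 + d + y)) = x0 \<bullet> (Q *v x0) + 2 * (d \<bullet> (Q *v x0)) + 2 * ((Q *v x0) \<bullet> y)
      + d \<bullet> (Q *v d) + 2 * (d \<bullet> (Q *v y)) + y \<bullet> (Q *v y)" for d y
    using Q[of x0 d] Q[of x0 y] Q[of y d] inner_commute[of y "Q *v x0"]
    by (simp add: matrix_vector_right_distrib inner_add_left inner_add_right)
  have sqS: "sqint M (\<lambda>\<omega>. x0 + D t \<omega> + Y \<omega>)" by (intro sqint_add sq)
  have "expectation (\<lambda>\<omega>. X t \<omega> \<bullet> (Q *v X t \<omega>)) = expectation (\<lambda>\<omega>. (x0 + D t \<omega> + Y \<omega>) \<bullet> (Q *v (x0 + D t \<omega> + Y \<omega>)))"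
  proof (rule integral_cong_AE)
    show "(\<lambda>\<omega>. X t \<omega> \<bullet> (Q *v X t \<omega>)) \<in> borel_measurable M"
      using sqint_inner[OF Y(4) sqint_mv[OF Y(4)]] by (rule borel_measurable_integrable)
    show "(\<lambda>\<omega>. (x0 + D t \<omega> + Y \<omega>) \<bullet> (Q *v (x0 + D t \<omega> + Y \<omega>))) \<in> borel_measurable M"
      using sqint_inner[OF sqS sqint_mv[OF sqS]] by (rule borel_measurable_integrable)
  qed (use XY in eventually_elim, simp)
  also have "\<dots> = x0 \<bullet> (Q *v x0) + 2 * expectation (\<lambda>\<omega>. D t \<omega> \<bullet> (Q *v x0)) + 2 * expectation (\<lambda>\<omega>. (Q *v x0) \<bullet> Y \<omega>)
      + expectation (\<lambda>\<omega>. D t \<omega> \<bullet> (Q *v D t \<omega>)) + 2 * expectation (\<lambda>\<omega>. D t \<omega> \<bullet> (Q *v Y \<omega>))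
      + expectation (\<lambda>\<omega>. Y \<omega> \<bullet> (Q *v Y \<omega>))"
  proof -
    have "integrable M (\<lambda>\<omega>. D t \<omega> \<bullet> (Q *v x0))" "integrable M (\<lambda>\<omega>. (Q *v x0) \<bullet> Y \<omega>)"
      "integrable M (\<lambda>\<omega>. D t \<omega> \<bullet> (Q *v D t \<omega>))" "integrable M (\<lambda>\<omega>. D t \<omega> \<bullet> (Q *v Y \<omega>))"
      "integrable M (\<lambda>\<omega>. Y \<omega> \<bullet> (Q *v Y \<omega>))"
      by (intro sqint_inner sq)+
    then show ?thesis unfolding * by (simp add: prob_space)
  qed
  also have "expectation (\<lambda>\<omega>. D t \<omega> \<bullet> (Q *v x0)) = (\<integral>p. G (fst p) (snd p) \<bullet> (Q *v x0) \<partial>PM t)"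
    unfolding D_def by (rule expectation_drift_inner[OF G t sqint_const])
  also have "expectation (\<lambda>\<omega>. (Q *v x0) \<bullet> Y \<omega>) = 0"
  proof -
    \<comment> \<open>The mean is zero because a constant is measurable already at time 0, where the
      integral vanishes in mean square.\<close>
    obtain Y0 where Y0: "has_ito_integral M F W (\<lambda>s \<omega>. C *v X s \<omega>) 0 Y0"
      by (rule solution_decomposition[OF sol order_refl])
    have "expectation (\<lambda>\<omega>. (Q *v x0) \<bullet> Y \<omega>) = expectation (\<lambda>\<omega>. (Q *v x0) \<bullet> Y0 \<omega>)"
      by (rule ito_martingale[OF Y(1) Y0 order_refl t sqint_const]) simp
    also have "\<dots> = 0" by (rule ito_integral_0[OF Y0 sqint_const])
    finally show ?thesis .
  qed
  also have "expectation (\<lambda>\<omega>. D t \<omega> \<bullet> (Q *v D t \<omega>)) = 2 * (\<integral>p. G (fst p) (snd p) \<bullet> (Q *v D (fst p) (snd p)) \<partial>PM t)"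
    unfolding D_def by (rule expectation_drift_quadratic[OF G t Q])
  also have "expectation (\<lambda>\<omega>. D t \<omega> \<bullet> (Q *v Y \<omega>))
      = (\<integral>p. G (fst p) (snd p) \<bullet> (Q *v (X (fst p) (snd p) - x0 - D (fst p) (snd p))) \<partial>PM t)"
  proof -
    have "expectation (\<lambda>\<omega>. D t \<omega> \<bullet> (Q *v Y \<omega>)) = (\<integral>p. G (fst p) (snd p) \<bullet> (Q *v Y (snd p)) \<partial>PM t)"
      unfolding D_def by (rule expectation_drift_inner[OF G t sqint_mv[OF Y(3)]])
    also have "\<dots> = (\<integral>s. expectation (\<lambda>\<omega>. G s \<omega> \<bullet> (Q *v Y \<omega>)) \<partial>TL t)"
      by (rule integral_PM_fst[where f = "\<lambda>s \<omega>. G s \<omega> \<bullet> (Q *v Y \<omega>)"])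
        (rule sqint_inner[OF G sqint_snd_PM[OF sqint_mv[OF Y(3)]]])
    also have "\<dots> = (\<integral>s. expectation (\<lambda>\<omega>. G s \<omega> \<bullet> (Q *v (X s \<omega> - x0 - D s \<omega>))) \<partial>TL t)"
    proof (rule Bochner_Integration.integral_cong[OF refl])
      fix s assume "s \<in> space (TL t)"
      then have s: "0 \<le> s" "s \<le> t" by (auto simp: space_restrict_space)
      obtain Y' where Y': "has_ito_integral M F W (\<lambda>s \<omega>. C *v X s \<omega>) s Y'"
        "AE \<omega> in M. X s \<omega> = x0 + (\<integral>s. A *v X s \<omega> \<partial>TL s) + Y' \<omega>" "sqint M Y'" "sqint M (X s)"
        by (rule solution_decomposition[OF sol s(1)])
      have XY': "AE \<omega> in M. X s \<omega> = x0 + D s \<omega> + Y' \<omega>" unfolding D_def G_def by (rule Y'(2))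
      have QG: "sqint M (\<lambda>\<omega>. Q *v G s \<omega>)" unfolding G_def by (intro sqint_mv Y'(4))
      have QGF: "(\<lambda>\<omega>. Q *v G s \<omega>) \<in> borel_measurable (F s)"
        unfolding G_def by (intro measurable_mv solution_adapted[OF sol s(1)])
      have sw: "G s \<omega> \<bullet> (Q *v y) = (Q *v G s \<omega>) \<bullet> y" for \<omega> y by (metis Q inner_commute)
      have "expectation (\<lambda>\<omega>. (Q *v G s \<omega>) \<bullet> Y \<omega>) = expectation (\<lambda>\<omega>. (Q *v G s \<omega>) \<bullet> Y' \<omega>)"
        by (rule ito_martingale[OF Y(1) Y'(1) s QG QGF])
      also have "\<dots> = expectation (\<lambda>\<omega>. (Q *v G s \<omega>) \<bullet> (X s \<omega> - x0 - D s \<omega>))"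
      proof (rule integral_cong_AE)
        show "(\<lambda>\<omega>. (Q *v G s \<omega>) \<bullet> Y' \<omega>) \<in> borel_measurable M"
          by (rule borel_measurable_integrable[OF sqint_inner[OF QG Y'(3)]])
        show "(\<lambda>\<omega>. (Q *v G s \<omega>) \<bullet> (X s \<omega> - x0 - D s \<omega>)) \<in> borel_measurable M"
          by (intro borel_measurable_integrable sqint_inner QG sqint_diff Y'(4) sqint_const sqD s)
      qed (use XY' in eventually_elim, simp)
      finally show "expectation (\<lambda>\<omega>. G s \<omega> \<bullet> (Q *v Y \<omega>)) = expectation (\<lambda>\<omega>. G s \<omega> \<bullet> (Q *v (X s \<omega> - x0 - D s \<omega>)))"
        unfolding sw .
    qed
    also have "\<dots> = (\<integral>p. G (fst p) (snd p) \<bullet> (Q *v (X (fst p) (snd p) - x0 - D (fst p) (snd p))) \<partial>PM t)"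
      by (rule integral_PM_fst(1)[where f = "\<lambda>s \<omega>. G s \<omega> \<bullet> (Q *v (X s \<omega> - x0 - D s \<omega>))", symmetric])
        (intro sqint_inner G sqint_mv sqint_diff XP DP PMt.sqint_const)
    finally show ?thesis .
  qed
  also have "expectation (\<lambda>\<omega>. Y \<omega> \<bullet> (Q *v Y \<omega>)) = (\<integral>p. (C *v X (fst p) (snd p)) \<bullet> (Q *v (C *v X (fst p) (snd p))) \<partial>PM t)"
    by (rule ito_isometry[OF Y(1) t])
  finally have e: "expectation (\<lambda>\<omega>. X t \<omega> \<bullet> (Q *v X t \<omega>)) = x0 \<bullet> (Q *v x0)
      + 2 * (\<integral>p. G (fst p) (snd p) \<bullet> (Q *v x0) \<partial>PM t) + 2 * 0
      + 2 * (\<integral>p. G (fst p) (snd p) \<bullet> (Q *v D (fst p) (snd p)) \<partial>PM t)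
      + 2 * (\<integral>p. G (fst p) (snd p) \<bullet> (Q *v (X (fst p) (snd p) - x0 - D (fst p) (snd p))) \<partial>PM t)
      + (\<integral>p. (C *v X (fst p) (snd p)) \<bullet> (Q *v (C *v X (fst p) (snd p))) \<partial>PM t)" .
  have "expectation (\<lambda>\<omega>. X t \<omega> \<bullet> (Q *v X t \<omega>)) = x0 \<bullet> (Q *v x0)
    + (\<integral>p. 2 * (G (fst p) (snd p) \<bullet> (Q *v x0)) + 2 * (G (fst p) (snd p) \<bullet> (Q *v D (fst p) (snd p)))
      + 2 * (G (fst p) (snd p) \<bullet> (Q *v (X (fst p) (snd p) - x0 - D (fst p) (snd p))))
      + (C *v X (fst p) (snd p)) \<bullet> (Q *v (C *v X (fst p) (snd p))) \<partial>PM t)"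
  proof -
    have "integrable (PM t) (\<lambda>p. G (fst p) (snd p) \<bullet> (Q *v x0))"
      "integrable (PM t) (\<lambda>p. G (fst p) (snd p) \<bullet> (Q *v D (fst p) (snd p)))"
      "integrable (PM t) (\<lambda>p. G (fst p) (snd p) \<bullet> (Q *v (X (fst p) (snd p) - x0 - D (fst p) (snd p))))"
      "integrable (PM t) (\<lambda>p. (C *v X (fst p) (snd p)) \<bullet> (Q *v (C *v X (fst p) (snd p))))"
      by (intro sqint_inner G sqint_mv sqint_diff XP DP PMt.sqint_const)+
    then show ?thesis unfolding e by simp
  qed
  also have "(\<lambda>p. 2 * (G (fst p) (snd p) \<bullet> (Q *v x0)) + 2 * (G (fst p) (snd p) \<bullet> (Q *v D (fst p) (snd p)))
      + 2 * (G (fst p) (snd p) \<bullet> (Q *v (X (fst p) (snd p) - x0 - D (fst p) (snd p))))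
      + (C *v X (fst p) (snd p)) \<bullet> (Q *v (C *v X (fst p) (snd p))))
    = (\<lambda>p. 2 * ((A *v X (fst p) (snd p)) \<bullet> (Q *v X (fst p) (snd p)))
      + (C *v X (fst p) (snd p)) \<bullet> (Q *v (C *v X (fst p) (snd p))))"
    by (simp add: fun_eq_iff matrix_vector_mult_diff_distrib inner_diff_right G_def)
  finally show ?thesis .
qed

end

section \<open>Existence of solutions by the Euler scheme\<close>

text \<open>Splitting \<open>d k x\<close> by Young's inequality with weight \<open>(4/3)^k\<close>
  trades its square, of mean order \<open>(1/2)^k\<close>, for a term of order
  \<open>(2/3)^k\<close> and the deterministic \<open>(3/4)^k\<close>. Both are summable, so the
  increments are summable almost everywhere. Any ratio strictly between 1/2 and 1 could replace
  3/4.\<close>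

lemma AE_convergent_of_L2_fast:
  fixes Z :: "nat \<Rightarrow> 'a \<Rightarrow> 'b::euclidean_space"
  assumes fin: "finite_measure M" and Z: "\<And>k. sqint M (Z k)"
    and bd: "\<And>k. (\<integral>x. (norm (Z (Suc k) x - Z k x))\<^sup>2 \<partial>M) \<le> K * (1/2) ^ k"
  shows "AE x in M. convergent (\<lambda>k. Z k x)"
proof -
  interpret finite_measure M by fact
  have K: "0 \<le> K" using order_trans[OF _ bd[of 0]] by simp
  define d where "d k x = norm (Z (Suc k) x - Z k x)" for k x
  have [measurable]: "d k \<in> borel_measurable M" for k
    unfolding d_def using Z sqint_measurable by auto
  have le: "d k x \<le> (3/4)^k + (4/3)^k * (d k x)\<^sup>2" for k x
  proof -
    have "0 \<le> ((3/4)^k - d k x)\<^sup>2 * (4/3)^k" by simp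
    also have "\<dots> = (3/4)^k * ((3/4)^k * (4/3)^k) - 2 * ((3/4)^k * (4/3)^k) * d k x + (4/3)^k * (d k x)\<^sup>2"
      by (simp add: power2_eq_square algebra_simps)
    also have "(3/4)^k * (4/3)^k = (1::real)" by (simp add: power_mult_distrib[symmetric])
    finally have "2 * d k x \<le> (3/4)^k + (4/3)^k * (d k x)\<^sup>2" by simp
    moreover have "0 \<le> d k x" by (simp add: d_def)
    ultimately show ?thesis by linarith
  qed
  have int: "(\<integral>\<^sup>+x. ennreal (d k x) \<partial>M) \<le> ennreal (measure M (space M) * (3/4)^k + K * (2/3)^k)" for k
  proof -
    have i2: "integrable M (\<lambda>x. (d k x)\<^sup>2)" unfolding d_def by (intro sqint_integrable sqint_diff Z)
    have "(\<integral>\<^sup>+x. ennreal (d k x) \<partial>M) \<le> (\<integral>\<^sup>+x. ennreal ((3/4)^k + (4/3)^k * (d k x)\<^sup>2) \<partial>M)"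
      by (intro nn_integral_mono ennreal_leI le)
    also have "\<dots> = ennreal (\<integral>x. (3/4)^k + (4/3)^k * (d k x)\<^sup>2 \<partial>M)"
      using i2 by (intro nn_integral_eq_integral) auto
    also have "(\<integral>x. (3/4)^k + (4/3)^k * (d k x)\<^sup>2 \<partial>M) = measure M (space M) * (3/4)^k + (4/3)^k * (\<integral>x. (d k x)\<^sup>2 \<partial>M)"
      using i2 by simp
    also have "\<dots> \<le> measure M (space M) * (3/4)^k + (4/3)^k * (K * (1/2)^k)"
      using bd[of k] by (intro add_left_mono mult_left_mono) (auto simp: d_def)
    also have "(4/3)^k * (K * (1/2)^k) = K * (2/3)^k"
      by (simp add: power_mult_distrib[symmetric] mult.left_commute)
    finally show ?thesis by (simp add: ennreal_leI)
  qed
  have sm: "summable (\<lambda>k. measure M (space M) * (3/4)^k + K * (2/3)^k)"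
    by (intro summable_add summable_mult summable_geometric) auto
  have "(\<integral>\<^sup>+x. (\<Sum>k. ennreal (d k x)) \<partial>M) = (\<Sum>k. \<integral>\<^sup>+x. ennreal (d k x) \<partial>M)"
    by (rule nn_integral_suminf) simp
  also have "\<dots> \<le> (\<Sum>k. ennreal (measure M (space M) * (3/4)^k + K * (2/3)^k))"
    by (intro suminf_le int) auto
  also have "\<dots> = ennreal (\<Sum>k. measure M (space M) * (3/4)^k + K * (2/3)^k)"
    using K by (intro suminf_ennreal2 sm) auto
  also have "\<dots> < \<infinity>" by simp
  finally have "AE x in M. (\<Sum>k. ennreal (d k x)) \<noteq> \<infinity>"
    by (intro nn_integral_PInf_AE) auto
  then show ?thesis
  proof eventually_elim
    case (elim x)
    have "summable (\<lambda>k. d k x)"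
      using elim by (intro summable_suminf_not_top) (auto simp: d_def)
    then have "summable (\<lambda>k. Z (Suc k) x - Z k x)"
      unfolding d_def by (rule summable_norm_cancel)
    then have "convergent (\<lambda>n. \<Sum>k<n. Z (Suc k) x - Z k x)" by (simp add: summable_iff_convergent)
    then have "convergent (\<lambda>n. (Z n x - Z 0 x) + Z 0 x)"
      unfolding sum_lessThan_telescope[where f = "\<lambda>k. Z k x"] by (intro convergent_add convergent_const)
    then show ?case by simp
  qed
qed

text \<open>The bound is proved between two members of the sequence and passes to the almost
  everywhere limit by Fatou's lemma.\<close>

lemma L2_fast_limit:
  fixes Z :: "nat \<Rightarrow> 'a \<Rightarrow> 'b::euclidean_space"
  assumes fin: "finite_measure M" and Z: "\<And>k. sqint M (Z k)"
    and bd: "\<And>k. (\<integral>x. (norm (Z (Suc k) x - Z k x))\<^sup>2 \<partial>M) \<le> K * (1/2) ^ k"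
  shows "sqint M (\<lambda>x. lim (\<lambda>k. Z k x))"
    and "(\<integral>x. (norm (lim (\<lambda>k. Z k x) - Z k x))\<^sup>2 \<partial>M) \<le> 12 * K * (1/2) ^ k"
proof -
  have K: "0 \<le> K" using order_trans[OF _ bd[of 0]] by simp
  define X where "X x = lim (\<lambda>k. Z k x)" for x
  have X[measurable]: "X \<in> borel_measurable M"
    unfolding X_def using Z sqint_measurable by (intro borel_measurable_lim_metric) auto
  have [measurable]: "Z k \<in> borel_measurable M" for k using Z sqint_measurable by auto
  \<comment> \<open>The weights must let the induction below close: a bound
    \<open>c K (1/2)^k\<close> needs \<open>3 + (3/2) (c/2) \<le> c\<close>, so
    \<open>c = 12\<close>. Equal weights 2 would require \<open>2 + c \<le> c\<close>.\<close>
  have two: "(norm (a + b))\<^sup>2 \<le> 3 * (norm a)\<^sup>2 + 3/2 * (norm b)\<^sup>2" for a b :: 'b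
  proof -
    have "(norm (a + b))\<^sup>2 \<le> (norm a + norm b)\<^sup>2" by (intro power_mono norm_triangle_ineq) simp
    also have "\<dots> \<le> 3 * (norm a)\<^sup>2 + 3/2 * (norm b)\<^sup>2"
      using zero_le_power2[of "2 * norm a - norm b"] by (simp add: power2_eq_square algebra_simps)
    finally show ?thesis .
  qed
  have pair: "(\<integral>x. (norm (Z (k + m) x - Z k x))\<^sup>2 \<partial>M) \<le> 12 * K * (1/2) ^ k" for k m
  proof (induction m arbitrary: k)
    case 0 then show ?case using K by simp
  next
    case (Suc m)
    have sq: "sqint M (\<lambda>x. Z (Suc k) x - Z k x)" "sqint M (\<lambda>x. Z (k + Suc m) x - Z (Suc k) x)"
      "sqint M (\<lambda>x. Z (k + Suc m) x - Z k x)" by (intro sqint_diff Z)+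
    have "(\<integral>x. (norm (Z (k + Suc m) x - Z k x))\<^sup>2 \<partial>M)
      \<le> (\<integral>x. 3 * (norm (Z (Suc k) x - Z k x))\<^sup>2 + 3/2 * (norm (Z (k + Suc m) x - Z (Suc k) x))\<^sup>2 \<partial>M)"
    proof (intro integral_mono sqint_integrable[OF sq(3)] Bochner_Integration.integrable_add
        Bochner_Integration.integrable_mult_right sqint_integrable[OF sq(1)] sqint_integrable[OF sq(2)])
      fix x
      show "(norm (Z (k + Suc m) x - Z k x))\<^sup>2
        \<le> 3 * (norm (Z (Suc k) x - Z k x))\<^sup>2 + 3/2 * (norm (Z (k + Suc m) x - Z (Suc k) x))\<^sup>2"
        using two[of "Z (Suc k) x - Z k x" "Z (k + Suc m) x - Z (Suc k) x"] by simp
    qed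
    also have "\<dots> = 3 * (\<integral>x. (norm (Z (Suc k) x - Z k x))\<^sup>2 \<partial>M)
        + 3/2 * (\<integral>x. (norm (Z (k + Suc m) x - Z (Suc k) x))\<^sup>2 \<partial>M)"
      using sqint_integrable[OF sq(1)] sqint_integrable[OF sq(2)] by simp
    also have "\<dots> \<le> 3 * (K * (1/2)^k) + 3/2 * (12 * K * (1/2)^(Suc k))"
      using bd[of k] Suc.IH[of "Suc k"] by (intro add_mono mult_left_mono) auto
    also have "\<dots> = 12 * K * (1/2)^k" by simp
    finally show ?case .
  qed
  have nn: "(\<integral>\<^sup>+x. ennreal ((norm (X x - Z k x))\<^sup>2) \<partial>M) \<le> ennreal (12 * K * (1/2) ^ k)" for k
  proof -
    have "AE x in M. ennreal ((norm (X x - Z k x))\<^sup>2) = liminf (\<lambda>m. ennreal ((norm (Z (k + m) x - Z k x))\<^sup>2))"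
      using AE_convergent_of_L2_fast[OF fin Z bd]
    proof eventually_elim
      case (elim x)
      then have "(\<lambda>m. Z m x) \<longlonglongrightarrow> X x" by (simp add: X_def convergent_LIMSEQ_iff)
      then have "(\<lambda>m. Z (m + k) x) \<longlonglongrightarrow> X x" by (rule LIMSEQ_ignore_initial_segment)
      then have "(\<lambda>m. ennreal ((norm (Z (k + m) x - Z k x))\<^sup>2)) \<longlonglongrightarrow> ennreal ((norm (X x - Z k x))\<^sup>2)"
        by (intro tendsto_ennrealI tendsto_intros) (simp add: add.commute)
      then show ?case by (intro lim_imp_Liminf[symmetric]) simp_all
    qed
    then have "(\<integral>\<^sup>+x. ennreal ((norm (X x - Z k x))\<^sup>2) \<partial>M)
        = (\<integral>\<^sup>+x. liminf (\<lambda>m. ennreal ((norm (Z (k + m) x - Z k x))\<^sup>2)) \<partial>M)"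
      by (rule nn_integral_cong_AE)
    also have "\<dots> \<le> liminf (\<lambda>m. \<integral>\<^sup>+x. ennreal ((norm (Z (k + m) x - Z k x))\<^sup>2) \<partial>M)"
      by (rule nn_integral_liminf) simp
    also have "\<dots> \<le> liminf (\<lambda>m::nat. ennreal (12 * K * (1/2) ^ k))"
    proof (rule Liminf_mono, rule always_eventually, rule allI)
      fix m
      have "(\<integral>\<^sup>+x. ennreal ((norm (Z (k + m) x - Z k x))\<^sup>2) \<partial>M) = ennreal (\<integral>x. (norm (Z (k + m) x - Z k x))\<^sup>2 \<partial>M)"
        using sqint_integrable[OF sqint_diff[OF Z[of "k + m"] Z[of k]]] by (intro nn_integral_eq_integral) auto
      also have "\<dots> \<le> ennreal (12 * K * (1/2) ^ k)" by (rule ennreal_leI[OF pair])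
      finally show "(\<integral>\<^sup>+x. ennreal ((norm (Z (k + m) x - Z k x))\<^sup>2) \<partial>M) \<le> ennreal (12 * K * (1/2) ^ k)" .
    qed
    also have "\<dots> = ennreal (12 * K * (1/2) ^ k)" by (simp add: Liminf_const)
    finally show ?thesis .
  qed
  have "(\<lambda>x. X x - Z 0 x) \<in> borel_measurable M" by simp
  moreover have "(\<integral>\<^sup>+x. ennreal ((norm (X x - Z 0 x))\<^sup>2) \<partial>M) < \<infinity>"
    using nn[of 0] by (rule le_less_trans) simp
  ultimately have "sqint M (\<lambda>x. X x - Z 0 x)"
    by (auto simp: sqint_def integrable_iff_bounded)
  from sqint_add[OF this Z[of 0]] have sq: "sqint M X" by simp
  then show "sqint M (\<lambda>x. lim (\<lambda>k. Z k x))" by (simp add: X_def[abs_def])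
  have "ennreal (\<integral>x. (norm (X x - Z k x))\<^sup>2 \<partial>M) = (\<integral>\<^sup>+x. ennreal ((norm (X x - Z k x))\<^sup>2) \<partial>M)"
    using sqint_integrable[OF sqint_diff[OF sq Z[of k]]] by (intro nn_integral_eq_integral[symmetric]) auto
  with nn[of k] have "ennreal (\<integral>x. (norm (X x - Z k x))\<^sup>2 \<partial>M) \<le> ennreal (12 * K * (1/2) ^ k)" by simp
  then have "(\<integral>x. (norm (X x - Z k x))\<^sup>2 \<partial>M) \<le> 12 * K * (1/2) ^ k"
    using K by (subst (asm) ennreal_le_iff) auto
  then show "(\<integral>x. (norm (lim (\<lambda>k. Z k x) - Z k x))\<^sup>2 \<partial>M) \<le> 12 * K * (1/2) ^ k" by (simp add: X_def)
qed

text \<open>The grid cell \<open>(jh, (j+1)h]\<close> containing \<open>s\<close>; truncated subtraction makes it \<open>0\<close> at \<open>s = 0\<close>.\<close>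

definition cell :: "real \<Rightarrow> real \<Rightarrow> nat" where
  "cell h s = nat \<lceil>s / h\<rceil> - 1"

lemma cell_bounds:
  assumes h: "0 < h" and s: "0 \<le> s"
  shows "real (cell h s) * h \<le> s" "s \<le> real (Suc (cell h s)) * h"
    "0 < s \<Longrightarrow> real (cell h s) * h < s"
proof -
  have *: "real (cell h s) * h < s \<and> s \<le> real (Suc (cell h s)) * h" if "0 < s"
  proof -
    have "0 < s / h" using that h by simp
    then have c: "0 < \<lceil>s / h\<rceil>" by linarith
    then have "int (cell h s) = \<lceil>s / h\<rceil> - 1" unfolding cell_def by linarith
    then have r: "real (cell h s) = real_of_int \<lceil>s / h\<rceil> - 1" "real (Suc (cell h s)) = real_of_int \<lceil>s / h\<rceil>"
      by linarith+
    have "real_of_int \<lceil>s / h\<rceil> - 1 < s / h" "s / h \<le> real_of_int \<lceil>s / h\<rceil>" by linarith+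
    then show ?thesis unfolding r pos_less_divide_eq[OF h] pos_divide_le_eq[OF h] by blast
  qed
  moreover have "cell h 0 = 0" by (simp add: cell_def)
  ultimately show "real (cell h s) * h \<le> s" "s \<le> real (Suc (cell h s)) * h"
    "0 < s \<Longrightarrow> real (cell h s) * h < s"
    using s h by (cases "s = 0"; force)+
qed

lemma cell_unique:
  assumes h: "0 < h" and "real j * h < s" "s \<le> real (Suc j) * h"
  shows "cell h s = j"
proof -
  have s: "0 < s" using assms by (smt (verit) mult_nonneg_nonneg of_nat_0_le_iff)
  note c = cell_bounds[OF h less_imp_le[OF s]]
  have "real j * h < real (Suc (cell h s)) * h" "real (cell h s) * h < real (Suc j) * h"
    using c(2) c(3)[OF s] assms by linarith+
  then have "real j < real (Suc (cell h s))" "real (cell h s) < real (Suc j)"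
    using h mult_less_cancel_right_pos by blast+
  then show ?thesis by linarith
qed

text \<open>Left-open cells nest under halving: a fine cell is the left or the right half of a
  coarse one. Being open on the left matches the pieces of elementary processes.\<close>

lemma cell_refine:
  assumes h: "0 < h" and s: "0 \<le> s"
  shows "cell h s = 2 * cell (2 * h) s \<or> cell h s = Suc (2 * cell (2 * h) s)"
proof (cases "s = 0")
  case True then show ?thesis by (simp add: cell_def)
next
  case False
  let ?j = "cell (2 * h) s"
  note c = cell_bounds[of "2 * h" s]
  have j: "real ?j * (2 * h) < s" "s \<le> real (Suc ?j) * (2 * h)" using c h s False by auto
  show ?thesis
  proof (cases "s \<le> real (Suc (2 * ?j)) * h")
    case True
    then have "cell h s = 2 * ?j" using j h by (intro cell_unique) (auto simp: algebra_simps)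
    then show ?thesis by simp
  next
    case False
    then have "cell h s = Suc (2 * ?j)" using j h by (intro cell_unique) (auto simp: algebra_simps)
    then show ?thesis by simp
  qed
qed

lemma cell_measurable: "cell h \<in> measurable borel (count_space UNIV)"
  unfolding cell_def by measurable

lemma common_operator_bound:
  fixes A C :: "real^'n^'n"
  obtains L where "L \<ge> 1" "\<And>x. norm (A *v x) \<le> L * norm x" "\<And>x. norm (C *v x) \<le> L * norm x"
proof -
  obtain a where a: "\<And>x. norm (A *v x) \<le> norm x * a"
    using bounded_linear.bounded[OF matrix_vector_mul_bounded_linear[of A]] by auto
  obtain c where c: "\<And>x. norm (C *v x) \<le> norm x * c"
    using bounded_linear.bounded[OF matrix_vector_mul_bounded_linear[of C]] by auto
  define L where "L = max 1 (max a c)"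
  have "a \<le> L" "c \<le> L" "L \<ge> 1" by (auto simp: L_def)
  have "norm (A *v x) \<le> L * norm x" for x
    using order_trans[OF a[of x] mult_left_mono[OF \<open>a \<le> L\<close> norm_ge_zero]] by (simp add: mult.commute)
  moreover have "norm (C *v x) \<le> L * norm x" for x
    using order_trans[OF c[of x] mult_left_mono[OF \<open>c \<le> L\<close> norm_ge_zero]] by (simp add: mult.commute)
  ultimately show ?thesis using that[OF \<open>L \<ge> 1\<close>] by blast
qed

lemma integral_square_le:
  assumes "sqint M U" "sqint M V" "sqint M V'"
    and "\<And>x. (norm (U x))\<^sup>2 \<le> \<alpha> * (norm (V x))\<^sup>2 + \<beta> * (norm (V' x))\<^sup>2"
  shows "(\<integral>x. (norm (U x))\<^sup>2 \<partial>M) \<le> \<alpha> * (\<integral>x. (norm (V x))\<^sup>2 \<partial>M) + \<beta> * (\<integral>x. (norm (V' x))\<^sup>2 \<partial>M)"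
proof -
  note i = sqint_integrable[OF assms(1)] sqint_integrable[OF assms(2)] sqint_integrable[OF assms(3)]
  have "(\<integral>x. (norm (U x))\<^sup>2 \<partial>M) \<le> (\<integral>x. \<alpha> * (norm (V x))\<^sup>2 + \<beta> * (norm (V' x))\<^sup>2 \<partial>M)"
    using i by (intro integral_mono assms(4)) auto
  also have "\<dots> = \<alpha> * (\<integral>x. (norm (V x))\<^sup>2 \<partial>M) + \<beta> * (\<integral>x. (norm (V' x))\<^sup>2 \<partial>M)"
    using i by simp
  finally show ?thesis .
qed

section \<open>The Euler scheme and the error of halving its step\<close>

context wiener_process
begin

primrec euler :: "real^'n^'n \<Rightarrow> real^'n^'n \<Rightarrow> real^'n \<Rightarrow> real \<Rightarrow> nat \<Rightarrow> 'a \<Rightarrow> real^'n" where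
  "euler A C x0 h 0 = (\<lambda>\<omega>. x0)"
| "euler A C x0 h (Suc j) = (\<lambda>\<omega>. euler A C x0 h j \<omega> + h *\<^sub>R (A *v euler A C x0 h j \<omega>)
    + (W (real (Suc j) * h) \<omega> - W (real j * h) \<omega>) *\<^sub>R (C *v euler A C x0 h j \<omega>))"

text \<open>One step of the scheme, and one fine step of the difference of two schemes, has this
  form. Since \<open>U\<close> and \<open>V\<close> are known at time \<open>a\<close>, the cross
  term has mean zero and the squares add as in Pythagoras' theorem.\<close>

lemma increment_step:
  assumes ab: "0 \<le> a" "a \<le> b" and U: "sqint M U" "U \<in> borel_measurable (F a)"
    and V: "sqint M V" "V \<in> borel_measurable (F a)"
  shows "sqint M (\<lambda>\<omega>. U \<omega> + (W b \<omega> - W a \<omega>) *\<^sub>R V \<omega>)"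
    "(\<lambda>\<omega>. U \<omega> + (W b \<omega> - W a \<omega>) *\<^sub>R V \<omega>) \<in> borel_measurable (F b)"
    "expectation (\<lambda>\<omega>. (norm (U \<omega> + (W b \<omega> - W a \<omega>) *\<^sub>R V \<omega>))\<^sup>2)
      = expectation (\<lambda>\<omega>. (norm (U \<omega>))\<^sup>2) + (b - a) * expectation (\<lambda>\<omega>. (norm (V \<omega>))\<^sup>2)"
proof -
  note D = sqint_increment[OF ab V(2,1)]
  show "sqint M (\<lambda>\<omega>. U \<omega> + (W b \<omega> - W a \<omega>) *\<^sub>R V \<omega>)" by (rule sqint_add[OF U(1) D])
  have "U \<in> borel_measurable (F b)" "V \<in> borel_measurable (F b)" "W a \<in> borel_measurable (F b)" "W b \<in> borel_measurable (F b)"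
    using measurable_F_mono[OF ab(2) U(2)] measurable_F_mono[OF ab(2) V(2)] measurable_F_mono[OF ab(2) adapted[OF ab(1)]]
      adapted[of b] ab by auto
  then show "(\<lambda>\<omega>. U \<omega> + (W b \<omega> - W a \<omega>) *\<^sub>R V \<omega>) \<in> borel_measurable (F b)" by simp
  have "expectation (\<lambda>\<omega>. (norm (U \<omega> + (W b \<omega> - W a \<omega>) *\<^sub>R V \<omega>))\<^sup>2) = expectation (\<lambda>\<omega>. (norm (U \<omega>))\<^sup>2
      + 2 * (U \<omega> \<bullet> ((W b \<omega> - W a \<omega>) *\<^sub>R V \<omega>)) + ((W b \<omega> - W a \<omega>) *\<^sub>R V \<omega>) \<bullet> ((W b \<omega> - W a \<omega>) *\<^sub>R V \<omega>))"
    unfolding power2_norm_eq_inner by (simp add: inner_add_left inner_add_right inner_commute algebra_simps)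
  also have "\<dots> = expectation (\<lambda>\<omega>. (norm (U \<omega>))\<^sup>2) + 2 * expectation (\<lambda>\<omega>. U \<omega> \<bullet> ((W b \<omega> - W a \<omega>) *\<^sub>R V \<omega>))
      + expectation (\<lambda>\<omega>. ((W b \<omega> - W a \<omega>) *\<^sub>R V \<omega>) \<bullet> ((W b \<omega> - W a \<omega>) *\<^sub>R V \<omega>))"
    using sqint_integrable[OF U(1)] sqint_inner[OF U(1) D] sqint_inner[OF D D] by simp
  also have "expectation (\<lambda>\<omega>. U \<omega> \<bullet> ((W b \<omega> - W a \<omega>) *\<^sub>R V \<omega>)) = 0"
    by (rule increment_orthogonal[OF ab U V])
  also have "expectation (\<lambda>\<omega>. ((W b \<omega> - W a \<omega>) *\<^sub>R V \<omega>) \<bullet> ((W b \<omega> - W a \<omega>) *\<^sub>R V \<omega>))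
      = (b - a) * expectation (\<lambda>\<omega>. (norm (V \<omega>))\<^sup>2)"
    unfolding increments_inner[OF ab ab V V] using ab by (simp add: power2_norm_eq_inner)
  finally show "expectation (\<lambda>\<omega>. (norm (U \<omega> + (W b \<omega> - W a \<omega>) *\<^sub>R V \<omega>))\<^sup>2)
      = expectation (\<lambda>\<omega>. (norm (U \<omega>))\<^sup>2) + (b - a) * expectation (\<lambda>\<omega>. (norm (V \<omega>))\<^sup>2)" by simp
qed

lemma euler_sqint_measurable:
  assumes "0 \<le> h"
  shows "sqint M (euler A C x0 h j)" "euler A C x0 h j \<in> borel_measurable (F (real j * h))"
proof -
  have "sqint M (euler A C x0 h j) \<and> euler A C x0 h j \<in> borel_measurable (F (real j * h))"
  proof (induction j)
    case 0 then show ?case using sqint_const by simp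
  next
    case (Suc j)
    have o: "0 \<le> real j * h" "real j * h \<le> real (Suc j) * h" using assms by (auto simp: algebra_simps)
    let ?e = "euler A C x0 h j"
    have sq: "sqint M (\<lambda>\<omega>. ?e \<omega> + h *\<^sub>R (A *v ?e \<omega>))" "sqint M (\<lambda>\<omega>. C *v ?e \<omega>)"
      using Suc by (auto intro!: sqint_add sqint_scaleR sqint_mv)
    have me: "(\<lambda>\<omega>. ?e \<omega> + h *\<^sub>R (A *v ?e \<omega>)) \<in> borel_measurable (F (real j * h))"
      "(\<lambda>\<omega>. C *v ?e \<omega>) \<in> borel_measurable (F (real j * h))"
      using Suc by (auto intro!: measurable_mv borel_measurable_add borel_measurable_scaleR)
    show ?case
      using increment_step(1,2)[OF o sq(1) me(1) sq(2) me(2)] unfolding euler.simps by blast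
  qed
  then show "sqint M (euler A C x0 h j)" "euler A C x0 h j \<in> borel_measurable (F (real j * h))" by auto
qed

abbreviation msq :: "('a \<Rightarrow> 'b::euclidean_space) \<Rightarrow> real" where
  "msq U \<equiv> expectation (\<lambda>\<omega>. (norm (U \<omega>))\<^sup>2)"

text \<open>The drift gives \<open>(1 + h L)\<^sup>2\<close>, at most
  \<open>1 + 3 L\<^sup>2 h\<close> since \<open>L \<ge> 1\<close> and \<open>h \<le> 1\<close>; the
  orthogonal noise adds another \<open>L\<^sup>2 h\<close>.\<close>

lemma euler_growth:
  assumes L: "L \<ge> 1" "\<And>x. norm (A *v x) \<le> L * norm x" "\<And>x. norm (C *v x) \<le> L * norm x"
    and h: "0 < h" "h \<le> 1"
  shows "msq (euler A C x0 h (Suc j)) \<le> (1 + 4 * L\<^sup>2 * h) * msq (euler A C x0 h j)"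
proof -
  let ?e = "euler A C x0 h j"
  note e = euler_sqint_measurable[OF less_imp_le[OF h(1)], of A C x0 j]
  have o: "0 \<le> real j * h" "real j * h \<le> real (Suc j) * h" using h by (auto simp: algebra_simps)
  have sq: "sqint M (\<lambda>\<omega>. ?e \<omega> + h *\<^sub>R (A *v ?e \<omega>))" "sqint M (\<lambda>\<omega>. C *v ?e \<omega>)"
    using e(1) by (auto intro!: sqint_add sqint_scaleR sqint_mv)
  have me: "(\<lambda>\<omega>. ?e \<omega> + h *\<^sub>R (A *v ?e \<omega>)) \<in> borel_measurable (F (real j * h))"
      "(\<lambda>\<omega>. C *v ?e \<omega>) \<in> borel_measurable (F (real j * h))"
    using e(2) by (auto intro!: measurable_mv borel_measurable_add borel_measurable_scaleR)
  have 1: "msq (\<lambda>\<omega>. ?e \<omega> + h *\<^sub>R (A *v ?e \<omega>)) \<le> (1 + 3 * L\<^sup>2 * h) * msq ?e + 0 * msq ?e"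
  proof (rule integral_square_le[OF sq(1) e(1) e(1)])
    fix \<omega>
    have "norm (?e \<omega> + h *\<^sub>R (A *v ?e \<omega>)) \<le> norm (?e \<omega>) + h * (L * norm (?e \<omega>))"
      using h L(2) by (intro norm_triangle_le add_left_mono) (simp add: mult_left_mono)
    also have "\<dots> = (1 + h * L) * norm (?e \<omega>)" by (simp add: algebra_simps)
    finally have "(norm (?e \<omega> + h *\<^sub>R (A *v ?e \<omega>)))\<^sup>2 \<le> ((1 + h * L) * norm (?e \<omega>))\<^sup>2"
      by (rule power_mono) simp
    also have "\<dots> = (1 + h * L)\<^sup>2 * (norm (?e \<omega>))\<^sup>2" by (simp add: power_mult_distrib)
    also have "(1 + h * L)\<^sup>2 \<le> 1 + 3 * L\<^sup>2 * h"
    proof -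
      have "h * L \<le> h * L\<^sup>2" using h L(1) by (simp add: power2_eq_square)
      moreover have "h\<^sup>2 * L\<^sup>2 \<le> h * L\<^sup>2" using h by (intro mult_right_mono) (auto simp: power2_eq_square)
      ultimately show ?thesis by (simp add: power2_eq_square algebra_simps)
    qed
    finally show "(norm (?e \<omega> + h *\<^sub>R (A *v ?e \<omega>)))\<^sup>2 \<le> (1 + 3 * L\<^sup>2 * h) * (norm (?e \<omega>))\<^sup>2 + 0 * (norm (?e \<omega>))\<^sup>2"
      by (simp add: mult_right_mono)
  qed
  have 2: "msq (\<lambda>\<omega>. C *v ?e \<omega>) \<le> L\<^sup>2 * msq ?e + 0 * msq ?e"
  proof (rule integral_square_le[OF sq(2) e(1) e(1)])
    fix \<omega>
    show "(norm (C *v ?e \<omega>))\<^sup>2 \<le> L\<^sup>2 * (norm (?e \<omega>))\<^sup>2 + 0 * (norm (?e \<omega>))\<^sup>2"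
      using power_mono[OF L(3), of "?e \<omega>" 2] by (simp add: power_mult_distrib)
  qed
  have "msq (euler A C x0 h (Suc j)) = msq (\<lambda>\<omega>. ?e \<omega> + h *\<^sub>R (A *v ?e \<omega>)) + h * msq (\<lambda>\<omega>. C *v ?e \<omega>)"
    using increment_step(3)[OF o sq(1) me(1) sq(2) me(2)] by (simp add: algebra_simps)
  also have "\<dots> \<le> (1 + 3 * L\<^sup>2 * h) * msq ?e + h * (L\<^sup>2 * msq ?e)"
    using 1 2 h by (intro add_mono mult_left_mono) auto
  also have "\<dots> = (1 + 4 * L\<^sup>2 * h) * msq ?e" by (simp add: algebra_simps)
  finally show ?thesis .
qed

text \<open>Serves for full cells and for the last cell, cut off at the final time. The noise sets
  the order \<open>b - a\<close>; the drift is of second order and is reduced to it by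
  \<open>b - a \<le> 1\<close>.\<close>

lemma partial_step_bound:
  fixes A C :: "real^'n^'n" and e :: "'a \<Rightarrow> real^'n"
  assumes L: "L \<ge> 1" "\<And>x. norm (A *v x) \<le> L * norm x" "\<And>x. norm (C *v x) \<le> L * norm x"
    and ab: "0 \<le> a" "a \<le> b" "b - a \<le> 1" and e: "sqint M e" "e \<in> borel_measurable (F a)"
  shows "sqint M (\<lambda>\<omega>. (b - a) *\<^sub>R (A *v e \<omega>) + (W b \<omega> - W a \<omega>) *\<^sub>R (C *v e \<omega>))"
    and "msq (\<lambda>\<omega>. (b - a) *\<^sub>R (A *v e \<omega>) + (W b \<omega> - W a \<omega>) *\<^sub>R (C *v e \<omega>)) \<le> 2 * L\<^sup>2 * (b - a) * msq e"
proof -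
  have sq: "sqint M (\<lambda>\<omega>. (b - a) *\<^sub>R (A *v e \<omega>))" "sqint M (\<lambda>\<omega>. C *v e \<omega>)"
    by (intro sqint_scaleR sqint_mv e(1))+
  have me: "(\<lambda>\<omega>. (b - a) *\<^sub>R (A *v e \<omega>)) \<in> borel_measurable (F a)" "(\<lambda>\<omega>. C *v e \<omega>) \<in> borel_measurable (F a)"
    using e(2) by (auto intro!: measurable_mv borel_measurable_scaleR)
  note st = increment_step[OF ab(1,2) sq(1) me(1) sq(2) me(2)]
  show "sqint M (\<lambda>\<omega>. (b - a) *\<^sub>R (A *v e \<omega>) + (W b \<omega> - W a \<omega>) *\<^sub>R (C *v e \<omega>))" by (rule st(1))
  have 1: "msq (\<lambda>\<omega>. (b - a) *\<^sub>R (A *v e \<omega>)) \<le> ((b - a) * L\<^sup>2) * msq e + 0 * msq e"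
  proof (rule integral_square_le[OF sq(1) e(1) e(1)])
    fix \<omega>
    have "(norm ((b - a) *\<^sub>R (A *v e \<omega>)))\<^sup>2 = (b - a)\<^sup>2 * (norm (A *v e \<omega>))\<^sup>2" by (simp add: power_mult_distrib)
    also have "\<dots> \<le> (b - a) * (L * norm (e \<omega>))\<^sup>2"
      using ab by (intro mult_mono power_mono L(2)) (auto simp: power2_eq_square mult_left_le)
    finally show "(norm ((b - a) *\<^sub>R (A *v e \<omega>)))\<^sup>2 \<le> ((b - a) * L\<^sup>2) * (norm (e \<omega>))\<^sup>2 + 0 * (norm (e \<omega>))\<^sup>2"
      by (simp add: power_mult_distrib mult.assoc)
  qed
  have 2: "msq (\<lambda>\<omega>. C *v e \<omega>) \<le> L\<^sup>2 * msq e + 0 * msq e"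
  proof (rule integral_square_le[OF sq(2) e(1) e(1)])
    fix \<omega>
    show "(norm (C *v e \<omega>))\<^sup>2 \<le> L\<^sup>2 * (norm (e \<omega>))\<^sup>2 + 0 * (norm (e \<omega>))\<^sup>2"
      using power_mono[OF L(3), of "e \<omega>" 2] by (simp add: power_mult_distrib)
  qed
  have "msq (\<lambda>\<omega>. (b - a) *\<^sub>R (A *v e \<omega>)) + (b - a) * msq (\<lambda>\<omega>. C *v e \<omega>)
      \<le> ((b - a) * L\<^sup>2) * msq e + (b - a) * (L\<^sup>2 * msq e)"
    using 1 2 ab by (intro add_mono mult_left_mono) auto
  then show "msq (\<lambda>\<omega>. (b - a) *\<^sub>R (A *v e \<omega>) + (W b \<omega> - W a \<omega>) *\<^sub>R (C *v e \<omega>)) \<le> 2 * L\<^sup>2 * (b - a) * msq e"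
    unfolding st(3) by (simp add: algebra_simps)
qed

text \<open>One coarse step against two fine ones; \<open>U1\<close>, \<open>V1\<close>, \<open>V2\<close> are the coefficients of \<open>1\<close> and of the two
  Wiener increments, which are orthogonal.\<close>

lemma euler_refine_step:
  assumes L: "L \<ge> 1" "\<And>x. norm (A *v x) \<le> L * norm x" "\<And>x. norm (C *v x) \<le> L * norm x"
    and g: "0 < g" "g \<le> 1"
  shows "msq (\<lambda>\<omega>. euler A C x0 (2 * g) (Suc j) \<omega> - euler A C x0 g (2 * Suc j) \<omega>)
    \<le> (1 + 21 * L\<^sup>2 * g) * msq (\<lambda>\<omega>. euler A C x0 (2 * g) j \<omega> - euler A C x0 g (2 * j) \<omega>)
      + 8 * L^4 * g\<^sup>2 * msq (euler A C x0 g (2 * j))"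
proof -
  define y x where "y = euler A C x0 (2 * g) j" and "x = euler A C x0 g (2 * j)"
  define a b c where "a = real j * (2 * g)" and "b = a + g" and "c = a + 2 * g"
  define e where "e = (\<lambda>\<omega>. y \<omega> - x \<omega>)"
  define r where "r = (\<lambda>\<omega>. (b - a) *\<^sub>R (A *v x \<omega>) + (W b \<omega> - W a \<omega>) *\<^sub>R (C *v x \<omega>))"
  have times: "real (2 * j) * g = a" "real (Suc (2 * j)) * g = b" "real (Suc (Suc (2 * j))) * g = c" "real (Suc j) * (2 * g) = c"
    by (simp_all add: a_def b_def c_def algebra_simps)
  have abc: "0 \<le> a" "a \<le> b" "b \<le> c" "0 \<le> b" "b - a = g" "c - b = g" using g by (simp_all add: a_def b_def c_def)
  have y: "sqint M y" "y \<in> borel_measurable (F a)"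
    using euler_sqint_measurable[of "2 * g" A C x0 j] g by (auto simp: y_def a_def)
  have x: "sqint M x" "x \<in> borel_measurable (F a)"
    using euler_sqint_measurable[of g A C x0 "2 * j"] g by (auto simp: x_def times(1)[symmetric] simp del: of_nat_mult)
  have e: "sqint M e" "e \<in> borel_measurable (F a)"
    unfolding e_def using y x by (auto intro: sqint_diff)
  have "b - a \<le> 1" using abc(5) g by simp
  note rb = partial_step_bound[OF L abc(1,2) this x]
  have r: "sqint M r" "msq r \<le> 2 * L\<^sup>2 * g * msq x"
    unfolding r_def abc(5)[symmetric] by (fact rb(1)) (fact rb(2))
  \<comment> \<open>Besides the linear action on the error \<open>e\<close>, the corrections come
    from the second fine step acting on the first: its drift sees the first drift and the first
    noise (\<open>U1\<close>, \<open>V1\<close>), and its noise sees the whole increment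
    \<open>r\<close> (\<open>V2\<close>).\<close>
  define U1 where "U1 = (\<lambda>\<omega>. e \<omega> + (2 * g) *\<^sub>R (A *v e \<omega>) - g\<^sup>2 *\<^sub>R (A *v (A *v x \<omega>)))"
  define V1 where "V1 = (\<lambda>\<omega>. C *v e \<omega> - g *\<^sub>R (A *v (C *v x \<omega>)))"
  define V2 where "V2 = (\<lambda>\<omega>. C *v (e \<omega> - r \<omega>))"
  have sq: "sqint M U1" "sqint M V1" "sqint M V2"
    unfolding U1_def V1_def V2_def by (intro sqint_add sqint_diff sqint_scaleR sqint_mv e x r)+
  have me: "U1 \<in> borel_measurable (F a)" "V1 \<in> borel_measurable (F a)"
    unfolding U1_def V1_def
    by (intro borel_measurable_add borel_measurable_diff borel_measurable_scaleR borel_measurable_const measurable_mv e x)+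
  note s1 = increment_step[OF abc(1,2) sq(1) me(1) sq(2) me(2)]
  have xb: "x \<in> borel_measurable (F b)" "e \<in> borel_measurable (F b)"
    using measurable_F_mono[OF abc(2)] x e by auto
  have "W a \<in> borel_measurable (F b)" "W b \<in> borel_measurable (F b)"
    using measurable_F_mono[OF abc(2) adapted[OF abc(1)]] adapted[OF abc(4)] by auto
  then have rF: "r \<in> borel_measurable (F b)"
    unfolding r_def using xb
    by (intro borel_measurable_add borel_measurable_diff borel_measurable_scaleR borel_measurable_const measurable_mv)
  have V2F: "V2 \<in> borel_measurable (F b)"
    unfolding V2_def by (intro measurable_mv borel_measurable_diff xb rF)
  note s2 = increment_step(3)[OF abc(4,3) s1(1,2) sq(3) V2F]
  have pt: "euler A C x0 (2 * g) (Suc j) \<omega> - euler A C x0 g (2 * Suc j) \<omega>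
    = (U1 \<omega> + (W b \<omega> - W a \<omega>) *\<^sub>R V1 \<omega>) + (W c \<omega> - W b \<omega>) *\<^sub>R V2 \<omega>" for \<omega>
  proof -
    have 1: "euler A C x0 (2 * g) (Suc j) \<omega> = y \<omega> + (2 * g) *\<^sub>R (A *v y \<omega>) + (W c \<omega> - W a \<omega>) *\<^sub>R (C *v y \<omega>)"
      unfolding euler.simps times(4) by (simp add: y_def a_def)
    have x': "euler A C x0 g (Suc (2 * j)) \<omega> = x \<omega> + r \<omega>"
      unfolding euler.simps times(1,2) r_def abc(5) by (simp add: x_def)
    have 2: "euler A C x0 g (2 * Suc j) \<omega> = (x \<omega> + r \<omega>) + g *\<^sub>R (A *v (x \<omega> + r \<omega>)) + (W c \<omega> - W b \<omega>) *\<^sub>R (C *v (x \<omega> + r \<omega>))"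
    proof -
      have s: "2 * Suc j = Suc (Suc (2 * j))" by simp
      show ?thesis unfolding s euler.simps(2)[of A C x0 g "Suc (2 * j)"] x' times(2,3) ..
    qed
    have y': "y \<omega> = e \<omega> + x \<omega>" by (simp add: e_def)
    show "euler A C x0 (2 * g) (Suc j) \<omega> - euler A C x0 g (2 * Suc j) \<omega>
      = (U1 \<omega> + (W b \<omega> - W a \<omega>) *\<^sub>R V1 \<omega>) + (W c \<omega> - W b \<omega>) *\<^sub>R V2 \<omega>"
      unfolding 1 2 y' U1_def V1_def V2_def
      by (simp add: r_def abc(5) matrix_vector_right_distrib matrix_vector_mult_diff_distrib matrix_vector_mult_scaleR
          vec_eq_iff power2_eq_square algebra_simps)
  qed
  have eq: "msq (\<lambda>\<omega>. euler A C x0 (2 * g) (Suc j) \<omega> - euler A C x0 g (2 * Suc j) \<omega>)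
      = msq U1 + g * msq V1 + g * msq V2"
    unfolding pt s2 s1(3) abc(5,6) ..
  have b1: "msq U1 \<le> (1 + 17 * L\<^sup>2 * g) * msq e + (2 * L^4 * g\<^sup>2) * msq x"
  proof (rule integral_square_le[OF sq(1) e(1) x(1)])
    fix \<omega>
    let ?n = "norm (e \<omega>)" and ?m = "norm (x \<omega>)"
    have gL: "0 \<le> g * L" "g * L \<le> g * L\<^sup>2" "g\<^sup>2 * L\<^sup>2 \<le> g * L\<^sup>2"
      using g L(1) by (auto simp: power2_eq_square)
    have "norm (U1 \<omega>) \<le> norm (e \<omega> + (2 * g) *\<^sub>R (A *v e \<omega>)) + norm (g\<^sup>2 *\<^sub>R (A *v (A *v x \<omega>)))"
      unfolding U1_def by (rule norm_triangle_ineq4)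
    also have "\<dots> \<le> (1 + 2 * g * L) * ?n + g\<^sup>2 * L\<^sup>2 * ?m"
    proof (rule add_mono)
      have "norm (e \<omega> + (2 * g) *\<^sub>R (A *v e \<omega>)) \<le> ?n + 2 * g * (L * ?n)"
        using g L(2) by (intro norm_triangle_le add_left_mono) (simp add: mult_left_mono)
      then show "norm (e \<omega> + (2 * g) *\<^sub>R (A *v e \<omega>)) \<le> (1 + 2 * g * L) * ?n" by (simp add: algebra_simps)
      have "norm (A *v (A *v x \<omega>)) \<le> L * (L * ?m)"
        using L(1) by (intro order_trans[OF L(2)] mult_left_mono L(2)) auto
      then show "norm (g\<^sup>2 *\<^sub>R (A *v (A *v x \<omega>))) \<le> g\<^sup>2 * L\<^sup>2 * ?m"
        by (simp add: power2_eq_square mult.assoc mult_left_mono g(1) less_imp_le)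
    qed
    finally have "(norm (U1 \<omega>))\<^sup>2 \<le> ((1 + 2 * g * L) * ?n + g\<^sup>2 * L\<^sup>2 * ?m)\<^sup>2"
      by (rule power_mono) simp
    \<comment> \<open>The weights \<open>1 + g\<close> and \<open>1 + 1/g\<close> keep the factor of
      the old error at 1 plus order \<open>g\<close>, as iteration over order \<open>1/g\<close>
      steps demands; a fixed factor 2 would explode. The price \<open>1/g\<close> is harmless
      against \<open>g^4\<close>.\<close>
    also have "\<dots> \<le> (1 + g) * ((1 + 2 * g * L) * ?n)\<^sup>2 + (1 + 1 / g) * (g\<^sup>2 * L\<^sup>2 * ?m)\<^sup>2"
    proof -
      have "0 \<le> (g * p - q)\<^sup>2 / g" for p q :: real using g by simp
      moreover have "(g * p - q)\<^sup>2 / g = (1 + g) * p\<^sup>2 + (1 + 1 / g) * q\<^sup>2 - (p + q)\<^sup>2" for p q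
        using g by (simp add: power2_eq_square field_simps)
      ultimately show ?thesis by (metis diff_ge_0_iff_ge)
    qed
    also have "\<dots> \<le> (1 + 17 * L\<^sup>2 * g) * ?n\<^sup>2 + (2 * L^4 * g\<^sup>2) * ?m\<^sup>2"
    proof (rule add_mono)
      have "(1 + 2 * g * L)\<^sup>2 = 1 + 4 * (g * L) + 4 * (g\<^sup>2 * L\<^sup>2)" by (simp add: power2_eq_square algebra_simps)
      also have "\<dots> \<le> 1 + 8 * (g * L\<^sup>2)" using gL by simp
      finally have "(1 + g) * (1 + 2 * g * L)\<^sup>2 \<le> (1 + g) * (1 + 8 * (g * L\<^sup>2))" using g by (intro mult_left_mono) auto
      also have "\<dots> = 1 + g + 8 * (g * L\<^sup>2) + 8 * (g\<^sup>2 * L\<^sup>2)" by (simp add: power2_eq_square algebra_simps)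
      also have "\<dots> \<le> 1 + 17 * L\<^sup>2 * g"
      proof -
        have "g \<le> g * L\<^sup>2" using g L(1) by simp
        then show ?thesis using gL(3) by (simp add: algebra_simps)
      qed
      finally show "(1 + g) * ((1 + 2 * g * L) * ?n)\<^sup>2 \<le> (1 + 17 * L\<^sup>2 * g) * ?n\<^sup>2"
        unfolding power_mult_distrib mult.assoc[symmetric] by (rule mult_right_mono) simp
      have "(1 + 1 / g) * (g\<^sup>2)\<^sup>2 = g^4 + g^3" using g by (simp add: power2_eq_square power3_eq_cube power4_eq_xxxx field_simps)
      also have "\<dots> \<le> g\<^sup>2 + g\<^sup>2" using g by (intro add_mono power_decreasing) auto
      finally have "(1 + 1 / g) * (g\<^sup>2)\<^sup>2 * (L^4 * ?m\<^sup>2) \<le> (2 * g\<^sup>2) * (L^4 * ?m\<^sup>2)" by (intro mult_right_mono) auto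
      then show "(1 + 1 / g) * (g\<^sup>2 * L\<^sup>2 * ?m)\<^sup>2 \<le> (2 * L^4 * g\<^sup>2) * ?m\<^sup>2"
        by (simp add: power_mult_distrib power2_eq_square power4_eq_xxxx mult_ac)
    qed
    finally show "(norm (U1 \<omega>))\<^sup>2 \<le> (1 + 17 * L\<^sup>2 * g) * ?n\<^sup>2 + (2 * L^4 * g\<^sup>2) * ?m\<^sup>2" .
  qed
  have sqd: "(norm (u - v))\<^sup>2 \<le> 2 * (norm u)\<^sup>2 + 2 * (norm v)\<^sup>2" for u v :: "real^'n"
    using norm_add_square_le[of u "- v"] by simp
  have b2: "msq V1 \<le> (2 * L\<^sup>2) * msq e + (2 * L^4 * g) * msq x"
  proof (rule integral_square_le[OF sq(2) e(1) x(1)])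
    fix \<omega>
    have "(norm (V1 \<omega>))\<^sup>2 \<le> 2 * (norm (C *v e \<omega>))\<^sup>2 + 2 * (norm (g *\<^sub>R (A *v (C *v x \<omega>))))\<^sup>2"
      unfolding V1_def by (rule sqd)
    also have "\<dots> \<le> 2 * (L * norm (e \<omega>))\<^sup>2 + 2 * (g * (L * (L * norm (x \<omega>))))\<^sup>2"
    proof (intro add_mono mult_left_mono power_mono L(3))
      have "norm (A *v (C *v x \<omega>)) \<le> L * (L * norm (x \<omega>))"
        using L(1) by (intro order_trans[OF L(2)] mult_left_mono L(3)) auto
      then show "norm (g *\<^sub>R (A *v (C *v x \<omega>))) \<le> g * (L * (L * norm (x \<omega>)))"
        using g by (simp add: mult_left_mono)
    qed auto
    also have "\<dots> = 2 * L\<^sup>2 * (norm (e \<omega>))\<^sup>2 + 2 * L^4 * g\<^sup>2 * (norm (x \<omega>))\<^sup>2"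
      by (simp add: power_mult_distrib power2_eq_square power4_eq_xxxx mult_ac)
    also have "\<dots> \<le> 2 * L\<^sup>2 * (norm (e \<omega>))\<^sup>2 + 2 * L^4 * g * (norm (x \<omega>))\<^sup>2"
      using g by (intro add_left_mono mult_right_mono mult_left_mono) (auto simp: power2_eq_square mult_left_le)
    finally show "(norm (V1 \<omega>))\<^sup>2 \<le> (2 * L\<^sup>2) * (norm (e \<omega>))\<^sup>2 + (2 * L^4 * g) * (norm (x \<omega>))\<^sup>2" .
  qed
  have b3: "msq V2 \<le> (2 * L\<^sup>2) * msq e + (2 * L\<^sup>2) * msq r"
  proof (rule integral_square_le[OF sq(3) e(1) r(1)])
    fix \<omega>
    have "(norm (V2 \<omega>))\<^sup>2 \<le> (L * norm (e \<omega> - r \<omega>))\<^sup>2"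
      unfolding V2_def by (intro power_mono L(3)) auto
    also have "\<dots> \<le> L\<^sup>2 * (2 * (norm (e \<omega>))\<^sup>2 + 2 * (norm (r \<omega>))\<^sup>2)"
      unfolding power_mult_distrib by (intro mult_left_mono sqd) auto
    finally show "(norm (V2 \<omega>))\<^sup>2 \<le> (2 * L\<^sup>2) * (norm (e \<omega>))\<^sup>2 + (2 * L\<^sup>2) * (norm (r \<omega>))\<^sup>2"
      by (simp add: algebra_simps)
  qed
  have "(2 * L\<^sup>2) * msq r \<le> (2 * L\<^sup>2) * (2 * L\<^sup>2 * g * msq x)" by (intro mult_left_mono r(2)) auto
  then have b3': "msq V2 \<le> (2 * L\<^sup>2) * msq e + 4 * L^4 * g * msq x"
    using b3 by (simp add: power2_eq_square power4_eq_xxxx mult_ac)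
  \<comment> \<open>The constants are \<open>21 = 17 + 2 + 2\<close> for the propagated error and
    \<open>8 = 2 + 2 + 4\<close> for the new one. The local error is of order
    \<open>g\<^sup>2\<close>.\<close>
  have "msq U1 + g * msq V1 + g * msq V2
      \<le> ((1 + 17 * L\<^sup>2 * g) * msq e + (2 * L^4 * g\<^sup>2) * msq x) + g * ((2 * L\<^sup>2) * msq e + (2 * L^4 * g) * msq x)
        + g * ((2 * L\<^sup>2) * msq e + 4 * L^4 * g * msq x)"
    using g by (intro add_mono mult_left_mono b1 b2 b3') auto
  also have "\<dots> = (1 + 21 * L\<^sup>2 * g) * msq e + 8 * L^4 * g\<^sup>2 * msq x"
    by (simp add: power2_eq_square algebra_simps)
  finally show ?thesis unfolding eq e_def y_def x_def .
qed

end

text \<open>Each of the \<open>j\<close> inputs \<open>b\<close> is charged with the full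
  amplification \<open>(1 + a) ^ j\<close>, a crude bound that suffices over a bounded time
  interval.\<close>

lemma discrete_gronwall:
  fixes d :: "nat \<Rightarrow> real"
  assumes "d 0 = 0" and step: "\<And>j. j < n \<Longrightarrow> d (Suc j) \<le> (1 + a) * d j + b" and ab: "0 \<le> a" "0 \<le> b"
    and "j \<le> n"
  shows "d j \<le> real j * b * (1 + a) ^ j"
  using \<open>j \<le> n\<close>
proof (induction j)
  case 0 then show ?case using assms by simp
next
  case (Suc j)
  have "d (Suc j) \<le> (1 + a) * d j + b" using step Suc.prems by simp
  also have "\<dots> \<le> (1 + a) * (real j * b * (1 + a) ^ j) + b * (1 + a) ^ Suc j"
  proof (rule add_mono)
    show "(1 + a) * d j \<le> (1 + a) * (real j * b * (1 + a) ^ j)" using Suc ab by (intro mult_left_mono) auto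
    have "1 \<le> (1 + a) ^ Suc j" using ab by (intro one_le_power) simp
    from mult_left_mono[OF this ab(2)] show "b \<le> b * (1 + a) ^ Suc j" by simp
  qed
  also have "\<dots> = real (Suc j) * b * (1 + a) ^ Suc j" by (simp add: algebra_simps)
  finally show ?case .
qed

lemma one_plus_power_le_exp: "0 \<le> a \<Longrightarrow> (1 + a) ^ j \<le> exp (real j * a)"
  unfolding exp_of_nat_mult by (intro power_mono) auto

lemma cell_mono: "0 < h \<Longrightarrow> s \<le> t \<Longrightarrow> cell h s \<le> cell h t"
  unfolding cell_def by (intro diff_le_mono nat_mono ceiling_mono divide_right_mono) auto

section \<open>Convergence of the dyadic Euler schemes\<close>

context wiener_process
begin

lemma euler_bound:
  assumes L: "L \<ge> 1" "\<And>x. norm (A *v x) \<le> L * norm x" "\<And>x. norm (C *v x) \<le> L * norm x"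
    and h: "0 < h" "h \<le> 1" and j: "real j * h \<le> T"
  shows "msq (euler A C x0 h j) \<le> exp (4 * L\<^sup>2 * T) * (norm x0)\<^sup>2"
proof -
  have a: "0 \<le> 4 * L\<^sup>2 * h" using h by simp
  have "msq (euler A C x0 h j) \<le> (1 + 4 * L\<^sup>2 * h) ^ j * (norm x0)\<^sup>2"
  proof (induction j)
    case 0 then show ?case by (simp add: prob_space)
  next
    case (Suc j)
    show ?case
      using order_trans[OF euler_growth[OF L h] mult_left_mono[OF Suc, of "1 + 4 * L\<^sup>2 * h"]] a
      by (simp add: mult.assoc)
  qed
  also have "\<dots> \<le> exp (real j * (4 * L\<^sup>2 * h)) * (norm x0)\<^sup>2"
    by (intro mult_right_mono one_plus_power_le_exp a) simp
  also have "\<dots> \<le> exp (4 * L\<^sup>2 * T) * (norm x0)\<^sup>2"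
  proof (intro mult_right_mono)
    have "4 * L\<^sup>2 * (real j * h) \<le> 4 * L\<^sup>2 * T" using j by (intro mult_left_mono) auto
    then show "exp (real j * (4 * L\<^sup>2 * h)) \<le> exp (4 * L\<^sup>2 * T)" by (simp add: mult_ac)
  qed simp
  finally show ?thesis .
qed

text \<open>Order \<open>1/g\<close> steps with local errors of order \<open>g\<^sup>2\<close>
  accumulate, by Gronwall, to a mean square distance of order \<open>g\<close>.\<close>

lemma euler_refine:
  fixes A C :: "real^'n^'n" and x0 :: "real^'n"
  assumes L: "L \<ge> 1" "\<And>x. norm (A *v x) \<le> L * norm x" "\<And>x. norm (C *v x) \<le> L * norm x"
    and g: "0 < g" "g \<le> 1" and j: "real j * (2 * g) \<le> T"
  defines "R \<equiv> exp (4 * L\<^sup>2 * T) * (norm x0)\<^sup>2"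
  shows "msq (\<lambda>\<omega>. euler A C x0 (2 * g) j \<omega> - euler A C x0 g (2 * j) \<omega>) \<le> T * (8 * L^4 * R) * exp (21 * L\<^sup>2 * T) * g"
proof -
  define d where "d j = msq (\<lambda>\<omega>. euler A C x0 (2 * g) j \<omega> - euler A C x0 g (2 * j) \<omega>)" for j
  have R: "0 \<le> R" by (simp add: R_def)
  have jg0: "0 \<le> real j * g" using g by simp
  then have jg: "real j * g \<le> T" and T: "0 \<le> T" using j by linarith+
  have a: "0 \<le> 21 * L\<^sup>2 * g" and b: "0 \<le> 8 * L^4 * g\<^sup>2 * R" using g R by simp_all
  have "d j \<le> real j * (8 * L^4 * g\<^sup>2 * R) * (1 + 21 * L\<^sup>2 * g) ^ j"
  proof (rule discrete_gronwall[where n = j, OF _ _ a b order_refl])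
    show "d 0 = 0" by (simp add: d_def)
    fix i assume i: "i < j"
    have "real (2 * i) * g \<le> real j * (2 * g)" using i g by (simp add: mult.assoc mult_right_mono)
    then have "msq (euler A C x0 g (2 * i)) \<le> R" unfolding R_def using j by (intro euler_bound[OF L g]) simp
    then have "8 * L^4 * g\<^sup>2 * msq (euler A C x0 g (2 * i)) \<le> 8 * L^4 * g\<^sup>2 * R" by (intro mult_left_mono) auto
    then show "d (Suc i) \<le> (1 + 21 * L\<^sup>2 * g) * d i + 8 * L^4 * g\<^sup>2 * R"
      unfolding d_def using euler_refine_step[OF L g, of x0 i] by linarith
  qed
  also have "\<dots> = (real j * g) * (8 * L^4 * R) * g * (1 + 21 * L\<^sup>2 * g) ^ j" by (simp add: power2_eq_square mult_ac)
  also have "\<dots> \<le> T * (8 * L^4 * R) * g * exp (21 * L\<^sup>2 * T)"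
  proof (rule mult_mono)
    show "real j * g * (8 * L^4 * R) * g \<le> T * (8 * L^4 * R) * g"
      using jg R g by (intro mult_right_mono) auto
    have "(1 + 21 * L\<^sup>2 * g) ^ j \<le> exp (real j * (21 * L\<^sup>2 * g))" by (rule one_plus_power_le_exp[OF a])
    also have "21 * L\<^sup>2 * (real j * g) \<le> 21 * L\<^sup>2 * T" using jg by (intro mult_left_mono) auto
    then have "exp (real j * (21 * L\<^sup>2 * g)) \<le> exp (21 * L\<^sup>2 * T)" by (simp add: mult_ac)
    finally show "(1 + 21 * L\<^sup>2 * g) ^ j \<le> exp (21 * L\<^sup>2 * T)" .
  qed (use T R g a in auto)
  finally show ?thesis unfolding d_def by (simp add: mult_ac)
qed

text \<open>Constant on each cell, with the value reached at its left end: except at time 0 it is an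
  elementary process on the dyadic grid, and its value is known when the cell begins.\<close>

definition euler_process :: "real^'n^'n \<Rightarrow> real^'n^'n \<Rightarrow> real^'n \<Rightarrow> nat \<Rightarrow> real \<Rightarrow> 'a \<Rightarrow> real^'n" where
  "euler_process A C x0 k s = euler A C x0 ((1/2)^k) (cell ((1/2)^k) s)"

lemma sqint_euler_process: "sqint M (euler_process A C x0 k s)"
  unfolding euler_process_def by (rule euler_sqint_measurable) simp

text \<open>In the left half of a coarse cell both processes are compared at the same grid time,
  where \<open>euler_refine\<close> applies. In the right half the fine process has made one more
  step, which is itself of mean square order \<open>g\<close>.\<close>

lemma euler_process_increment:
  fixes A C :: "real^'n^'n"
  assumes T: "0 \<le> T"
  obtains K where "K \<ge> 0" "\<And>k s. 0 \<le> s \<Longrightarrow> s \<le> T \<Longrightarrow>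
    msq (\<lambda>\<omega>. euler_process A C x0 (Suc k) s \<omega> - euler_process A C x0 k s \<omega>) \<le> K * (1/2)^k"
proof -
  obtain L where L: "L \<ge> 1" "\<And>x. norm (A *v x) \<le> L * norm x" "\<And>x. norm (C *v x) \<le> L * norm x"
    by (rule common_operator_bound[of A C]) iprover
  define R where "R = exp (4 * L\<^sup>2 * T) * (norm x0)\<^sup>2"
  define K1 where "K1 = T * (8 * L^4 * R) * exp (21 * L\<^sup>2 * T)"
  define K where "K = 4 * L\<^sup>2 * R + 2 * K1"
  have R: "0 \<le> R" by (simp add: R_def)
  have K1: "0 \<le> K1" using R T by (simp add: K1_def)
  have K: "0 \<le> K" using R K1 by (simp add: K_def)
  show ?thesis
  proof (rule that[OF K])
    fix k s assume s: "0 \<le> s" "s \<le> T"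
    define g :: real where "g = (1/2)^Suc k"
    have g: "0 < g" "g \<le> 1" unfolding g_def using power_le_one[of "1/2::real" "Suc k"] by simp_all
    have gk: "2 * g = (1/2)^k" by (simp add: g_def)
    define j where "j = cell (2 * g) s"
    have jT: "real j * (2 * g) \<le> T" using cell_bounds(1)[of "2 * g" s] g s unfolding j_def by linarith
    let ?y = "euler A C x0 (2 * g) j" and ?x = "euler A C x0 g (2 * j)" and ?x' = "euler A C x0 g (Suc (2 * j))"
    have sq: "sqint M ?y" "sqint M ?x" "sqint M ?x'" by (rule euler_sqint_measurable(1); use g in linarith)+
    have d: "msq (\<lambda>\<omega>. ?y \<omega> - ?x \<omega>) \<le> K1 * g"
      unfolding K1_def R_def by (rule euler_refine[OF L g jT])
    have xx: "(\<integral>\<omega>. (norm (?x \<omega> - ?y \<omega>))\<^sup>2 \<partial>M) \<le> K1 * g" using d by (simp add: norm_minus_commute)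
    have odd: "msq (\<lambda>\<omega>. ?x' \<omega> - ?y \<omega>) \<le> (4 * L\<^sup>2 * R + 2 * K1) * g"
    proof -
      have a: "0 \<le> real (2 * j) * g" "real (2 * j) * g \<le> real (Suc (2 * j)) * g"
        "real (Suc (2 * j)) * g - real (2 * j) * g = g"
        using g by (auto simp: algebra_simps)
      have a1: "real (Suc (2 * j)) * g - real (2 * j) * g \<le> 1" using a(3) g by simp
      note e = euler_sqint_measurable[OF less_imp_le[OF g(1)], of A C x0 "2 * j"]
      note pb = partial_step_bound[OF L a(1,2) a1 e, unfolded a(3)]
      have x': "?x' \<omega> = ?x \<omega> + (g *\<^sub>R (A *v ?x \<omega>) + (W (real (Suc (2 * j)) * g) \<omega> - W (real (2 * j) * g) \<omega>) *\<^sub>R (C *v ?x \<omega>))" for \<omega>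
        unfolding euler.simps(2) by (simp only: add.assoc)
      have "msq (\<lambda>\<omega>. ?x' \<omega> - ?y \<omega>) = msq (\<lambda>\<omega>. (g *\<^sub>R (A *v ?x \<omega>) + (W (real (Suc (2 * j)) * g) \<omega> - W (real (2 * j) * g) \<omega>) *\<^sub>R (C *v ?x \<omega>)) + (?x \<omega> - ?y \<omega>))"
      proof -
        have "u + v - w = v + (u - w)" for u v w :: "real^'n" by simp
        then show ?thesis unfolding x' by (simp only:)
      qed
      also have "\<dots> \<le> 2 * msq (\<lambda>\<omega>. g *\<^sub>R (A *v ?x \<omega>) + (W (real (Suc (2 * j)) * g) \<omega> - W (real (2 * j) * g) \<omega>) *\<^sub>R (C *v ?x \<omega>))
          + 2 * msq (\<lambda>\<omega>. ?x \<omega> - ?y \<omega>)"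
        by (rule integral_norm_add_square_le[OF pb(1) sqint_diff[OF sq(2,1)]])
      also have "\<dots> \<le> 2 * (2 * L\<^sup>2 * g * R) + 2 * (K1 * g)"
      proof (intro add_mono mult_left_mono xx)
        have "real (2 * j) * g \<le> T" using jT by (simp add: mult_ac)
        then have "msq ?x \<le> R" unfolding R_def by (rule euler_bound[OF L g])
        then have "2 * L\<^sup>2 * g * msq ?x \<le> 2 * L\<^sup>2 * g * R" using g by (intro mult_left_mono) auto
        with pb(2) show "msq (\<lambda>\<omega>. g *\<^sub>R (A *v ?x \<omega>) + (W (real (Suc (2 * j)) * g) \<omega> - W (real (2 * j) * g) \<omega>) *\<^sub>R (C *v ?x \<omega>)) \<le> 2 * L\<^sup>2 * g * R"
          by (rule order_trans)
      qed auto
      finally show ?thesis by (simp add: algebra_simps)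
    qed
    have even: "K1 * g \<le> (4 * L\<^sup>2 * R + 2 * K1) * g" using g R K1 by (intro mult_right_mono) auto
    have "msq (\<lambda>\<omega>. euler A C x0 g (cell g s) \<omega> - ?y \<omega>) \<le> K * g"
      using cell_refine[OF g(1) s(1), folded j_def]
    proof
      assume c: "cell g s = 2 * j"
      show ?thesis unfolding c K_def by (rule order_trans[OF xx even])
    next
      assume c: "cell g s = Suc (2 * j)"
      show ?thesis unfolding c K_def by (rule odd)
    qed
    also have "\<dots> \<le> K * (1/2)^k" using K g gk by (intro mult_left_mono) auto
    finally show "msq (\<lambda>\<omega>. euler_process A C x0 (Suc k) s \<omega> - euler_process A C x0 k s \<omega>) \<le> K * (1/2)^k"
      unfolding euler_process_def gk[symmetric] g_def[symmetric] j_def .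
  qed
qed

text \<open>For times up to \<open>t\<close> only cells starting by \<open>t\<close> occur, and
  their values are measurable at \<open>t\<close>. Replacing the others by 0 makes every member of
  the countable family measurable, and the cell index composes with it.\<close>

lemma euler_process_progressive: "progressive F (euler_process A C x0 k)"
  unfolding progressive_def
proof (intro allI impI)
  fix t :: real assume t: "0 \<le> t"
  define h :: real where "h = (1/2)^k"
  have h: "0 < h" by (simp add: h_def)
  let ?N = "restrict_space borel {0..t} \<Otimes>\<^sub>M F t"
  have "(\<lambda>p. (if real j * h \<le> t then euler A C x0 h j (snd p) else 0)) \<in> borel_measurable ?N" for j
  proof (cases "real j * h \<le> t")
    case True
    have "euler A C x0 h j \<in> borel_measurable (F t)"
      using euler_sqint_measurable(2)[OF less_imp_le[OF h]] measurable_F_mono[OF True] by blast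
    from measurable_compose[OF measurable_snd this] True show ?thesis by simp
  qed simp
  moreover have "(\<lambda>p. cell h (fst p)) \<in> measurable ?N (count_space UNIV)"
    by (intro measurable_compose[OF measurable_fst] measurable_restrict_space1 cell_measurable)
  ultimately have "(\<lambda>p. if real (cell h (fst p)) * h \<le> t then euler A C x0 h (cell h (fst p)) (snd p) else 0) \<in> borel_measurable ?N"
    by (rule measurable_compose_countable)
  also have "?this \<longleftrightarrow> (\<lambda>(s, \<omega>). euler_process A C x0 k s \<omega>) \<in> borel_measurable ?N"
  proof (rule measurable_cong)
    fix p assume "p \<in> space ?N"
    then have "fst p \<in> {0..t}" by (auto simp: space_pair_measure space_restrict_space)
    then have "real (cell h (fst p)) * h \<le> t" using cell_bounds(1)[OF h, of "fst p"] by auto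
    then show "(if real (cell h (fst p)) * h \<le> t then euler A C x0 h (cell h (fst p)) (snd p) else 0)
      = (case p of (s, \<omega>) \<Rightarrow> euler_process A C x0 k s \<omega>)"
      by (simp add: euler_process_def h_def case_prod_unfold)
  qed
  finally show "(\<lambda>(s, \<omega>). euler_process A C x0 k s \<omega>) \<in> borel_measurable ?N" .
qed

lemma sqint_euler_process_PM:
  assumes t: "0 \<le> t"
  shows "sqint (PM t) (\<lambda>p. euler_process A C x0 k (fst p) (snd p))"
proof -
  define h :: real where "h = (1/2)^k"
  have h: "0 < h" by (simp add: h_def)
  have e: "sqint M (euler A C x0 h j)" for j by (rule euler_sqint_measurable(1)[OF less_imp_le[OF h]])
  show ?thesis
  proof (rule sqintI_le[where g = "\<lambda>p. \<Sum>j\<le>cell h t. (norm (euler A C x0 h j (snd p)))\<^sup>2"])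
    show "(\<lambda>p. euler_process A C x0 k (fst p) (snd p)) \<in> borel_measurable (PM t)"
      by (rule progressive_measurable[OF euler_process_progressive t])
    show "integrable (PM t) (\<lambda>p. \<Sum>j\<le>cell h t. (norm (euler A C x0 h j (snd p)))\<^sup>2)"
      by (intro Bochner_Integration.integrable_sum sqint_integrable sqint_snd_PM e)
    fix p assume "p \<in> space (PM t)"
    then have "cell h (fst p) \<le> cell h t"
      by (intro cell_mono h) (auto simp: PM_def space_pair_measure space_restrict_space)
    then show "(norm (euler_process A C x0 k (fst p) (snd p)))\<^sup>2 \<le> (\<Sum>j\<le>cell h t. (norm (euler A C x0 h j (snd p)))\<^sup>2)"
      unfolding euler_process_def h_def[symmetric]
      by (intro member_le_sum[where f = "\<lambda>j. (norm (euler A C x0 h j (snd p)))\<^sup>2"]) auto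
  qed
qed

text \<open>The limit is taken pointwise, so that it is progressive without completing the filtration; where
  the sequence diverges, \<open>lim\<close> is a fixed junk value.\<close>

definition euler_limit :: "real^'n^'n \<Rightarrow> real^'n^'n \<Rightarrow> real^'n \<Rightarrow> real \<Rightarrow> 'a \<Rightarrow> real^'n" where
  "euler_limit A C x0 s \<omega> = lim (\<lambda>k. euler_process A C x0 k s \<omega>)"

lemma euler_limit_progressive: "progressive F (euler_limit A C x0)"
  unfolding progressive_def
proof (intro allI impI)
  fix t :: real assume t: "0 \<le> t"
  have "(\<lambda>p. lim (\<lambda>k. (case p of (s, \<omega>) \<Rightarrow> euler_process A C x0 k s \<omega>)))
      \<in> borel_measurable (restrict_space borel {0..t} \<Otimes>\<^sub>M F t)"
  proof (intro borel_measurable_lim_metric)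
    show "(\<lambda>p. case p of (s, \<omega>) \<Rightarrow> euler_process A C x0 k s \<omega>)
        \<in> borel_measurable (restrict_space borel {0..t} \<Otimes>\<^sub>M F t)" for k
      using euler_process_progressive[of A C x0 k] t unfolding progressive_def by blast
  qed
  then show "(\<lambda>(s, \<omega>). euler_limit A C x0 s \<omega>) \<in> borel_measurable (restrict_space borel {0..t} \<Otimes>\<^sub>M F t)"
    by (simp add: euler_limit_def case_prod_unfold)
qed

text \<open>The limit theorem is used twice, on \<open>M\<close> at the time \<open>t\<close> and on
  \<open>PM t\<close>. Both uses speak of the same pointwise \<open>lim\<close>, so the limit at a
  time and the limit as a process agree without passing to a modification.\<close>

lemma euler_limit_approx:
  assumes t: "0 \<le> t"
  obtains K where "K \<ge> 0" "sqint M (euler_limit A C x0 t)" "sqint (PM t) (\<lambda>p. euler_limit A C x0 (fst p) (snd p))"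
    "\<And>k. msq (\<lambda>\<omega>. euler_limit A C x0 t \<omega> - euler_process A C x0 k t \<omega>) \<le> K * (1/2)^k"
    "\<And>k. (\<integral>p. (norm (euler_limit A C x0 (fst p) (snd p) - euler_process A C x0 k (fst p) (snd p)))\<^sup>2 \<partial>PM t) \<le> K * (1/2)^k"
proof -
  obtain K where K: "K \<ge> 0" "\<And>k s. 0 \<le> s \<Longrightarrow> s \<le> t \<Longrightarrow>
    msq (\<lambda>\<omega>. euler_process A C x0 (Suc k) s \<omega> - euler_process A C x0 k s \<omega>) \<le> K * (1/2)^k"
    by (rule euler_process_increment[OF t]) iprover
  note pt = L2_fast_limit[OF finite_measure_axioms sqint_euler_process K(2)[OF t order_refl], folded euler_limit_def]
  interpret TL: finite_measure "TL t" by (rule finite_measure_restrict_lborel)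
  have int: "(\<integral>p. (norm (euler_process A C x0 (Suc k) (fst p) (snd p) - euler_process A C x0 k (fst p) (snd p)))\<^sup>2 \<partial>PM t)
      \<le> (t * K) * (1/2)^k" for k
  proof -
    note i = integral_PM_fst[where f = "\<lambda>s \<omega>. (norm (euler_process A C x0 (Suc k) s \<omega> - euler_process A C x0 k s \<omega>))\<^sup>2",
        OF sqint_integrable[OF sqint_diff[OF sqint_euler_process_PM[OF t] sqint_euler_process_PM[OF t]]]]
    have "(\<integral>s. msq (\<lambda>\<omega>. euler_process A C x0 (Suc k) s \<omega> - euler_process A C x0 k s \<omega>) \<partial>TL t)
        \<le> (\<integral>s. K * (1/2)^k \<partial>TL t)"
      by (rule integral_mono[OF i(2)]) (use K in \<open>auto simp: space_restrict_space\<close>)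
    also have "\<dots> = (t * K) * (1/2)^k"
      using t by (simp add: measure_restrict_space space_restrict_space)
    finally show ?thesis unfolding i(1) .
  qed
  note pm = L2_fast_limit[OF finite_measure_PM sqint_euler_process_PM[OF t] int, folded euler_limit_def]
  define K' where "K' = max (12 * K) (12 * (t * K))"
  have K': "12 * K * (1/2)^k \<le> K' * (1/2)^k" "12 * (t * K) * (1/2)^k \<le> K' * (1/2)^k" for k :: nat
    by (intro mult_right_mono; simp add: K'_def)+
  show ?thesis
  proof (rule that[of K'])
    show "K' \<ge> 0" using K(1) by (simp add: K'_def)
    show "sqint M (euler_limit A C x0 t)" using pt(1) by (simp add: euler_limit_def[abs_def])
    show "sqint (PM t) (\<lambda>p. euler_limit A C x0 (fst p) (snd p))" by (rule pm(1))
    show "msq (\<lambda>\<omega>. euler_limit A C x0 t \<omega> - euler_process A C x0 k t \<omega>) \<le> K' * (1/2)^k" for k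
      by (rule order_trans[OF pt(2) K'(1)])
    show "(\<integral>p. (norm (euler_limit A C x0 (fst p) (snd p) - euler_process A C x0 k (fst p) (snd p)))\<^sup>2 \<partial>PM t) \<le> K' * (1/2)^k" for k
      by (rule order_trans[OF pm(2) K'(2)])
  qed
qed

end

section \<open>The limit of the Euler schemes solves the equation\<close>

lemma integral_indicator_TL:
  fixes v :: "'b::euclidean_space"
  assumes "0 \<le> a" "a \<le> b" "b \<le> t"
  shows "integrable (TL t) (\<lambda>s. indicat_real {a<..b} s *\<^sub>R v)"
    and "(\<integral>s. indicat_real {a<..b} s *\<^sub>R v \<partial>TL t) = (b - a) *\<^sub>R v"
proof -
  have e: "(\<lambda>s. indicat_real {0..t} s *\<^sub>R indicat_real {a<..b} s *\<^sub>R v) = (\<lambda>s. indicat_real {a<..b} s *\<^sub>R v)"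
    using assms by (auto simp: indicator_def fun_eq_iff)
  have i: "integrable lborel (\<lambda>s. indicat_real {a<..b} s *\<^sub>R v)" using assms by simp
  show "integrable (TL t) (\<lambda>s. indicat_real {a<..b} s *\<^sub>R v)"
    using integrable_restrict_space[of "{0..t}" lborel "\<lambda>s. indicat_real {a<..b} s *\<^sub>R v", unfolded e] i by simp
  show "(\<integral>s. indicat_real {a<..b} s *\<^sub>R v \<partial>TL t) = (b - a) *\<^sub>R v"
    using integral_restrict_space[of "{0..t}" lborel "\<lambda>s. indicat_real {a<..b} s *\<^sub>R v", unfolded e] assms by simp
qed

text \<open>The grid is cut at \<open>t\<close>, which shortens the last piece. Time 0 is excluded
  because a step process vanishes there, while \<open>cell\<close> assigns it to the initial
  cell.\<close>

lemma step_process_cell: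
  assumes h: "0 < h" and s: "0 < s" "s \<le> t"
  shows "step_process (Suc (cell h t)) (\<lambda>i. min (real i * h) t) f s \<omega> = f (cell h s) \<omega>"
proof -
  note c = cell_bounds[OF h less_imp_le[OF s(1)]]
  have ind: "indicat_real {min (real i * h) t<..min (real (Suc i) * h) t} s = (if i = cell h s then 1 else 0)" for i
  proof (cases "i = cell h s")
    case True
    then show ?thesis using c s by (auto simp: indicator_def)
  next
    case False
    have "\<not> (real i * h < s \<and> s \<le> real (Suc i) * h)" using cell_unique[OF h, of i s] False by auto
    then have "s \<notin> {min (real i * h) t<..min (real (Suc i) * h) t}" using s by auto
    then show ?thesis using False by (simp add: indicator_def)
  qed
  have "cell h s \<le> cell h t" by (rule cell_mono[OF h s(2)])
  then show ?thesis
    unfolding step_process_def ind by (simp add: if_distrib [where f = "\<lambda>x. x *\<^sub>R _"] cong: if_cong)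
qed

lemma AE_TL_pos: "AE s in TL t. 0 < s \<and> s \<le> t"
proof -
  have "AE s in lborel. s \<noteq> (0::real)" by (rule AE_lborel_singleton)
  then have "AE s in TL t. s \<noteq> 0" by (subst AE_restrict_space_iff) auto
  then show ?thesis using AE_space by eventually_elim (auto simp: space_restrict_space)
qed

context wiener_process
begin

lemma expectation_drift_square_le:
  assumes G: "sqint (PM t) (\<lambda>p. G (fst p) (snd p))" and t: "0 \<le> t"
  shows "msq (\<lambda>\<omega>. \<integral>r. G r \<omega> \<partial>TL t) \<le> t * (\<integral>p. (norm (G (fst p) (snd p)))\<^sup>2 \<partial>PM t)"
proof -
  note J = integrable_section_square[OF G]
  have "msq (\<lambda>\<omega>. \<integral>r. G r \<omega> \<partial>TL t) \<le> expectation (\<lambda>\<omega>. t * (\<integral>r. (norm (G r \<omega>))\<^sup>2 \<partial>TL t))"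
    using J sqint_integrable[OF sqint_drift[OF G t]] drift_bound[OF G t] t
    by (intro integral_mono_AE) (auto elim!: eventually_mono)
  also have "\<dots> = t * expectation (\<lambda>\<omega>. \<integral>r. (norm (G r \<omega>))\<^sup>2 \<partial>TL t)" by simp
  also have "expectation (\<lambda>\<omega>. \<integral>r. (norm (G r \<omega>))\<^sup>2 \<partial>TL t) = (\<integral>p. (norm (G (fst p) (snd p)))\<^sup>2 \<partial>PM t)"
    by (rule expectation_section[OF sqint_integrable[OF G] borel_measurable_integrable[OF J]]) simp
  finally show ?thesis .
qed

lemma euler_telescope:
  "euler A C x0 h N \<omega> = x0 + (\<Sum>i<N. h *\<^sub>R (A *v euler A C x0 h i \<omega>))
    + (\<Sum>i<N. (W (real (Suc i) * h) \<omega> - W (real i * h) \<omega>) *\<^sub>R (C *v euler A C x0 h i \<omega>))"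
  by (induction N) (simp_all add: algebra_simps)

text \<open>The scheme satisfies the integrated equation exactly at grid times. Between them its
  value is frozen at the left end \<open>N h\<close> while both integrals run on to
  \<open>t\<close>; the right-hand side is what they gain there.\<close>

lemma euler_process_balance:
  fixes A C :: "real^'n^'n" and x0 :: "real^'n" and t :: real and k :: nat
  assumes t: "0 \<le> t"
  defines "h \<equiv> (1/2::real)^k" and "N \<equiv> cell ((1/2)^k) t"
  shows "euler_process A C x0 k t \<omega> - x0 - (\<integral>s. A *v euler_process A C x0 k s \<omega> \<partial>TL t)
      - step_integral W (Suc N) (\<lambda>i. min (real i * h) t) (\<lambda>i \<omega>. C *v euler A C x0 h i \<omega>) \<omega>
    = - ((t - real N * h) *\<^sub>R (A *v euler A C x0 h N \<omega>) + (W t \<omega> - W (real N * h) \<omega>) *\<^sub>R (C *v euler A C x0 h N \<omega>))"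
proof -
  have h: "0 < h" by (simp add: h_def)
  have N: "N = cell h t" by (simp add: N_def h_def)
  note c = cell_bounds(1,2)[OF h t, folded N]
  let ?e = "\<lambda>i. euler A C x0 h i \<omega>" and ?\<tau> = "\<lambda>i. min (real i * h) t"
  have \<tau>: "?\<tau> i = real i * h" if "i \<le> N" for i
  proof -
    have "real i * h \<le> real N * h" using that h by (intro mult_right_mono) auto
    with c(1) show ?thesis by simp
  qed
  have \<tau>N: "?\<tau> (Suc N) = t" using c(2) by simp
  have \<tau>le: "0 \<le> ?\<tau> i" "?\<tau> i \<le> ?\<tau> (Suc i)" "?\<tau> (Suc i) \<le> t" for i
    using h t by (auto simp: min_def algebra_simps)
  have drift: "(\<integral>s. A *v euler_process A C x0 k s \<omega> \<partial>TL t)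
      = (\<Sum>i<N. h *\<^sub>R (A *v ?e i)) + (t - real N * h) *\<^sub>R (A *v ?e N)"
  proof -
    have "(\<integral>s. A *v euler_process A C x0 k s \<omega> \<partial>TL t) = (\<integral>s. step_process (Suc N) ?\<tau> (\<lambda>i \<omega>. A *v euler A C x0 h i \<omega>) s \<omega> \<partial>TL t)"
    proof (rule integral_cong_AE)
      have "cell h \<in> measurable (TL t) (count_space UNIV)" by (rule measurable_restrict_lborel[OF cell_measurable])
      from measurable_compose[OF this, of "\<lambda>j. A *v ?e j" borel]
      show "(\<lambda>s. A *v euler_process A C x0 k s \<omega>) \<in> borel_measurable (TL t)"
        by (simp add: euler_process_def h_def)
      show "(\<lambda>s. step_process (Suc N) ?\<tau> (\<lambda>i \<omega>. A *v euler A C x0 h i \<omega>) s \<omega>) \<in> borel_measurable (TL t)"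
        unfolding step_process_def
        by (intro borel_measurable_sum borel_measurable_scaleR borel_measurable_const measurable_restrict_lborel) simp
      show "AE s in TL t. A *v euler_process A C x0 k s \<omega> = step_process (Suc N) ?\<tau> (\<lambda>i \<omega>. A *v euler A C x0 h i \<omega>) s \<omega>"
        using AE_TL_pos
      proof eventually_elim
        case (elim s)
        then show ?case unfolding N euler_process_def h_def[symmetric] by (subst step_process_cell[OF h]) auto
      qed
    qed
    also have "\<dots> = (\<Sum>i<Suc N. (?\<tau> (Suc i) - ?\<tau> i) *\<^sub>R (A *v ?e i))"
      unfolding step_process_def
      by (subst Bochner_Integration.integral_sum)
        (rule integral_indicator_TL[OF \<tau>le], rule sum.cong[OF refl integral_indicator_TL(2)[OF \<tau>le]])
    also have "\<dots> = (\<Sum>i<N. h *\<^sub>R (A *v ?e i)) + (t - real N * h) *\<^sub>R (A *v ?e N)"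
    proof -
      have "(\<Sum>i<N. (?\<tau> (Suc i) - ?\<tau> i) *\<^sub>R (A *v ?e i)) = (\<Sum>i<N. h *\<^sub>R (A *v ?e i))"
      proof (rule sum.cong[OF refl])
        fix i assume "i \<in> {..<N}"
        then have "?\<tau> (Suc i) - ?\<tau> i = h" using \<tau>[of i] \<tau>[of "Suc i"] by (simp add: algebra_simps)
        then show "(?\<tau> (Suc i) - ?\<tau> i) *\<^sub>R (A *v ?e i) = h *\<^sub>R (A *v ?e i)" by (simp only:)
      qed
      then show ?thesis unfolding sum.lessThan_Suc \<tau>N \<tau>[OF order_refl] by (simp only:)
    qed
    finally show ?thesis .
  qed
  have si: "step_integral W (Suc N) ?\<tau> (\<lambda>i \<omega>. C *v euler A C x0 h i \<omega>) \<omega>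
      = (\<Sum>i<N. (W (real (Suc i) * h) \<omega> - W (real i * h) \<omega>) *\<^sub>R (C *v ?e i)) + (W t \<omega> - W (real N * h) \<omega>) *\<^sub>R (C *v ?e N)"
  proof -
    have "(\<Sum>i<N. (W (?\<tau> (Suc i)) \<omega> - W (?\<tau> i) \<omega>) *\<^sub>R (C *v ?e i))
        = (\<Sum>i<N. (W (real (Suc i) * h) \<omega> - W (real i * h) \<omega>) *\<^sub>R (C *v ?e i))"
    proof (rule sum.cong[OF refl])
      fix i assume "i \<in> {..<N}"
      then have "?\<tau> (Suc i) = real (Suc i) * h" "?\<tau> i = real i * h" using \<tau>[of i] \<tau>[of "Suc i"] by simp_all
      then show "(W (?\<tau> (Suc i)) \<omega> - W (?\<tau> i) \<omega>) *\<^sub>R (C *v ?e i) = (W (real (Suc i) * h) \<omega> - W (real i * h) \<omega>) *\<^sub>R (C *v ?e i)"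
        by (simp only:)
    qed
    then show ?thesis unfolding step_integral_def sum.lessThan_Suc \<tau>N \<tau>[OF order_refl] by (simp only:)
  qed
  have "euler_process A C x0 k t \<omega> = ?e N" by (simp add: euler_process_def N_def h_def)
  then show ?thesis
    unfolding drift si euler_telescope[of A C x0 h N \<omega>] by (simp add: algebra_simps)
qed

theorem euler_limit_solution:
  fixes A C :: "real^'n^'n"
  shows "ito_solution M F W A C x0 (euler_limit A C x0)"
proof -
  let ?X = "euler_limit A C x0" and ?Z = "euler_process A C x0"
  obtain L where L: "L \<ge> 1" "\<And>x. norm (A *v x) \<le> L * norm x" "\<And>x. norm (C *v x) \<le> L * norm x"
    by (rule common_operator_bound[of A C]) iprover
  have sqL: "(norm (A *v x))\<^sup>2 \<le> L\<^sup>2 * (norm x)\<^sup>2 + 0 * (norm x)\<^sup>2" "(norm (C *v x))\<^sup>2 \<le> L\<^sup>2 * (norm x)\<^sup>2 + 0 * (norm x)\<^sup>2" for x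
    using power_mono[OF L(2), of x 2] power_mono[OF L(3), of x 2] by (simp_all add: power_mult_distrib)
  have en: "energy M t ?X < \<infinity>" if t: "0 \<le> t" for t
  proof -
    have X: "sqint (PM t) (\<lambda>p. ?X (fst p) (snd p))" by (rule euler_limit_approx[OF t]) iprover
    show ?thesis
      using sqint_integrable[OF X] unfolding energy_eq[OF sqint_measurable[OF X]] by (simp add: integrable_iff_bounded)
  qed
  have main: "\<exists>Y. has_ito_integral M F W (\<lambda>s \<omega>. C *v ?X s \<omega>) t Y \<and>
      (AE \<omega> in M. ?X t \<omega> = x0 + (LBINT s:{0..t}. A *v ?X s \<omega>) + Y \<omega>)" if t: "0 \<le> t" for t
  proof -
    obtain K where K: "K \<ge> 0" and Xt: "sqint M (?X t)" and XP: "sqint (PM t) (\<lambda>p. ?X (fst p) (snd p))"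
      and K1: "\<And>k. msq (\<lambda>\<omega>. ?X t \<omega> - ?Z k t \<omega>) \<le> K * (1/2)^k"
      and K2: "\<And>k. (\<integral>p. (norm (?X (fst p) (snd p) - ?Z k (fst p) (snd p)))\<^sup>2 \<partial>PM t) \<le> K * (1/2)^k"
      by (rule euler_limit_approx[OF t]) iprover
    define h :: "nat \<Rightarrow> real" where "h k = (1/2)^k" for k
    have h: "0 < h k" "h k \<le> 1" for k by (simp_all add: h_def power_le_one)
    define N where "N k = cell (h k) t" for k
    define \<tau> where "\<tau> k i = min (real i * h k) t" for k i
    define f where "f k i = (\<lambda>\<omega>. C *v euler A C x0 (h k) i \<omega>)" for k i
    \<comment> \<open>Defined as the remainder, \<open>Y\<close> satisfies the equation trivially;
      what has to be shown is that the step integrals of the Euler processes converge to it.\<close>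
    define Y where "Y = (\<lambda>\<omega>. ?X t \<omega> - x0 - (\<integral>s. A *v ?X s \<omega> \<partial>TL t))"
    have NT: "real (N k) * h k \<le> t" "t \<le> real (Suc (N k)) * h k" for k
      using cell_bounds(1,2)[OF h(1)[of k] t] by (auto simp: N_def)
    note AX = sqint_mv[OF XP, of A] and CX = sqint_mv[OF XP, of C]
    have D: "sqint M (\<lambda>\<omega>. \<integral>s. A *v ?X s \<omega> \<partial>TL t)" by (rule sqint_drift[where G = "\<lambda>s \<omega>. A *v ?X s \<omega>", OF AX t])
    have Y: "sqint M Y" unfolding Y_def by (intro sqint_diff Xt sqint_const D)
    have el: "elementary M F t (Suc (N k)) (\<tau> k) (f k)" for k
      unfolding elementary_def
    proof (intro conjI allI impI)
      show "\<tau> k 0 = 0" using t by (simp add: \<tau>_def)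
      show "\<tau> k (Suc (N k)) = t" using NT(2)[of k] by (simp add: \<tau>_def)
      fix i assume i: "i < Suc (N k)"
      show "\<tau> k i \<le> \<tau> k (Suc i)" using h(1)[of k] by (auto simp: \<tau>_def min_def algebra_simps)
      note e = euler_sqint_measurable[OF less_imp_le[OF h(1)], of A C x0 k i]
      have "real i * h k \<le> real (N k) * h k" using i h(1)[of k] by (intro mult_right_mono) auto
      then have "\<tau> k i = real i * h k" using NT(1)[of k] by (simp add: \<tau>_def)
      then show "f k i \<in> borel_measurable (F (\<tau> k i))"
        unfolding f_def using measurable_mv[OF e(2)] by simp
      show "integrable M (\<lambda>\<omega>. (norm (f k i \<omega>))\<^sup>2)"
        unfolding f_def by (rule sqint_integrable[OF sqint_mv[OF e(1)]])
    qed
    have zero: "(\<lambda>k. ennreal (c * (1/2)^k)) \<longlonglongrightarrow> 0" for c :: real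
    proof -
      have "(\<lambda>k. c * (1/2)^k) \<longlonglongrightarrow> c * 0" by (intro tendsto_intros LIMSEQ_realpow_zero) auto
      from tendsto_ennrealI[OF this] show ?thesis by simp
    qed
    have lim1: "(\<lambda>k. energy M t (\<lambda>s \<omega>. C *v ?X s \<omega> - step_process (Suc (N k)) (\<tau> k) (f k) s \<omega>)) \<longlonglongrightarrow> 0"
    proof (rule tendsto_sandwich[OF always_eventually always_eventually tendsto_const zero[of "L\<^sup>2 * K"]]; intro allI)
      fix k
      note sq = sqint_diff[OF XP sqint_euler_process_PM[OF t, of A C x0 k]]
      have "energy M t (\<lambda>s \<omega>. C *v ?X s \<omega> - step_process (Suc (N k)) (\<tau> k) (f k) s \<omega>)
          = energy M t (\<lambda>s \<omega>. C *v (?X s \<omega> - ?Z k s \<omega>))"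
        unfolding energy_def
      proof (rule nn_integral_cong, rule nn_integral_cong_AE)
        fix \<omega>
        \<comment> \<open>At time 0 the step process is 0 and the Euler process is
          \<open>x0\<close>, a discrepancy that the energy does not see.\<close>
        have "AE s in lborel. s \<noteq> (0::real)" by (rule AE_lborel_singleton)
        then show "AE s in lborel. ennreal ((norm (C *v ?X s \<omega> - step_process (Suc (N k)) (\<tau> k) (f k) s \<omega>))\<^sup>2) * indicator {0..t} s
            = ennreal ((norm (C *v (?X s \<omega> - ?Z k s \<omega>)))\<^sup>2) * indicator {0..t} s"
        proof eventually_elim
          case (elim s)
          show ?case
          proof (cases "s \<in> {0..t}")
            case True
            with elim have "0 < s" "s \<le> t" by auto
            from step_process_cell[OF h(1) this, of k "f k" \<omega>]
            have "step_process (Suc (N k)) (\<tau> k) (f k) s \<omega> = C *v ?Z k s \<omega>"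
              by (simp add: N_def \<tau>_def[abs_def] f_def euler_process_def h_def)
            then show ?thesis by (simp add: matrix_vector_mult_diff_distrib)
          qed simp
        qed
      qed
      also have "\<dots> = (\<integral>\<^sup>+p. ennreal ((norm (C *v (?X (fst p) (snd p) - ?Z k (fst p) (snd p))))\<^sup>2) \<partial>PM t)"
        by (rule energy_eq[OF sqint_measurable[OF sqint_mv[OF sq]]])
      also have "\<dots> = ennreal (\<integral>p. (norm (C *v (?X (fst p) (snd p) - ?Z k (fst p) (snd p))))\<^sup>2 \<partial>PM t)"
        by (rule nn_integral_eq_integral[OF sqint_integrable[OF sqint_mv[OF sq]]]) simp
      also have "\<dots> \<le> ennreal (L\<^sup>2 * K * (1/2)^k)"
      proof (rule ennreal_leI)
        have "(\<integral>p. (norm (C *v (?X (fst p) (snd p) - ?Z k (fst p) (snd p))))\<^sup>2 \<partial>PM t)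
          \<le> L\<^sup>2 * (\<integral>p. (norm (?X (fst p) (snd p) - ?Z k (fst p) (snd p)))\<^sup>2 \<partial>PM t)
            + 0 * (\<integral>p. (norm (?X (fst p) (snd p) - ?Z k (fst p) (snd p)))\<^sup>2 \<partial>PM t)"
          by (rule integral_square_le[OF sqint_mv[OF sq] sq sq sqL(2)])
        also have "\<dots> \<le> L\<^sup>2 * (K * (1/2)^k)" using mult_left_mono[OF K2[of k], of "L\<^sup>2"] by simp
        finally show "(\<integral>p. (norm (C *v (?X (fst p) (snd p) - ?Z k (fst p) (snd p))))\<^sup>2 \<partial>PM t) \<le> L\<^sup>2 * K * (1/2)^k"
          by (simp add: mult.assoc)
      qed
      finally show "energy M t (\<lambda>s \<omega>. C *v ?X s \<omega> - step_process (Suc (N k)) (\<tau> k) (f k) s \<omega>) \<le> ennreal (L\<^sup>2 * K * (1/2)^k)" .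
    qed simp
    define R where "R = exp (4 * L\<^sup>2 * t) * (norm x0)\<^sup>2"
    define K' where "K' = 2 * K + 2 * (2 * (t * (L\<^sup>2 * K)) + 2 * (2 * L\<^sup>2 * R))"
    have lim2: "(\<lambda>k. \<integral>\<^sup>+\<omega>. ennreal ((norm (Y \<omega> - step_integral W (Suc (N k)) (\<tau> k) (f k) \<omega>))\<^sup>2) \<partial>M) \<longlonglongrightarrow> 0"
    proof (rule tendsto_sandwich[OF always_eventually always_eventually tendsto_const zero[of K']]; intro allI)
      fix k
      note ZP = sqint_euler_process_PM[OF t, of A C x0 k]
      note sq = sqint_diff[OF XP ZP]
      define e where "e = euler A C x0 (h k) (N k)"
      define \<rho> where "\<rho> = (\<lambda>\<omega>. (t - real (N k) * h k) *\<^sub>R (A *v e \<omega>) + (W t \<omega> - W (real (N k) * h k) \<omega>) *\<^sub>R (C *v e \<omega>))"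
      define D' where "D' = (\<lambda>\<omega>. \<integral>s. A *v (?X s \<omega> - ?Z k s \<omega>) \<partial>TL t)"
      have D': "sqint M D'" unfolding D'_def
        by (rule sqint_drift[where G = "\<lambda>s \<omega>. A *v (?X s \<omega> - ?Z k s \<omega>)", OF sqint_mv[OF sq] t])
      have a: "0 \<le> real (N k) * h k" using h(1)[of k] by simp
      have th: "t - real (N k) * h k \<le> h k" using NT(2)[of k] by (simp add: algebra_simps)
      then have th1: "t - real (N k) * h k \<le> 1" using h(2)[of k] by simp
      have ee: "sqint M e" "e \<in> borel_measurable (F (real (N k) * h k))"
        unfolding e_def by (rule euler_sqint_measurable[OF less_imp_le[OF h(1)]])+
      have \<rho>: "sqint M \<rho>" unfolding \<rho>_def by (rule partial_step_bound(1)[OF L a NT(1) th1 ee])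
      have \<rho>2: "msq \<rho> \<le> 2 * L\<^sup>2 * R * (1/2)^k"
      proof -
        have "msq e \<le> R" unfolding e_def R_def by (rule euler_bound[OF L h NT(1)])
        have "msq \<rho> \<le> 2 * L\<^sup>2 * (t - real (N k) * h k) * msq e"
          unfolding \<rho>_def by (rule partial_step_bound(2)[OF L a NT(1) th1 ee])
        also have "\<dots> \<le> 2 * L\<^sup>2 * h k * R"
          using th NT(1)[of k] h(1)[of k] \<open>msq e \<le> R\<close> by (intro mult_mono mult_left_mono) auto
        finally show ?thesis by (simp add: h_def mult_ac)
      qed
      have D2: "msq D' \<le> t * (L\<^sup>2 * K) * (1/2)^k"
      proof -
        have "msq D' \<le> t * (\<integral>p. (norm (A *v (?X (fst p) (snd p) - ?Z k (fst p) (snd p))))\<^sup>2 \<partial>PM t)"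
          unfolding D'_def
          by (rule expectation_drift_square_le[where G = "\<lambda>s \<omega>. A *v (?X s \<omega> - ?Z k s \<omega>)", OF sqint_mv[OF sq] t])
        also have "\<dots> \<le> t * (L\<^sup>2 * (\<integral>p. (norm (?X (fst p) (snd p) - ?Z k (fst p) (snd p)))\<^sup>2 \<partial>PM t)
            + 0 * (\<integral>p. (norm (?X (fst p) (snd p) - ?Z k (fst p) (snd p)))\<^sup>2 \<partial>PM t))"
          by (intro mult_left_mono t integral_square_le[OF sqint_mv[OF sq] sq sq sqL(1)])
        also have "\<dots> \<le> t * (L\<^sup>2 * (K * (1/2)^k))"
          using mult_left_mono[OF K2[of k], of "L\<^sup>2"] t by (intro mult_left_mono) auto
        finally show ?thesis by (simp add: mult.assoc)
      qed
      have sqt: "sqint M (\<lambda>\<omega>. ?X t \<omega> - ?Z k t \<omega>)" by (rule sqint_diff[OF Xt sqint_euler_process])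
      \<comment> \<open>The three errors: approximation at the final time, approximation inside the
        drift (\<open>D'\<close>), and the unfinished last cell (\<open>\<rho>\<close>). Each is of
        mean square order \<open>(1/2)^k\<close>.\<close>
      have E: "AE \<omega> in M. Y \<omega> - step_integral W (Suc (N k)) (\<tau> k) (f k) \<omega> = (?X t \<omega> - ?Z k t \<omega>) - (D' \<omega> + \<rho> \<omega>)"
        using AE_sqint_section[OF AX, unfolded fst_conv snd_conv] AE_sqint_section[OF sqint_mv[OF ZP, of A]]
      proof eventually_elim
        case (elim \<omega>)
        note i = sqint_integrable_fun[OF elim(1) finite_measure_restrict_lborel] sqint_integrable_fun[OF elim(2) finite_measure_restrict_lborel]
        have d: "D' \<omega> = (\<integral>s. A *v ?X s \<omega> \<partial>TL t) - (\<integral>s. A *v ?Z k s \<omega> \<partial>TL t)"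
          unfolding D'_def matrix_vector_mult_diff_distrib by (rule Bochner_Integration.integral_diff[OF i])
        have "?Z k t \<omega> - x0 - (\<integral>s. A *v ?Z k s \<omega> \<partial>TL t) - step_integral W (Suc (N k)) (\<tau> k) (f k) \<omega> = - \<rho> \<omega>"
          using euler_process_balance[OF t, of A C x0 k \<omega>]
          unfolding N_def \<tau>_def[abs_def] f_def[abs_def] \<rho>_def e_def h_def .
        then show ?case unfolding Y_def d by (simp add: algebra_simps)
      qed
      have sqS: "sqint M (\<lambda>\<omega>. (?X t \<omega> - ?Z k t \<omega>) - (D' \<omega> + \<rho> \<omega>))" by (intro sqint_diff sqint_add sqt D' \<rho>)
      have "(\<integral>\<^sup>+\<omega>. ennreal ((norm (Y \<omega> - step_integral W (Suc (N k)) (\<tau> k) (f k) \<omega>))\<^sup>2) \<partial>M)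
          = (\<integral>\<^sup>+\<omega>. ennreal ((norm ((?X t \<omega> - ?Z k t \<omega>) - (D' \<omega> + \<rho> \<omega>)))\<^sup>2) \<partial>M)"
        using E by (intro nn_integral_cong_AE) (auto elim!: eventually_mono)
      also have "\<dots> = ennreal (msq (\<lambda>\<omega>. (?X t \<omega> - ?Z k t \<omega>) - (D' \<omega> + \<rho> \<omega>)))"
        by (rule nn_integral_eq_integral[OF sqint_integrable[OF sqS]]) simp
      also have "\<dots> \<le> ennreal (K' * (1/2)^k)"
      proof (rule ennreal_leI)
        have "msq (\<lambda>\<omega>. (?X t \<omega> - ?Z k t \<omega>) - (D' \<omega> + \<rho> \<omega>)) \<le> 2 * msq (\<lambda>\<omega>. ?X t \<omega> - ?Z k t \<omega>) + 2 * msq (\<lambda>\<omega>. D' \<omega> + \<rho> \<omega>)"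
          by (rule integral_norm_diff_square_le[OF sqt sqint_add[OF D' \<rho>]])
        also have "\<dots> \<le> 2 * (K * (1/2)^k) + 2 * (2 * (t * (L\<^sup>2 * K) * (1/2)^k) + 2 * (2 * L\<^sup>2 * R * (1/2)^k))"
          by (intro add_mono mult_left_mono order_trans[OF integral_norm_add_square_le[OF D' \<rho>]] K1 D2 \<rho>2) auto
        also have "\<dots> = K' * (1/2)^k" by (simp add: K'_def algebra_simps)
        finally show "msq (\<lambda>\<omega>. (?X t \<omega> - ?Z k t \<omega>) - (D' \<omega> + \<rho> \<omega>)) \<le> K' * (1/2)^k" .
      qed
      finally show "(\<integral>\<^sup>+\<omega>. ennreal ((norm (Y \<omega> - step_integral W (Suc (N k)) (\<tau> k) (f k) \<omega>))\<^sup>2) \<partial>M) \<le> ennreal (K' * (1/2)^k)" .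
    qed simp
    have "has_ito_integral M F W (\<lambda>s \<omega>. C *v ?X s \<omega>) t Y"
      unfolding has_ito_integral_def
    proof (intro conjI exI)
      show "progressive F (\<lambda>s \<omega>. C *v ?X s \<omega>)"
        using euler_limit_progressive[of A C x0] measurable_mv unfolding progressive_def case_prod_unfold by blast
      show "Y \<in> borel_measurable M" by (rule sqint_measurable[OF Y])
      show "\<forall>k. elementary M F t (Suc (N k)) (\<tau> k) (f k)" using el by blast
    qed (fact lim1 lim2)+
    moreover have "AE \<omega> in M. ?X t \<omega> = x0 + (LBINT s:{0..t}. A *v ?X s \<omega>) + Y \<omega>"
      by (simp add: Y_def set_integral_TL)
    ultimately show ?thesis by blast
  qed
  show ?thesis
    unfolding ito_solution_def using euler_limit_progressive en main by blast
qed

end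

section \<open>Mean square stability\<close>

text \<open>Dual generator of the second moment flow: \<open>d/dt E[x \<bullet> Q x] = E[x \<bullet> moment_gen A C Q x]\<close>.\<close>

definition moment_gen :: "real^'n^'n \<Rightarrow> real^'n^'n \<Rightarrow> real^'n^'n \<Rightarrow> real^'n^'n" where
  "moment_gen A C Q = Q ** A + transpose A ** Q + transpose C ** Q ** C"

lemma transpose_moment_gen: "transpose Q = Q \<Longrightarrow> transpose (moment_gen A C Q) = moment_gen A C Q"
  by (simp add: moment_gen_def transpose_add matrix_transpose_mul matrix_mul_assoc add_ac)

lemma inner_moment_gen:
  assumes "transpose Q = Q"
  shows "x \<bullet> (moment_gen A C Q *v x) = 2 * ((A *v x) \<bullet> (Q *v x)) + (C *v x) \<bullet> (Q *v (C *v x))"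
proof -
  have "x \<bullet> (moment_gen A C Q *v x) = x \<bullet> (Q *v (A *v x)) + x \<bullet> (transpose A *v (Q *v x))
      + x \<bullet> (transpose C *v (Q *v (C *v x)))"
    by (simp add: moment_gen_def matrix_vector_mult_add_rdistrib inner_add_right matrix_vector_mul_assoc[symmetric]
        del: transpose_matrix_vector)
  then show ?thesis
    unfolding inner_transpose_mv using inner_symmetric_mv[OF assms, of x "A *v x"] by simp
qed

text \<open>The function \<open>exp (a s) f s\<close> is nonincreasing. Derivatives are assumed
  inside the interval only and continuity up to its ends, which is the form in which moments are
  known.\<close>

lemma gronwall_decay:
  fixes f g :: "real \<Rightarrow> real"
  assumes c: "continuous_on {0..t} f" and d: "\<And>s. 0 < s \<Longrightarrow> s < t \<Longrightarrow> (f has_real_derivative g s) (at s)"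
    and le: "\<And>s. 0 < s \<Longrightarrow> s < t \<Longrightarrow> g s \<le> - a * f s" and t: "0 \<le> t"
  shows "f t \<le> f 0 * exp (- a * t)"
proof (cases "t = 0")
  case False
  with t have t: "0 < t" by simp
  define \<phi> where "\<phi> = (\<lambda>s. exp (a * s) * f s)"
  have "\<phi> t \<le> \<phi> 0"
  proof (rule DERIV_nonpos_imp_decreasing_open[OF less_imp_le[OF t]])
    fix s assume s: "0 < s" "s < t"
    have "(\<phi> has_real_derivative (a * exp (a * s)) * f s + exp (a * s) * g s) (at s)"
      unfolding \<phi>_def by (auto intro!: derivative_eq_intros d s)
    moreover have "(a * exp (a * s)) * f s + exp (a * s) * g s \<le> 0"
    proof -
      have "exp (a * s) * (a * f s + g s) \<le> 0" using le[OF s] by (intro mult_nonneg_nonpos) auto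
      then show ?thesis by (simp add: algebra_simps)
    qed
    ultimately show "\<exists>y. (\<phi> has_real_derivative y) (at s) \<and> y \<le> 0" by blast
  next
    show "continuous_on {0..t} \<phi>" unfolding \<phi>_def by (intro continuous_intros c)
  qed
  then have "exp (- (a * t)) * (exp (a * t) * f t) \<le> exp (- (a * t)) * f 0"
    by (intro mult_left_mono) (auto simp: \<phi>_def)
  moreover have "exp (- (a * t)) * (exp (a * t) * f t) = f t" by (simp add: exp_minus)
  ultimately have "f t \<le> exp (- (a * t)) * f 0" by (simp only:)
  then show ?thesis by (simp add: mult.commute)
qed simp

lemma pd_bounds:
  fixes Q :: "real^'n^'n"
  assumes pd: "\<And>x. x \<noteq> 0 \<Longrightarrow> 0 < x \<bullet> (Q *v x)"
  obtains q1 q2 where "0 < q1" "0 < q2" "\<And>x. q1 * (x \<bullet> x) \<le> x \<bullet> (Q *v x)" "\<And>x. x \<bullet> (Q *v x) \<le> q2 * (x \<bullet> x)"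
proof -
  let ?f = "\<lambda>x. x \<bullet> (Q *v x)"
  have c: "continuous_on (sphere 0 1) ?f"
    by (intro continuous_intros matrix_vector_mult_linear_continuous_on)
  obtain u where u: "u \<in> sphere 0 1" "\<And>y. y \<in> sphere 0 1 \<Longrightarrow> ?f u \<le> ?f y"
    using continuous_attains_inf[OF compact_sphere unit_sphere_nonempty c] by blast
  obtain v where v: "v \<in> sphere 0 1" "\<And>y. y \<in> sphere 0 1 \<Longrightarrow> ?f y \<le> ?f v"
    using continuous_attains_sup[OF compact_sphere unit_sphere_nonempty c] by blast
  have nz: "u \<noteq> 0" "v \<noteq> 0" using u(1) v(1) by auto
  have scale: "?f u * (x \<bullet> x) \<le> ?f x \<and> ?f x \<le> ?f v * (x \<bullet> x)" for x
  proof (cases "x = 0")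
    case False
    let ?y = "x /\<^sub>R norm x"
    have y: "?y \<in> sphere 0 1" using False by simp
    have "?f x = ?f ?y * (x \<bullet> x)"
      using False by (simp add: matrix_vector_mult_scaleR power2_norm_eq_inner[symmetric] power2_eq_square field_simps)
    then show ?thesis using u(2)[OF y] v(2)[OF y] by (auto intro: mult_right_mono)
  qed simp
  show ?thesis
    by (rule that[of "?f u" "?f v"]) (use pd nz scale in auto)
qed

lemma inner_axis_mv: "axis i 1 \<bullet> (Q *v axis i 1) = Q $ i $ i" for Q :: "real^'n^'n"
  by (simp add: matrix_vector_mult_basis inner_axis' column_def)

text \<open>The trace dominates the largest eigenvalue. Instead of diagonalizing, Cauchy-Schwarz in
  the form of \<open>Q\<close> bounds each coordinate of \<open>Q x\<close>, so that its squared
  norm is at most \<open>trace Q\<close> times the form; the ordinary Cauchy-Schwarz inequality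
  finishes.\<close>

lemma psd_le_trace:
  fixes Q :: "real^'n^'n"
  assumes sym: "transpose Q = Q" and pos: "\<And>x. 0 \<le> x \<bullet> (Q *v x)"
  shows "x \<bullet> (Q *v x) \<le> trace Q * (x \<bullet> x)"
proof -
  let ?v = "x \<bullet> (Q *v x)"
  have "((Q *v x) $ i)\<^sup>2 \<le> Q $ i $ i * ?v" for i
    using psd_Cauchy_Schwarz[OF sym pos, of "axis i 1" x] unfolding inner_axis_mv by (simp add: inner_axis')
  then have "(\<Sum>i\<in>UNIV. ((Q *v x) $ i)\<^sup>2) \<le> (\<Sum>i\<in>UNIV. Q $ i $ i * ?v)" by (rule sum_mono)
  then have 1: "(Q *v x) \<bullet> (Q *v x) \<le> trace Q * ?v"
    by (simp add: inner_vec_def power2_eq_square trace_def sum_distrib_right)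
  have "?v * ?v \<le> (x \<bullet> x) * ((Q *v x) \<bullet> (Q *v x))"
    using Cauchy_Schwarz_ineq[of x "Q *v x"] by (simp add: power2_eq_square)
  also have "\<dots> \<le> (x \<bullet> x) * (trace Q * ?v)" by (intro mult_left_mono 1) simp
  finally have "?v * ?v \<le> ?v * (trace Q * (x \<bullet> x))" by (simp add: mult_ac)
  moreover have "0 \<le> trace Q"
    unfolding trace_def using pos[of "axis _ 1"] by (intro sum_nonneg) (simp add: inner_axis_mv)
  ultimately show ?thesis
    using pos[of x] by (cases "?v = 0") (simp, metis mult_le_cancel_left_pos less_eq_real_def)
qed

section \<open>The differential equation of the second moments and stability\<close>

context wiener_process
begin

abbreviation moment :: "(real \<Rightarrow> 'a \<Rightarrow> real^'n) \<Rightarrow> real^'n^'n \<Rightarrow> real \<Rightarrow> real" where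
  "moment X Q t \<equiv> expectation (\<lambda>\<omega>. X t \<omega> \<bullet> (Q *v X t \<omega>))"

lemma moment_gen_equation:
  assumes sol: "ito_solution M F W A C x0 X" and t: "0 \<le> t" and Q: "transpose Q = Q"
  shows "moment X Q t = x0 \<bullet> (Q *v x0) + (\<integral>p. X (fst p) (snd p) \<bullet> (moment_gen A C Q *v X (fst p) (snd p)) \<partial>PM t)"
  unfolding inner_moment_gen[OF Q] by (rule moment_equation[OF sol t inner_symmetric_mv[OF Q]])

lemma moment_integrable:
  assumes sol: "ito_solution M F W A C x0 X" and t: "0 \<le> t"
  shows "(\<lambda>s. moment X Q s) integrable_on {0..t}"
    and "(\<integral>p. X (fst p) (snd p) \<bullet> (Q *v X (fst p) (snd p)) \<partial>PM t) = integral {0..t} (\<lambda>s. moment X Q s)"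
proof -
  note XP = solution_sqint_PM[OF sol t]
  note i = integral_PM_fst[where f = "\<lambda>s \<omega>. X s \<omega> \<bullet> (Q *v X s \<omega>)", OF sqint_inner[OF XP sqint_mv[OF XP]]]
  have s: "set_integrable lborel {0..t} (\<lambda>s. moment X Q s)"
    using i(2) unfolding set_integrable_def by (subst (asm) integrable_restrict_space) auto
  from set_borel_integral_eq_integral[OF s] i(1)
  show "(\<lambda>s. moment X Q s) integrable_on {0..t}"
    and "(\<integral>p. X (fst p) (snd p) \<bullet> (Q *v X (fst p) (snd p)) \<partial>PM t) = integral {0..t} (\<lambda>s. moment X Q s)"
    by (simp_all add: set_integral_TL)
qed

lemma moment_ode:
  assumes sol: "ito_solution M F W A C x0 X" and Q: "transpose Q = Q" and t: "0 \<le> t"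
  shows "moment X Q t = x0 \<bullet> (Q *v x0) + integral {0..t} (moment X (moment_gen A C Q))"
  using moment_gen_equation[OF sol t Q] moment_integrable(2)[OF sol t] by simp

text \<open>Continuity in time comes from the moment equation, which presents the moment as an
  indefinite integral; paths of \<open>X\<close> are not involved.\<close>

lemma moment_continuous:
  assumes sol: "ito_solution M F W A C x0 X" and Q: "transpose Q = Q" and T: "0 \<le> T"
  shows "continuous_on {0..T} (moment X Q)"
proof -
  have "continuous_on {0..T} (\<lambda>t. x0 \<bullet> (Q *v x0) + integral {0..t} (moment X (moment_gen A C Q)))"
    by (intro continuous_intros indefinite_integral_continuous_1 moment_integrable(1)[OF sol T])
  then show ?thesis
    by (rule continuous_on_eq) (simp add: moment_ode[OF sol Q])
qed

text \<open>The integrand of the moment equation is again a moment, for the matrix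
  \<open>moment_gen A C Q\<close>, hence continuous, and the fundamental theorem of calculus
  applies.\<close>

lemma moment_derivative:
  assumes sol: "ito_solution M F W A C x0 X" and Q: "transpose Q = Q" and t: "0 < t"
  shows "(moment X Q has_real_derivative moment X (moment_gen A C Q) t) (at t)"
proof -
  let ?g = "moment X (moment_gen A C Q)"
  have "((\<lambda>t. integral {0..t} ?g) has_real_derivative ?g t) (at t within {0..t + 1})"
    using t by (intro integral_has_real_derivative moment_continuous[OF sol transpose_moment_gen[OF Q]]) auto
  then have "((\<lambda>t. x0 \<bullet> (Q *v x0) + integral {0..t} ?g) has_real_derivative ?g t) (at t within {0..t + 1})"
    by (auto intro!: derivative_eq_intros)
  moreover have "at t within {0..t + 1} = at t" using t by (intro at_within_interior) simp
  ultimately have "((\<lambda>t. x0 \<bullet> (Q *v x0) + integral {0..t} ?g) has_real_derivative ?g t) (at t)" by simp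
  then show ?thesis
    by (rule has_field_derivative_transform_within_open[where S = "{0<..}"]) (use t in \<open>auto simp: moment_ode[OF sol Q]\<close>)
qed

lemma nn_moment:
  assumes sol: "ito_solution M F W A C x0 X" and t: "0 \<le> t"
  shows "(\<integral>\<^sup>+\<omega>. ennreal (X t \<omega> \<bullet> X t \<omega>) \<partial>M) = ennreal (moment X (mat 1) t)"
    and "sqint M (X t)"
proof -
  show X: "sqint M (X t)" by (rule solution_decomposition[OF sol t])
  show "(\<integral>\<^sup>+\<omega>. ennreal (X t \<omega> \<bullet> X t \<omega>) \<partial>M) = ennreal (moment X (mat 1) t)"
    using sqint_inner[OF X X] by (simp add: nn_integral_eq_integral)
qed

lemma moment_0:
  assumes "ito_solution M F W A C x0 X" "transpose Q = Q"
  shows "moment X Q 0 = x0 \<bullet> (Q *v x0)"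
  using moment_ode[OF assms order_refl] by simp

lemma moment_bounds:
  assumes sol: "ito_solution M F W A C x0 X" and t: "0 \<le> t"
    and le: "\<And>x. c * (x \<bullet> (P *v x)) \<le> d * (x \<bullet> (Q *v x))"
  shows "c * moment X P t \<le> d * moment X Q t"
proof -
  note X = nn_moment(2)[OF sol t]
  have "expectation (\<lambda>\<omega>. c * (X t \<omega> \<bullet> (P *v X t \<omega>))) \<le> expectation (\<lambda>\<omega>. d * (X t \<omega> \<bullet> (Q *v X t \<omega>)))"
    by (intro integral_mono le Bochner_Integration.integrable_mult_right sqint_inner sqint_mv X)
  then show ?thesis by simp
qed

text \<open>The moment of \<open>Q\<close> decays at rate \<open>2 \<epsilon>\<close>; comparing its
  form with the Euclidean one at both ends costs the factor \<open>q2 / q1\<close>, which becomes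
  the constant of the estimate.\<close>

lemma lyapunov_ms_exp_stable:
  assumes e: "\<epsilon> > 0" and Q: "transpose Q = Q" and pd: "\<And>x. x \<noteq> 0 \<Longrightarrow> 0 < x \<bullet> (Q *v x)"
    and le: "\<And>x. 2 * (x \<bullet> (Q *v (A *v x))) + (C *v x) \<bullet> (Q *v (C *v x)) \<le> - 2 * \<epsilon> * (x \<bullet> (Q *v x))"
  shows "ms_exp_stable M F W A C"
proof -
  obtain q1 q2 where q: "0 < q1" "0 < q2" "\<And>x. q1 * (x \<bullet> x) \<le> x \<bullet> (Q *v x)" "\<And>x. x \<bullet> (Q *v x) \<le> q2 * (x \<bullet> x)"
    using pd_bounds[OF pd] by blast
  have gen: "1 * (x \<bullet> (moment_gen A C Q *v x)) \<le> (- 2 * \<epsilon>) * (x \<bullet> (Q *v x))" for x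
    using le[of x] inner_symmetric_mv[OF Q, of x "A *v x"] by (simp add: inner_moment_gen[OF Q])
  have "(\<integral>\<^sup>+\<omega>. ennreal (X t \<omega> \<bullet> X t \<omega>) \<partial>M)
        \<le> ennreal (q2 / q1 * exp (- (2 * \<epsilon>) * t)) * (\<integral>\<^sup>+\<omega>. ennreal (X 0 \<omega> \<bullet> X 0 \<omega>) \<partial>M)"
    if sol: "ito_solution M F W A C x0 X" and t: "0 \<le> t" for x0 X t
  proof -
    have "q1 * moment X (mat 1) t \<le> 1 * moment X Q t"
      by (rule moment_bounds[OF sol t]) (use q in simp)
    also have "moment X Q t \<le> moment X Q 0 * exp (- (2 * \<epsilon>) * t)"
    proof (rule gronwall_decay[OF moment_continuous[OF sol Q t] moment_derivative[OF sol Q] _ t])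
      fix s :: real assume "0 < s"
      then have "1 * moment X (moment_gen A C Q) s \<le> (- 2 * \<epsilon>) * moment X Q s"
        by (intro moment_bounds[OF sol _ gen]) simp
      then show "moment X (moment_gen A C Q) s \<le> - (2 * \<epsilon>) * moment X Q s" by simp
    qed
    also have "\<dots> \<le> (q2 * moment X (mat 1) 0) * exp (- (2 * \<epsilon>) * t)"
      using moment_bounds[OF sol order_refl, of 1 Q q2 "mat 1"] q by (intro mult_right_mono) auto
    finally have "moment X (mat 1) t \<le> (q2 / q1 * exp (- (2 * \<epsilon>) * t)) * moment X (mat 1) 0"
      using q by (simp add: field_simps)
    then have "ennreal (moment X (mat 1) t) \<le> ennreal ((q2 / q1 * exp (- (2 * \<epsilon>) * t)) * moment X (mat 1) 0)"
      by (rule ennreal_leI)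
    also have "\<dots> = ennreal (q2 / q1 * exp (- (2 * \<epsilon>) * t)) * ennreal (moment X (mat 1) 0)"
      using q by (intro ennreal_mult) auto
    finally show ?thesis using nn_moment(1)[OF sol t] nn_moment(1)[OF sol order_refl] by simp
  qed
  moreover have "q2 / q1 > 0" "2 * \<epsilon> > 0" using q e by auto
  ultimately show ?thesis unfolding ms_exp_stable_def by blast
qed

text \<open>\<open>S\<close> is the second moment matrix integrated over \<open>[0,T]\<close> and summed over the standard basis as
  initial values; \<open>T\<close> is so large that the moments at time \<open>T\<close> are smaller than the initial ones.\<close>

lemma stable_moment_matrix:
  fixes A C :: "real^'n^'n"
  assumes stab: "ms_exp_stable M F W A C"
  obtains S Q where "transpose S = S" "\<And>x. 0 \<le> x \<bullet> (S *v x)" "S ** Q = mat 1" "Q ** S = mat 1" "transpose Q = Q"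
    "trace (moment_gen A C Q ** S) < 0"
proof -
  obtain \<beta>1 \<beta>2 where \<beta>: "\<beta>1 > 0" "\<beta>2 > 0" and decay: "\<forall>x0 X. ito_solution M F W A C x0 X \<longrightarrow> (\<forall>t\<ge>0.
      (\<integral>\<^sup>+\<omega>. ennreal (X t \<omega> \<bullet> X t \<omega>) \<partial>M) \<le> ennreal (\<beta>1 * exp (- \<beta>2 * t)) * (\<integral>\<^sup>+\<omega>. ennreal (X 0 \<omega> \<bullet> X 0 \<omega>) \<partial>M))"
    using stab unfolding ms_exp_stable_def by blast
  define X where "X i = euler_limit A C (axis i 1 :: real^'n)" for i
  have sol: "ito_solution M F W A C (axis i 1) (X i)" for i unfolding X_def by (rule euler_limit_solution)
  have tr1: "transpose (mat 1 :: real^'n^'n) = mat 1" by (rule transpose_mat)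
  have bound: "moment (X i) (mat 1) t \<le> \<beta>1 * exp (- \<beta>2 * t)" if t: "0 \<le> t" for i t
  proof -
    have "moment (X i) (mat 1) 0 = 1" unfolding moment_0[OF sol tr1] by (simp add: norm_eq_1[symmetric])
    then have "ennreal (moment (X i) (mat 1) t) \<le> ennreal (\<beta>1 * exp (- \<beta>2 * t))"
      using decay[rule_format, OF sol t, of i] unfolding nn_moment(1)[OF sol t] nn_moment(1)[OF sol order_refl] by simp
    then show ?thesis using \<beta> by (subst (asm) ennreal_le_iff) auto
  qed
  \<comment> \<open>The factor \<open>CARD('n)\<close> counts the initial values: the terminal
    moments of all basis solutions together must stay below 1.\<close>
  obtain T where T: "0 < T" "CARD('n) * (\<beta>1 * exp (- \<beta>2 * T)) < 1"
  proof -
    have "((\<lambda>t. CARD('n) * (\<beta>1 * exp (- \<beta>2 * t))) \<longlongrightarrow> CARD('n) * (\<beta>1 * 0)) at_top"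
      using \<beta>
      by (intro tendsto_intros filterlim_compose[OF exp_at_bot] filterlim_tendsto_neg_mult_at_bot[OF tendsto_const _ filterlim_ident]) auto
    then have "\<forall>\<^sub>F t in at_top. CARD('n) * (\<beta>1 * exp (- \<beta>2 * t)) < 1"
      by (rule order_tendstoD) simp
    then have "\<forall>\<^sub>F t in at_top. CARD('n) * (\<beta>1 * exp (- \<beta>2 * t)) < 1 \<and> 0 < t"
      using eventually_gt_at_top by (rule eventually_conj)
    then show ?thesis using that by (auto simp: eventually_at_top_linorder)
  qed
  have T0: "0 \<le> T" using T by simp
  note XP = solution_sqint_PM[OF sol T0]
  define S :: "real^'n^'n" where "S = (\<chi> p q. \<Sum>i\<in>UNIV. \<integral>x. X i (fst x) (snd x) $ p * X i (fst x) (snd x) $ q \<partial>PM T)"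
  have coord: "integrable (PM T) (\<lambda>x. X i (fst x) (snd x) $ p * X i (fst x) (snd x) $ q)" for i p q
    using sqint_inner[OF sqint_linear[OF bounded_linear_vec_nth XP[of i], of p] sqint_linear[OF bounded_linear_vec_nth XP[of i], of q]]
    by simp
  \<comment> \<open>The right-hand side is \<open>trace (N ** S)\<close>, since \<open>S\<close> is
    symmetric. Every statement about \<open>S\<close> below is obtained by choosing
    \<open>N\<close>.\<close>
  have J: "(\<Sum>i\<in>UNIV. integral {0..T} (moment (X i) N)) = (\<Sum>p\<in>UNIV. \<Sum>q\<in>UNIV. N $ p $ q * S $ p $ q)" for N
  proof -
    have "integral {0..T} (moment (X i) N)
        = (\<Sum>p\<in>UNIV. \<Sum>q\<in>UNIV. N $ p $ q * (\<integral>x. X i (fst x) (snd x) $ p * X i (fst x) (snd x) $ q \<partial>PM T))" for i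
    proof -
      have "integral {0..T} (moment (X i) N) = (\<integral>x. X i (fst x) (snd x) \<bullet> (N *v X i (fst x) (snd x)) \<partial>PM T)"
        by (rule moment_integrable(2)[OF sol T0, symmetric])
      also have "\<dots> = (\<integral>x. (\<Sum>p\<in>UNIV. \<Sum>q\<in>UNIV. N $ p $ q * (X i (fst x) (snd x) $ p * X i (fst x) (snd x) $ q)) \<partial>PM T)"
        by (simp add: inner_vec_def matrix_vector_mult_def sum_distrib_left mult_ac)
      also have "\<dots> = (\<Sum>p\<in>UNIV. \<Sum>q\<in>UNIV. \<integral>x. N $ p $ q * (X i (fst x) (snd x) $ p * X i (fst x) (snd x) $ q) \<partial>PM T)"
        by (rule integral_double_sum) (intro Bochner_Integration.integrable_mult_right coord)
      finally show ?thesis by simp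
    qed
    then have "(\<Sum>i\<in>UNIV. integral {0..T} (moment (X i) N))
        = (\<Sum>i\<in>UNIV. \<Sum>p\<in>UNIV. \<Sum>q\<in>UNIV. N $ p $ q * (\<integral>x. X i (fst x) (snd x) $ p * X i (fst x) (snd x) $ q \<partial>PM T))" by simp
    also have "\<dots> = (\<Sum>p\<in>UNIV. \<Sum>q\<in>UNIV. \<Sum>i\<in>UNIV. N $ p $ q * (\<integral>x. X i (fst x) (snd x) $ p * X i (fst x) (snd x) $ q \<partial>PM T))"
      by (rule trans[OF sum.swap sum.cong[OF refl sum.swap]])
    finally show ?thesis by (simp add: S_def sum_distrib_left)
  qed
  have symS: "transpose S = S" by (simp add: S_def transpose_def vec_eq_iff mult.commute)
  have pd: "0 < x \<bullet> (S *v x)" if x: "x \<noteq> 0" for x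
  proof -
    \<comment> \<open>With this dyad the form of \<open>S\<close> at \<open>x\<close> integrates the
      mean squares of \<open>x \<bullet> X i\<close>. They are continuous and nonnegative, and for
      some \<open>i\<close> positive at time 0, since the initial values form a basis.\<close>
    define N :: "real^'n^'n" where "N = (\<chi> p q. x $ p * x $ q)"
    have N: "y \<bullet> (N *v y) = (x \<bullet> y)\<^sup>2" for y
      by (simp add: N_def inner_vec_def matrix_vector_mult_def power2_eq_square sum_product sum_distrib_left mult_ac)
    have trN: "transpose N = N" by (simp add: N_def transpose_def vec_eq_iff mult.commute)
    have "x \<bullet> (S *v x) = (\<Sum>p\<in>UNIV. \<Sum>q\<in>UNIV. N $ p $ q * S $ p $ q)"
      by (simp add: N_def inner_vec_def matrix_vector_mult_def sum_distrib_left mult_ac)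
    then have eq: "x \<bullet> (S *v x) = (\<Sum>i\<in>UNIV. integral {0..T} (moment (X i) N))" by (simp add: J)
    have nn: "0 \<le> moment (X i) N s" for i s unfolding N by simp
    have nnI: "0 \<le> integral {0..T} (moment (X i) N)" for i
      by (rule integral_nonneg[OF moment_integrable(1)[OF sol T0] nn])
    obtain i where i: "x $ i \<noteq> 0" using x by (auto simp: vec_eq_iff)
    have "moment (X i) N 0 = (x $ i)\<^sup>2" by (rule trans[OF moment_0[OF sol trN] trans[OF N]]) (simp add: inner_axis)
    then have "moment (X i) N 0 \<noteq> 0" using i by simp
    then have "integral {0..T} (moment (X i) N) \<noteq> 0"
      using integral_eq_0_iff[OF moment_continuous[OF sol trN T0] T(1) nn] T0 by auto
    with nnI[of i] have "0 < integral {0..T} (moment (X i) N)" by simp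
    then show ?thesis unfolding eq by (intro sum_pos2[OF _ UNIV_I]) (auto simp: nnI)
  qed
  obtain Q where Q: "S ** Q = mat 1" "Q ** S = mat 1" "transpose Q = Q" "\<And>x. x \<noteq> 0 \<Longrightarrow> 0 < x \<bullet> (Q *v x)"
    using pd_inverse[OF symS pd] by blast
  have Q0: "0 \<le> x \<bullet> (Q *v x)" for x using Q(4)[of x] by (cases "x = 0") auto
  have trQ: "0 < trace Q"
    unfolding trace_def
  proof (rule sum_pos)
    fix i :: 'n
    have "axis i (1::real) \<noteq> 0" by (simp add: axis_eq_0_iff)
    from Q(4)[OF this] show "0 < Q $ i $ i" unfolding inner_axis_mv .
  qed auto
  have "trace (moment_gen A C Q ** S) = (\<Sum>p\<in>UNIV. \<Sum>q\<in>UNIV. moment_gen A C Q $ p $ q * S $ p $ q)"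
    unfolding trace_def matrix_matrix_mult_def using symS by (auto simp: transpose_def vec_eq_iff intro!: sum.cong)
  also have "\<dots> = (\<Sum>i\<in>UNIV. integral {0..T} (moment (X i) (moment_gen A C Q)))" by (rule J[symmetric])
  \<comment> \<open>The integral of the generator is the terminal minus the initial moment; the
    initial ones add up to \<open>trace Q\<close>.\<close>
  also have "\<dots> = (\<Sum>i\<in>UNIV. moment (X i) Q T - Q $ i $ i)"
    using moment_ode[OF sol Q(3) T0] by (intro sum.cong refl) (simp add: inner_axis_mv)
  \<comment> \<open>Bounding the form of \<open>Q\<close> by its trace makes \<open>trace Q\<close>
    a common factor, so \<open>T\<close> could be chosen before \<open>Q\<close> was known.\<close>
  also have "\<dots> \<le> (\<Sum>i\<in>UNIV. trace Q * (\<beta>1 * exp (- \<beta>2 * T)) - Q $ i $ i)"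
  proof (intro sum_mono diff_right_mono)
    fix i
    have "1 * moment (X i) Q T \<le> trace Q * moment (X i) (mat 1) T"
      by (rule moment_bounds[OF sol T0]) (use psd_le_trace[OF Q(3) Q0] in simp)
    also have "\<dots> \<le> trace Q * (\<beta>1 * exp (- \<beta>2 * T))"
      using bound[OF T0] trQ by (intro mult_left_mono) auto
    finally show "moment (X i) Q T \<le> trace Q * (\<beta>1 * exp (- \<beta>2 * T))" by simp
  qed
  also have "\<dots> = trace Q * (CARD('n) * (\<beta>1 * exp (- \<beta>2 * T)) - 1)"
    by (simp add: sum_subtractf trace_def algebra_simps)
  also have "\<dots> < 0" using T trQ by (intro mult_pos_neg) auto
  finally have "trace (moment_gen A C Q ** S) < 0" .
  moreover have "0 \<le> x \<bullet> (S *v x)" for x using pd[of x] by (cases "x = 0") auto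
  ultimately show ?thesis using that[OF symS _ Q(1,2,3)] by blast
qed

end

section \<open>Rank-one identities and the equivalence\<close>

lemma single_input_trace:
  fixes B :: "real^1^'n" and K :: "real^'n^1"
  shows "trace (B ** K) = row 1 K \<bullet> column 1 B"
  by (simp add: trace_def matrix_matrix_mult_def row_def column_def inner_vec_def sum_1 mult_ac)

theorem theorem17:
  fixes M :: "'a measure" and F :: "real \<Rightarrow> 'a measure" and \<Delta> :: "real \<Rightarrow> 'a \<Rightarrow> real"
    and A :: "real^'n^'n" and B :: "real^1^'n" and \<mu> \<sigma> :: real
  assumes "wiener_process M F \<Delta>"
    and "\<mu> \<noteq> 0" and "\<sigma> > 0"
    and "\<forall>z \<in># eigvals A. Re z > 0"
    and "stabilizable A B"
  shows "(\<exists>K :: real^'n^1. ms_exp_stable M F \<Delta> (A + \<mu> *\<^sub>R (B ** K)) (\<sigma> *\<^sub>R (B ** K)))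
    \<longleftrightarrow> 2 * (\<sigma>\<^sup>2 / \<mu>\<^sup>2) * Re (\<Sum>\<^sub># (eigvals A)) < 1"
proof -
  interpret wiener_process M F \<Delta> by fact
  have trace: "Re (\<Sum>\<^sub># (eigvals A)) = trace A" by (simp add: sum_eigvals)
  show ?thesis
    unfolding trace
  proof
    assume tr: "2 * (\<sigma>\<^sup>2 / \<mu>\<^sup>2) * trace A < 1"
    obtain K :: "real^'n^1" and Q and \<epsilon> where Q: "\<epsilon> > 0" "transpose Q = Q" "\<And>x. x \<noteq> 0 \<Longrightarrow> 0 < x \<bullet> (Q *v x)"
      "\<And>x. 2 * (x \<bullet> (Q *v ((A + \<mu> *\<^sub>R (B ** K)) *v x)))
        + ((\<sigma> *\<^sub>R (B ** K)) *v x) \<bullet> (Q *v ((\<sigma> *\<^sub>R (B ** K)) *v x)) \<le> - 2 * \<epsilon> * (x \<bullet> (Q *v x))"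
      by (rule stabilizing_feedback_exists[OF assms(2-5) tr], rule that)
    show "\<exists>K :: real^'n^1. ms_exp_stable M F \<Delta> (A + \<mu> *\<^sub>R (B ** K)) (\<sigma> *\<^sub>R (B ** K))"
      by (rule exI, rule lyapunov_ms_exp_stable[OF Q])
  next
    assume "\<exists>K :: real^'n^1. ms_exp_stable M F \<Delta> (A + \<mu> *\<^sub>R (B ** K)) (\<sigma> *\<^sub>R (B ** K))"
    then obtain K :: "real^'n^1" where K: "ms_exp_stable M F \<Delta> (A + \<mu> *\<^sub>R (B ** K)) (\<sigma> *\<^sub>R (B ** K))" ..
    let ?A = "A + \<mu> *\<^sub>R (B ** K)" and ?C = "\<sigma> *\<^sub>R (B ** K)" and ?k = "row 1 K" and ?b = "column 1 B"
    obtain S Q where S: "transpose S = S" "\<And>x. 0 \<le> x \<bullet> (S *v x)" "S ** Q = mat 1" "Q ** S = mat 1" "transpose Q = Q"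
      and neg: "trace (moment_gen ?A ?C Q ** S) < 0"
      by (rule stable_moment_matrix[OF K]) iprover
    have trace_scaleR: "trace (c *\<^sub>R X) = c * trace X" for c and X :: "real^'n^'n"
      by (simp add: trace_def sum_distrib_left)
    note sc = matrix_mult_scaleR transpose_scaleR trace_scaleR
    have "trace (moment_gen ?A ?C Q ** S) = trace (Q ** ?A ** S) + trace (transpose ?A ** Q ** S) + trace (transpose ?C ** Q ** ?C ** S)"
      by (simp add: moment_gen_def matrix_add_rdistrib trace_add)
    \<comment> \<open>As \<open>S\<close> and \<open>Q\<close> are inverse to each other, both drift
      terms lose them under the cyclic trace.\<close>
    also have "trace (Q ** ?A ** S) = trace ?A"
      by (subst trace_mul_sym) (simp add: matrix_mul_assoc S)
    also have "trace (transpose ?A ** Q ** S) = trace ?A"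
      by (simp add: matrix_mul_assoc[symmetric] S trace_transpose)
    also have "trace ?A = trace A + \<mu> * (?k \<bullet> ?b)"
      by (simp add: trace_add sc single_input_trace)
    also have "trace (transpose ?C ** Q ** ?C ** S) = \<sigma>\<^sup>2 * ((?k \<bullet> (S *v ?k)) * (?b \<bullet> (Q *v ?b)))"
    proof -
      \<comment> \<open>With a single input \<open>B K\<close> has rank one, so the covariance
        injected by the noise is a scalar multiple of \<open>B B\<^sup>T\<close>, and its trace
        against \<open>Q\<close> is a product of two scalars.\<close>
      have "(B ** K) ** (S ** transpose (B ** K)) = (?k \<bullet> (S *v ?k)) *\<^sub>R (B ** transpose B)"
      proof (subst matrix_eq, intro allI)
        fix x
        have "transpose (B ** K) *v x = (?b \<bullet> x) *\<^sub>R ?k"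
          by (simp add: matrix_transpose_mul single_input_mv row_transpose column_transpose del: transpose_matrix_vector)
        moreover have l: "((B ** K) ** (S ** transpose (B ** K))) *v x = (B ** K) *v (S *v (transpose (B ** K) *v x))"
          by (simp only: matrix_vector_mul_assoc)
        ultimately show "((B ** K) ** (S ** transpose (B ** K))) *v x = ((?k \<bullet> (S *v ?k)) *\<^sub>R (B ** transpose B)) *v x"
          unfolding l by (simp add: single_input_mv scaleR_matrix_vector_assoc[symmetric]
              matrix_vector_mult_scaleR row_transpose mult.commute del: transpose_matrix_vector)
      qed
      moreover have "trace (transpose (B ** K) ** Q ** (B ** K) ** S) = trace (Q ** ((B ** K) ** (S ** transpose (B ** K))))"
        by (subst matrix_mul_assoc[symmetric], subst matrix_mul_assoc[symmetric], subst trace_mul_sym) (simp add: matrix_mul_assoc)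
      ultimately have "trace (transpose (B ** K) ** Q ** (B ** K) ** S) = (?k \<bullet> (S *v ?k)) * (?b \<bullet> (Q *v ?b))"
        by (simp add: sc trace_dyad)
      then show ?thesis by (simp add: sc power2_eq_square)
    qed
    finally have "2 * trace A + 2 * \<mu> * (?k \<bullet> ?b) + \<sigma>\<^sup>2 * ((?k \<bullet> (S *v ?k)) * (?b \<bullet> (Q *v ?b))) < 0"
      using neg by (simp add: algebra_simps)
    then show "2 * (\<sigma>\<^sup>2 / \<mu>\<^sup>2) * trace A < 1"
      by (rule trace_condition_necessary[OF assms(2,3) S(1-3)])
  qed
qed

end
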